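(* For all $\rho\in\mathscr I$, $F(\rho)=F_{\mathrm{DM}}(\rho):=\inf_{\Gamma\mapsto\rho}\operatorname{Tr}\Gamma H_0$, where the infimum is over density matrices $\Gamma=\sum_k\lambda_k\langle\Psi_k,\cdot\rangle\Psi_k$ (possibly infinite convex sums, $\lambda_k\ge0$, $\sum_k\lambda_k=1$, $\Psi_k\in\mathscr W$ mutually orthogonal) with density $\sum_k\lambda_k\rho_{\Psi_k}=\rho$, and $\operatorname{Tr}\Gamma H_0=\sum_k\lambda_k\langle\Psi_k,H_0\Psi_k\rangle$.
   Context: $\mathbb{T}$ is the one-dimensional torus $[0,1]$ with $0,1$ identified; $N\ge1$. $\mathcal{H}=(L^2(\mathbb{T})\otimes\mathbb{C}^2)^{\wedge N}$, $\mathscr{W}=\{\Psi\in(H^1(\mathbb{T})\otimes\mathbb{C}^2)^{\wedge N}:\|\Psi\|_{\mathcal H}=1\}$, $T(\Psi)=\frac12\sum_j\|\nabla_j\Psi\|^2$, $\rho_\Psi(x)=N\sum_{\sigma}\int|\Psi(x\sigma_1,x_2\sigma_2,\dots)|^2dx_2\cdots dx_N$. A form $B$ is kinetically bounded if $|B(\Psi,\Psi)|\le aT(\Psi)+b$ on $\mathscr W$ for some $a,b\ge0$; the infimum of such $a$ is the relative kinetic bound. $W$ is a positive quadratic form on $(H^1(\mathbb{T})\otimes\mathbb{C}^2)^{\wedge N}$, kinetically bounded with relative bound $<1$; $\langle\Psi,H_0\Psi\rangle=T(\Psi)+W(\Psi,\Psi)$. $\mathscr X=\{\rho\in H^1(\mathbb{T})\mid\int\rho=N\}$,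 $\mathscr I=\{\rho\in L^1(\mathbb{T})\mid\nabla\sqrt\rho\in L^2,\rho\ge0,\int\rho=N\}$, and $\mathscr X^*$ is $H^{-1}(\mathbb{T})=\{f+\nabla g: f,g\in L^2(\mathbb{T})\}$ modulo additive constants, with pairing $\langle v,\rho\rangle=\int f\rho-\int g\nabla\rho$. For $v\in\mathscr X^*$ let $E(v)=\inf_{\Psi\in\mathscr W}\{\langle\Psi,H_0\Psi\rangle+\langle v,\rho_\Psi\rangle\}$, and for $\rho\in\mathscr X$ let $F(\rho)=\sup_{v\in\mathscr X^*}\{E(v)-\langle v,\rho\rangle\}$. *)

theory Defs
  imports "HOL-Analysis.Analysis" "HOL-Combinatorics.Permutations"
begin

text \<open>Conventions. The torus T is modelled by the interval [0,1] with Lebesgue measure.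
  An N-particle wave function is a function of positions x (extensional on {..<N})
  and spins s (extensional on {..<N}, True/False = up/down); particle indices are 0..N-1.\<close>

type_synonym wavefn = "(nat \<Rightarrow> real) \<Rightarrow> (nat \<Rightarrow> bool) \<Rightarrow> complex"

definition U :: "real measure" where
  "U = restrict_space lborel {0..1}"

definition cube :: "nat \<Rightarrow> (nat \<Rightarrow> real) measure" where
  "cube N = PiM {..<N} (\<lambda>_. U)"

definition spins :: "nat \<Rightarrow> (nat \<Rightarrow> bool) set" where
  "spins N = PiE {..<N} (\<lambda>_. UNIV)"

definition L2T :: "(real \<Rightarrow> real) \<Rightarrow> bool" where
  "L2T f \<longleftrightarrow> f \<in> borel_measurable U \<and> integrable U (\<lambda>x. (f x)\<^sup>2)"

text \<open>Weak (periodic) derivative on the torus, tested against the Fourier modes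
  exp(-2 pi i k x), k in Z (dense in the periodic test functions).\<close>
definition weak_derivT :: "(real \<Rightarrow> real) \<Rightarrow> (real \<Rightarrow> real) \<Rightarrow> bool" where
  "weak_derivT f d \<longleftrightarrow> L2T f \<and> L2T d \<and>
     (\<forall>k::int. (\<integral>x. complex_of_real (d x) * cis (- 2 * pi * of_int k * x) \<partial>U)
        = 2 * pi * \<i> * of_int k * (\<integral>x. complex_of_real (f x) * cis (- 2 * pi * of_int k * x) \<partial>U))"

definition H1T :: "(real \<Rightarrow> real) \<Rightarrow> bool" where
  "H1T f \<longleftrightarrow> (\<exists>d. weak_derivT f d)"

definition derivT :: "(real \<Rightarrow> real) \<Rightarrow> real \<Rightarrow> real" where
  "derivT f = (SOME d. weak_derivT f d)"

definition Iset :: "nat \<Rightarrow> (real \<Rightarrow> real) set" where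
  "Iset N = {\<rho>. \<rho> \<in> borel_measurable U \<and> integrable U \<rho> \<and> (AE x in U. 0 \<le> \<rho> x)
               \<and> H1T (\<lambda>x. sqrt (\<rho> x)) \<and> (\<integral>x. \<rho> x \<partial>U) = real N}"

text \<open>Elements of X* = H^{-1}(T) are represented by pairs (f,g) of L^2 functions, v = f + grad g;
  pairing with rho in H^1: int f rho - int g rho'.\<close>
definition pairing :: "(real \<Rightarrow> real) \<times> (real \<Rightarrow> real) \<Rightarrow> (real \<Rightarrow> real) \<Rightarrow> real" where
  "pairing v \<rho> = (\<integral>x. fst v x * \<rho> x \<partial>U) - (\<integral>x. snd v x * derivT \<rho> x \<partial>U)"

definition L2 :: "nat \<Rightarrow> wavefn \<Rightarrow> bool" where
  "L2 N \<Psi> \<longleftrightarrow> (\<forall>s\<in>spins N. (\<lambda>x. \<Psi> x s) \<in> borel_measurable (cube N)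
                      \<and> integrable (cube N) (\<lambda>x. (cmod (\<Psi> x s))\<^sup>2))"

definition normsq :: "nat \<Rightarrow> wavefn \<Rightarrow> real" where
  "normsq N \<Psi> = (\<Sum>s\<in>spins N. \<integral>x. (cmod (\<Psi> x s))\<^sup>2 \<partial>cube N)"

definition inner_wf :: "nat \<Rightarrow> wavefn \<Rightarrow> wavefn \<Rightarrow> complex" where
  "inner_wf N \<Phi> \<Psi> = (\<Sum>s\<in>spins N. \<integral>x. cnj (\<Phi> x s) * \<Psi> x s \<partial>cube N)"

definition emode :: "nat \<Rightarrow> (nat \<Rightarrow> int) \<Rightarrow> (nat \<Rightarrow> real) \<Rightarrow> complex" where
  "emode N k x = cis (2 * pi * (\<Sum>j<N. of_int (k j) * x j))"

definition is_pderiv :: "nat \<Rightarrow> nat \<Rightarrow> wavefn \<Rightarrow> wavefn \<Rightarrow> bool" where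
  "is_pderiv N j \<Psi> G \<longleftrightarrow> L2 N \<Psi> \<and> L2 N G \<and>
     (\<forall>s\<in>spins N. \<forall>k::nat \<Rightarrow> int.
        (\<integral>x. G x s * cnj (emode N k x) \<partial>cube N)
          = 2 * pi * \<i> * of_int (k j) * (\<integral>x. \<Psi> x s * cnj (emode N k x) \<partial>cube N))"

definition pderiv_wf :: "nat \<Rightarrow> nat \<Rightarrow> wavefn \<Rightarrow> wavefn" where
  "pderiv_wf N j \<Psi> = (SOME G. is_pderiv N j \<Psi> G)"

definition H1 :: "nat \<Rightarrow> wavefn \<Rightarrow> bool" where
  "H1 N \<Psi> \<longleftrightarrow> L2 N \<Psi> \<and> (\<forall>j<N. \<exists>G. is_pderiv N j \<Psi> G)"

definition antisym_wf :: "nat \<Rightarrow> wavefn \<Rightarrow> bool" where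
  "antisym_wf N \<Psi> \<longleftrightarrow> (\<forall>p. p permutes {..<N} \<longrightarrow>
     (\<forall>s\<in>spins N. AE x in cube N. \<Psi> (x \<circ> p) (s \<circ> p) = of_int (sign p) * \<Psi> x s))"

definition Vspace :: "nat \<Rightarrow> wavefn set" where
  "Vspace N = {\<Psi>. H1 N \<Psi> \<and> antisym_wf N \<Psi>}"

definition Wset :: "nat \<Rightarrow> wavefn set" where
  "Wset N = {\<Psi>. \<Psi> \<in> Vspace N \<and> normsq N \<Psi> = 1}"

definition kin :: "nat \<Rightarrow> wavefn \<Rightarrow> real" where
  "kin N \<Psi> = 1/2 * (\<Sum>j<N. normsq N (pderiv_wf N j \<Psi>))"

definition density :: "nat \<Rightarrow> wavefn \<Rightarrow> real \<Rightarrow> real" where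
  "density N \<Psi> x = real N * (\<Sum>s\<in>spins N.
      \<integral>y. (cmod (\<Psi> (y(0 := x)) s))\<^sup>2 \<partial>(PiM {1..<N} (\<lambda>_. U)))"

definition energy :: "nat \<Rightarrow> (wavefn \<Rightarrow> wavefn \<Rightarrow> complex) \<Rightarrow> wavefn \<Rightarrow> real" where
  "energy N W \<Psi> = kin N \<Psi> + Re (W \<Psi> \<Psi>)"

definition positive_sesq_form :: "nat \<Rightarrow> (wavefn \<Rightarrow> wavefn \<Rightarrow> complex) \<Rightarrow> bool" where
  "positive_sesq_form N W \<longleftrightarrow>
     (\<forall>\<Phi>\<in>Vspace N. \<forall>\<Psi>\<in>Vspace N. \<forall>Z\<in>Vspace N. \<forall>c::complex.
        W (\<lambda>x s. \<Phi> x s + c * \<Psi> x s) Z = W \<Phi> Z + cnj c * W \<Psi> Z)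
   \<and> (\<forall>\<Phi>\<in>Vspace N. \<forall>\<Psi>\<in>Vspace N. W \<Psi> \<Phi> = cnj (W \<Phi> \<Psi>))
   \<and> (\<forall>\<Psi>\<in>Vspace N. \<forall>Z\<in>Vspace N. normsq N \<Psi> = 0 \<longrightarrow> W \<Psi> Z = 0)
   \<and> (\<forall>\<Psi>\<in>Vspace N. 0 \<le> Re (W \<Psi> \<Psi>))"

definition kin_bounded_lt1 :: "nat \<Rightarrow> (wavefn \<Rightarrow> wavefn \<Rightarrow> complex) \<Rightarrow> bool" where
  "kin_bounded_lt1 N W \<longleftrightarrow> (\<exists>a b. 0 \<le> a \<and> a < 1 \<and> 0 \<le> b \<and>
      (\<forall>\<Psi>\<in>Wset N. cmod (W \<Psi> \<Psi>) \<le> a * kin N \<Psi> + b))"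

definition Efun :: "nat \<Rightarrow> (wavefn \<Rightarrow> wavefn \<Rightarrow> complex) \<Rightarrow> (real \<Rightarrow> real) \<times> (real \<Rightarrow> real) \<Rightarrow> ereal" where
  "Efun N W v = (INF \<Psi>\<in>Wset N. ereal (energy N W \<Psi> + pairing v (density N \<Psi>)))"

definition Ffun :: "nat \<Rightarrow> (wavefn \<Rightarrow> wavefn \<Rightarrow> complex) \<Rightarrow> (real \<Rightarrow> real) \<Rightarrow> ereal" where
  "Ffun N W \<rho> = (SUP v\<in>{v. L2T (fst v) \<and> L2T (snd v)}. Efun N W v - ereal (pairing v \<rho>))"

definition dm_reps :: "nat \<Rightarrow> (real \<Rightarrow> real) \<Rightarrow> ((nat \<Rightarrow> real) \<times> (nat \<Rightarrow> wavefn)) set" where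
  "dm_reps N \<rho> = {(lam, Ps). (\<forall>k. 0 \<le> lam k) \<and> lam sums 1 \<and> (\<forall>k. Ps k \<in> Wset N)
      \<and> (\<forall>k l. k \<noteq> l \<longrightarrow> inner_wf N (Ps k) (Ps l) = 0)
      \<and> (AE x in U. (\<lambda>k. lam k * density N (Ps k) x) sums \<rho> x)}"

definition F_DM :: "nat \<Rightarrow> (wavefn \<Rightarrow> wavefn \<Rightarrow> complex) \<Rightarrow> (real \<Rightarrow> real) \<Rightarrow> ereal" where
  "F_DM N W \<rho> = (INF \<Gamma>\<in>dm_reps N \<rho>. (\<Sum>k. ereal (fst \<Gamma> k * energy N W (snd \<Gamma> k))))"

end

theory Submission
  imports Defs "HOL-Probability.Probability"
begin

text \<open>
  The inequality \<open>F \<le> F_DM\<close> holds because the bounds \<open>E(v) \<le> E(\<Psi>\<^sub>k) + \<langle>v, \<rho>\<^sub>k\<rangle>\<close> for the pure components of a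
  density matrix can be averaged: the densities \<open>\<rho>\<^sub>k\<close> and their weak derivatives are bounded in \<open>L\<^sup>\<infinity>\<close> and \<open>L\<^sup>2\<close> by a
  multiple of \<open>1 + T(\<Psi>\<^sub>k)\<close>, so that the pairing may be summed term by term.

  Conversely, let \<open>F(\<rho>) = c\<close> be finite. Instead of separating convex sets in \<open>H\<^sup>1\<close>, one nearly minimizes, over finite
  mixtures, the energy plus a quadratic penalty on the deviation of finitely many Fourier coefficients of the
  density from those of \<open>\<rho>\<close>. Stationarity against admixing pure states turns the gradient of the penalty into a trigonometric
  potential \<open>v\<close>, and \<open>E(v) - \<langle>v, \<rho>\<rangle> \<le> c\<close> bounds both energy and deviation. The mixtures are diagonalized by maximizing
  a weighted sum of squared norms. A limit in Fourier coordinates, where the kinetic energy controls high modes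
  and the ordering of the eigenvalues prevents loss of mass, is a density matrix representing \<open>\<rho>\<close> with energy at most
  \<open>c\<close>. Representability of \<open>\<rho>\<close> is a by-product and is not assumed.
\<close>

section \<open>Uniqueness of Fourier coefficients\<close>

text \<open>A mixture is carried as a sequence of unnormalized vectors \<open>X k\<close>, the
  weight of a component being \<open>normsq N (X k)\<close>. Energy, norm and tested densities are
  then sums of quadratic forms, and operations on density matrices become elementary: rotating two
  vectors unitarily keeps every such sum, admixing a state appends a scaled vector, and neither
  operators nor a spectral theorem enter. Weak derivatives are defined by testing against Fourier
  modes, so completeness of the modes is the analytic base: it makes the coefficients coordinates in
  which derivatives are multipliers and antisymmetry is a closed condition. In a limit of mixtures,
  weight can escape to high modes within a component or to components of ever larger index. The
  kinetic energy excludes the former; the latter is controlled only after diagonalization, when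
  small eigenvalues cannot add up to much on finitely many modes. The potentials produced by the
  penalty have no gradient part, so there \<rho> enters through its Fourier coefficients alone;
  square-integrable derivatives of densities matter for the averaging direction, where arbitrary
  \<open>v\<close> occur.\<close>

lemma space_U [simp]: "space U = {0..1}"
  by (simp add: U_def space_restrict_space)

lemma prob_space_U: "prob_space U"
  by (rule prob_spaceI) (simp add: U_def space_restrict_space emeasure_restrict_space)

interpretation U: prob_space U
  by (rule prob_space_U)

lemma id_measurable_U [measurable]: "(\<lambda>x. x) \<in> borel_measurable U"
  unfolding U_def by (rule measurable_restrict_space1) simp

lemma borel_measurable_U: "f \<in> borel_measurable borel \<Longrightarrow> f \<in> borel_measurable U"
  using measurable_compose[OF id_measurable_U] .

lemma AE_U_neq: "AE x in U. x \<noteq> (c::real)"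
proof -
  have "AE x in lborel. x \<noteq> c" by (rule AE_lborel_singleton)
  then show ?thesis unfolding U_def by (subst AE_restrict_space_iff) auto
qed

lemma cis_measurable [measurable]: "cis \<in> borel_measurable borel"
  by (intro borel_measurable_continuous_onI continuous_intros)

text \<open>An inductive predicate, so that closure under products follows by two inductions from
  adding frequencies; products are what polynomials on the circle require.\<close>

inductive trig_poly :: "(real \<Rightarrow> complex) \<Rightarrow> bool" where
  mode: "trig_poly (\<lambda>x. c * cis (- 2 * pi * of_int k * x))"
| add: "trig_poly f \<Longrightarrow> trig_poly g \<Longrightarrow> trig_poly (\<lambda>x. f x + g x)"

lemma trig_poly_mult_mode:
  assumes "trig_poly g"
  shows "trig_poly (\<lambda>x. c * cis (- 2 * pi * of_int k * x) * g x)"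
  using assms
proof induction
  case (mode d l)
  have "(\<lambda>x. c * cis (- 2 * pi * of_int k * x) * (d * cis (- 2 * pi * of_int l * x)))
      = (\<lambda>x. (c * d) * cis (- 2 * pi * of_int (k + l) * x))"
    by (auto simp: fun_eq_iff cis_mult algebra_simps)
  then show ?case using trig_poly.mode[of "c * d" "k + l"] by metis
next
  case (add f g)
  have "(\<lambda>x. c * cis (- 2 * pi * of_int k * x) * (f x + g x))
     = (\<lambda>x. c * cis (- 2 * pi * of_int k * x) * f x + c * cis (- 2 * pi * of_int k * x) * g x)"
    by (auto simp: algebra_simps)
  then show ?case using trig_poly.add[OF add.IH] by simp
qed

lemma trig_poly_mult:
  assumes "trig_poly f" "trig_poly g"
  shows "trig_poly (\<lambda>x. f x * g x)"
  using assms(1)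
proof induction
  case (mode c k)
  then show ?case by (rule trig_poly_mult_mode[OF assms(2)])
next
  case (add f h)
  have "(\<lambda>x. (f x + h x) * g x) = (\<lambda>x. f x * g x + h x * g x)" by (auto simp: algebra_simps)
  then show ?case using trig_poly.add[OF add.IH] by simp
qed

lemma trig_poly_const: "trig_poly (\<lambda>x. c)"
  using trig_poly.mode[of c 0] by simp

text \<open>On the unit circle the real and imaginary parts are combinations of \<open>cis\<close>
  with frequencies 1 and -1, which settles the real-linear generators; sums and products are covered
  by the closure properties.\<close>

lemma trig_poly_of_polynomial:
  fixes g :: "complex \<Rightarrow> real"
  assumes "real_polynomial_function g"
  shows "trig_poly (\<lambda>x. complex_of_real (g (cis (2 * pi * x))))"
  using assms
proof induction
  case (linear f)
  interpret f: bounded_linear f by fact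
  define a b where "a = f 1" and "b = f \<i>"
  have "f z = Re z * a + Im z * b" for z
  proof -
    have "f z = f (Re z *\<^sub>R 1 + Im z *\<^sub>R \<i>)"
      by (rule arg_cong[where f = f]) (simp add: complex_eq_iff)
    then show ?thesis by (simp add: f.add f.scaleR a_def b_def)
  qed
  then have eq: "(\<lambda>x. complex_of_real (f (cis (2 * pi * x))))
    = (\<lambda>x. ((a + \<i> * b) / 2) * cis (- 2 * pi * of_int 1 * x) + ((a - \<i> * b) / 2) * cis (- 2 * pi * of_int (-1) * x))"
    by (auto simp: fun_eq_iff complex_eq_iff field_simps)
  show ?case unfolding eq by (rule trig_poly.add[OF trig_poly.mode trig_poly.mode])
next
  case (const c)
  then show ?case by (rule trig_poly_const)
next
  case (add f g)
  then show ?case using trig_poly.add by force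
next
  case (mult f g)
  then show ?case using trig_poly_mult by force
qed

lemma trig_poly_bounded_measurable:
  assumes "trig_poly f"
  shows "f \<in> borel_measurable borel \<and> (\<exists>B. \<forall>x. cmod (f x) \<le> B)"
  using assms
proof induction
  case (mode c k)
  show ?case by (auto intro!: exI[of _ "cmod c"] simp: norm_mult)
next
  case (add f g)
  then obtain B C where "\<forall>x. cmod (f x) \<le> B" "\<forall>x. cmod (g x) \<le> C" by auto
  then have "\<forall>x. cmod (f x + g x) \<le> B + C" by (meson add_mono norm_triangle_le)
  then show ?case using add by auto
qed

lemma integrable_bounded_mult:
  fixes f g :: "'a \<Rightarrow> complex"
  assumes "integrable M f" "g \<in> borel_measurable M" "\<And>x. x \<in> space M \<Longrightarrow> cmod (g x) \<le> B"
  shows "integrable M (\<lambda>x. f x * g x)"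
proof (rule Bochner_Integration.integrable_bound)
  show "integrable M (\<lambda>x. B *\<^sub>R f x)" using assms by auto
  show "(\<lambda>x. f x * g x) \<in> borel_measurable M" using assms by auto
  show "AE x in M. norm (f x * g x) \<le> norm (B *\<^sub>R f x)"
  proof (rule AE_I2)
    fix x assume "x \<in> space M"
    then have "cmod (g x) \<le> \<bar>B\<bar>" using assms(3) by (meson abs_ge_self order_trans)
    then show "norm (f x * g x) \<le> norm (B *\<^sub>R f x)"
      by (simp add: norm_mult mult.commute[of "cmod (f x)"] mult_right_mono)
  qed
qed

context
  fixes f :: "real \<Rightarrow> complex"
  assumes f: "integrable U f"
    and zero: "\<And>k::int. (\<integral>x. f x * cis (- 2 * pi * of_int k * x) \<partial>U) = 0"
begin

lemma annihilates_trig_poly: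
  assumes "trig_poly h"
  shows "(\<integral>x. f x * h x \<partial>U) = 0"
  using assms
proof induction
  case (mode c k)
  have "(\<integral>x. f x * (c * cis (- 2 * pi * of_int k * x)) \<partial>U) = c * (\<integral>x. f x * cis (- 2 * pi * of_int k * x) \<partial>U)"
    by (subst integral_mult_right_zero[symmetric]) (simp add: algebra_simps)
  then show ?case using zero by simp
next
  case (add h g)
  have "integrable U (\<lambda>x. f x * p x)" if p: "trig_poly p" for p
  proof -
    obtain B where "\<And>x. cmod (p x) \<le> B" using trig_poly_bounded_measurable[OF p] by blast
    then show ?thesis
      using trig_poly_bounded_measurable[OF p] by (intro integrable_bounded_mult[OF f, of _ B] borel_measurable_U) auto
  qed
  then show ?case using add by (simp add: distrib_left)
qed

text \<open>Stone-Weierstrass on the unit circle: a polynomial within \<open>e\<close> of \<phi>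
  becomes a trigonometric polynomial along the circle and is annihilated, so the integral is at most
  \<open>e\<close> times the L1 norm of \<open>f\<close>.\<close>

lemma annihilates_periodic:
  fixes \<phi> :: "complex \<Rightarrow> real"
  assumes \<phi>: "continuous_on UNIV \<phi>"
  shows "(\<integral>x. f x * complex_of_real (\<phi> (cis (2 * pi * x))) \<partial>U) = 0"
proof -
  let ?h = "\<lambda>x. complex_of_real (\<phi> (cis (2 * pi * x)))"
  have meas: "?h \<in> borel_measurable borel"
    using \<phi> by (intro borel_measurable_continuous_onI continuous_intros continuous_on_compose2[OF \<phi>]) auto
  have comp: "compact (sphere (0::complex) 1)" by simp
  have \<phi>': "continuous_on (sphere 0 1) \<phi>" using \<phi> continuous_on_subset by blast
  have "cmod (\<integral>x. f x * ?h x \<partial>U) \<le> e * (\<integral>x. cmod (f x) \<partial>U)" if e: "e > 0" for e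
  proof -
    obtain g where g: "real_polynomial_function g" "\<And>x. x \<in> sphere 0 1 \<Longrightarrow> \<bar>\<phi> x - g x\<bar> < e"
      by (rule Stone_Weierstrass_real_polynomial_function[OF comp \<phi>' e]) (use that in blast)
    let ?g = "\<lambda>x. complex_of_real (g (cis (2 * pi * x)))"
    have tg: "trig_poly ?g" by (rule trig_poly_of_polynomial[OF g(1)])
    have mg: "?g \<in> borel_measurable borel" using trig_poly_bounded_measurable[OF tg] by blast
    have ig: "integrable U (\<lambda>x. f x * ?g x)"
      using trig_poly_bounded_measurable[OF tg] integrable_bounded_mult[OF f borel_measurable_U[OF mg]] by blast
    have d: "cmod (?h x - ?g x) \<le> e" for x
      using g(2)[of "cis (2 * pi * x)"] by (simp flip: of_real_diff)
    have id: "integrable U (\<lambda>x. f x * (?h x - ?g x))"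
      using meas mg by (intro integrable_bounded_mult[OF f _ d]) auto
    have "(\<integral>x. f x * ?h x \<partial>U) = (\<integral>x. f x * (?h x - ?g x) + f x * ?g x \<partial>U)"
      by (simp add: algebra_simps)
    also have "\<dots> = (\<integral>x. f x * (?h x - ?g x) \<partial>U)"
      using annihilates_trig_poly[OF tg] id ig by simp
    finally have "cmod (\<integral>x. f x * ?h x \<partial>U) \<le> (\<integral>x. cmod (f x * (?h x - ?g x)) \<partial>U)"
      by (simp only: integral_norm_bound)
    also have "\<dots> \<le> (\<integral>x. e * cmod (f x) \<partial>U)"
    proof (rule integral_mono)
      show "integrable U (\<lambda>x. cmod (f x * (?h x - ?g x)))" using id by (rule integrable_norm)
      show "integrable U (\<lambda>x. e * cmod (f x))" using f by auto
      show "cmod (f x * (?h x - ?g x)) \<le> e * cmod (f x)" for x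
        unfolding norm_mult mult.commute[of e] by (intro mult_left_mono d) simp
    qed
    finally show ?thesis by simp
  qed
  then have *: "cmod (\<integral>x. f x * ?h x \<partial>U) \<le> e * (\<integral>x. cmod (f x) \<partial>U)" if "e > 0" for e using that by blast
  have "cmod (\<integral>x. f x * ?h x \<partial>U) \<le> 0"
  proof (rule tendsto_lowerbound)
    show "((\<lambda>e. e * (\<integral>x. cmod (f x) \<partial>U)) \<longlongrightarrow> 0) (at_right 0)"
      by (auto intro!: tendsto_eq_intros)
    show "\<forall>\<^sub>F e in at_right 0. cmod (\<integral>x. f x * ?h x \<partial>U) \<le> e * (\<integral>x. cmod (f x) \<partial>U)"
      by (rule eventually_at_rightI[of 0 1]) (use * in auto)
  qed auto
  then show ?thesis by simp
qed

text \<open>The indicator of an open arc is the pointwise limit of the continuous functions min(1, n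
  dist(z, C)) on the circle, where C is the complementary closed arc; dominated convergence applies
  with majorant |f|.\<close>

lemma integral_initial_zero: "(\<integral>x. indicat_real {..a} x *\<^sub>R f x \<partial>U) = 0"
proof (cases "a < 0 \<or> 1 \<le> a")
  case True
  then consider "a < 0" | "1 \<le> a" by blast
  then show ?thesis
  proof cases
    case 1
    then have "(\<integral>x. indicat_real {..a} x *\<^sub>R f x \<partial>U) = (\<integral>x. 0 \<partial>U)"
      by (intro Bochner_Integration.integral_cong) (auto simp: indicator_def)
    then show ?thesis by simp
  next
    case 2
    then have "(\<integral>x. indicat_real {..a} x *\<^sub>R f x \<partial>U) = (\<integral>x. f x * cis (- 2 * pi * of_int 0 * x) \<partial>U)"
      by (intro Bochner_Integration.integral_cong) (auto simp: indicator_def)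
    then show ?thesis using zero[of 0] by simp
  qed
next
  case False
  then have a: "0 \<le> a" "a < 1" by auto
  \<comment> \<open>The images of 0 and \<open>a\<close> belong to the closed arc; there the limit
    may differ from the indicator, but these points are null.\<close>
  define C where "C = (\<lambda>x. cis (2 * pi * x)) ` ({0} \<union> {a..1})"
  have C: "closed C" "C \<noteq> {}"
    unfolding C_def by (auto intro!: compact_imp_closed compact_continuous_image continuous_intros)
  have notin: "cis (2 * pi * x) \<notin> C" if x: "0 < x" "x < a" for x
  proof
    assume "cis (2 * pi * x) \<in> C"
    then obtain y where y: "y = 0 \<or> a \<le> y \<and> y \<le> 1" "cis (2 * pi * x) = cis (2 * pi * y)"
      unfolding C_def by force
    then obtain n :: int where "complex_of_real (2 * pi * x) * \<i> = complex_of_real (2 * pi * y) * \<i> + of_int (2 * n) * complex_of_real pi * \<i>"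
      by (auto simp: cis_conv_exp exp_eq mult.commute)
    then have "2 * pi * x = 2 * pi * y + of_int (2 * n) * pi"
      by (auto simp: complex_eq_iff)
    then have "2 * pi * x = 2 * pi * (y + of_int n)" by (simp add: algebra_simps)
    then have "x = y + of_int n" by simp
    moreover have "n = 0 \<or> n \<le> -1 \<or> n \<ge> 1" by linarith
    ultimately have "real_of_int n = 0 \<or> real_of_int n \<le> -1 \<or> real_of_int n \<ge> 1" by fastforce
    then show False using x y a \<open>x = y + of_int n\<close> by auto
  qed
  define \<phi> where "\<phi> n z = min 1 (real n * infdist z C)" for n z
  have cont: "continuous_on UNIV (\<phi> n)" for n
    unfolding \<phi>_def by (intro continuous_intros)
  let ?h = "\<lambda>n x. complex_of_real (\<phi> n (cis (2 * pi * x)))"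
  have h: "?h n \<in> borel_measurable borel" for n
    by (intro borel_measurable_continuous_onI continuous_intros continuous_on_compose2[OF cont]) auto
  have "(\<lambda>n. \<integral>x. f x * ?h n x \<partial>U) \<longlonglongrightarrow> (\<integral>x. indicat_real {..a} x *\<^sub>R f x \<partial>U)"
  proof (rule integral_dominated_convergence)
    show "integrable U (\<lambda>x. cmod (f x))" using f by auto
    show "(\<lambda>x. indicat_real {..a} x *\<^sub>R f x) \<in> borel_measurable U" using f by auto
    show "(\<lambda>x. f x * ?h n x) \<in> borel_measurable U" for n using f h by auto
    show "AE x in U. norm (f x * ?h n x) \<le> cmod (f x)" for n
      by (rule AE_I2) (auto simp: norm_mult \<phi>_def infdist_nonneg mult_left_le)
    show "AE x in U. (\<lambda>n. f x * ?h n x) \<longlonglongrightarrow> indicat_real {..a} x *\<^sub>R f x"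
      using AE_U_neq[of 0] AE_U_neq[of a] AE_space
    proof eventually_elim
      case (elim x)
      show ?case
      proof (cases "x < a")
        case True
        then have "infdist (cis (2 * pi * x)) C > 0"
          using elim notin[of x] C by (simp add: infdist_pos_not_in_closed)
        then obtain m :: nat where m: "1 < real m * infdist (cis (2 * pi * x)) C"
          using reals_Archimedean3 by blast
        have "?h n x = 1" if "n \<ge> m" for n
        proof -
          have "real m * infdist (cis (2 * pi * x)) C \<le> real n * infdist (cis (2 * pi * x)) C"
            using that by (intro mult_right_mono) (auto simp: infdist_nonneg)
          then show ?thesis using m by (simp add: \<phi>_def)
        qed
        then have "(\<lambda>n. f x * ?h n x) \<longlonglongrightarrow> f x"
          by (intro tendsto_eventually eventually_sequentiallyI[of m]) auto
        then show ?thesis using True by simp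
      next
        case False
        then have "cis (2 * pi * x) \<in> C" unfolding C_def using elim by auto
        then show ?thesis using False elim by (simp add: \<phi>_def)
      qed
    qed
  qed
  then have "(\<lambda>n. 0) \<longlonglongrightarrow> (\<integral>x. indicat_real {..a} x *\<^sub>R f x \<partial>U)"
    using annihilates_periodic[OF cont] by simp
  then show ?thesis using LIMSEQ_unique tendsto_const by blast
qed

text \<open>Half-lines form an intersection-stable generator of the Borel sets, so the vanishing of
  the integral extends to all Borel sets by Dynkin induction, and a function whose set integrals all
  vanish is zero almost everywhere.\<close>

lemma fourier_unique_U: "AE x in U. f x = 0"
proof -
  have ii: "integrable U (\<lambda>x. indicat_real A x *\<^sub>R f x)" if "A \<in> sets borel" for A
  proof (rule Bochner_Integration.integrable_bound[OF f])
    show "(\<lambda>x. indicat_real A x *\<^sub>R f x) \<in> borel_measurable U" using f that by auto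
    show "AE x in U. norm (indicat_real A x *\<^sub>R f x) \<le> norm (f x)"
      by (auto simp: indicator_def)
  qed
  have f0: "(\<integral>x. f x \<partial>U) = 0" using zero[of 0] by simp
  have borel: "(\<integral>x. indicat_real A x *\<^sub>R f x \<partial>U) = 0" if A: "A \<in> sets borel" for A
  proof -
    have st: "Int_stable (range (\<lambda>a. {..a::real}))" by (auto simp: Int_stable_def image_iff)
    have A': "A \<in> sigma_sets UNIV (range (\<lambda>a. {..a::real}))"
      using A by (simp add: borel_eq_atMost)
    have sub: "range (\<lambda>a. {..a::real}) \<subseteq> Pow UNIV" by simp
    from st sub A' show ?thesis
    proof (induction rule: sigma_sets_induct_disjoint)
      case (basic A)
      then show ?case using integral_initial_zero by auto
    next
      case empty
      then show ?case by simp
    next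
      case (compl A)
      then have A: "A \<in> sets borel" by (simp add: borel_eq_atMost)
      have "(\<integral>x. indicat_real (UNIV - A) x *\<^sub>R f x \<partial>U) = (\<integral>x. f x - indicat_real A x *\<^sub>R f x \<partial>U)"
        by (intro Bochner_Integration.integral_cong) (auto simp: indicator_def)
      then show ?case using compl ii[OF A] f f0 by simp
    next
      case (union A)
      then have A: "A i \<in> sets borel" for i by (auto simp: borel_eq_atMost)
      have A': "(\<Union>i. A i) \<in> sets borel" using A by auto
      have sm: "(\<lambda>i. indicat_real (A i) x *\<^sub>R f x) sums (indicat_real (\<Union>i. A i) x *\<^sub>R f x)" for x
      proof (rule sums_scaleR_left)
        show "(\<lambda>i. indicat_real (A i) x) sums indicat_real (\<Union>i. A i) x"
          using indicator_sums[of A x] union unfolding disjoint_family_on_def by auto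
      qed
      have "(\<lambda>n. \<integral>x. (\<Sum>i<n. indicat_real (A i) x *\<^sub>R f x) \<partial>U) \<longlonglongrightarrow> (\<integral>x. indicat_real (\<Union>i. A i) x *\<^sub>R f x \<partial>U)"
      proof (rule integral_dominated_convergence)
        show "integrable U (\<lambda>x. cmod (f x))" using f by auto
        show "(\<lambda>x. indicat_real (\<Union>i. A i) x *\<^sub>R f x) \<in> borel_measurable U" using f A' by auto
        show "(\<lambda>x. \<Sum>i<n. indicat_real (A i) x *\<^sub>R f x) \<in> borel_measurable U" for n using f A by auto
        show "AE x in U. (\<lambda>n. \<Sum>i<n. indicat_real (A i) x *\<^sub>R f x) \<longlonglongrightarrow> indicat_real (\<Union>i. A i) x *\<^sub>R f x"
          using sm unfolding sums_def by auto
        have "(\<Sum>i<n. indicat_real (A i) x) \<le> 1" for n x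
        proof -
          have s1: "(\<lambda>i. indicat_real (A i) x) sums indicat_real (\<Union>i. A i) x"
            using indicator_sums[of A x] union unfolding disjoint_family_on_def by auto
          have "(\<Sum>i<n. indicat_real (A i) x) \<le> (\<Sum>i. indicat_real (A i) x)"
            by (rule sum_le_suminf[OF sums_summable[OF s1]]) auto
          also have "\<dots> \<le> 1" using sums_unique[OF s1] by (metis indicator_le_1)
          finally show ?thesis .
        qed
        then have "norm (\<Sum>i<n. indicat_real (A i) x *\<^sub>R f x) \<le> cmod (f x)" for n x
          by (simp flip: scaleR_left.sum add: mult_left_le_one_le sum_nonneg)
        then show "AE x in U. norm (\<Sum>i<n. indicat_real (A i) x *\<^sub>R f x) \<le> cmod (f x)" for n by auto
      qed
      moreover have "(\<integral>x. (\<Sum>i<n. indicat_real (A i) x *\<^sub>R f x) \<partial>U) = 0" for n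
        using ii[OF A] union by (subst Bochner_Integration.integral_sum) auto
      ultimately have "(\<lambda>n. 0) \<longlonglongrightarrow> (\<integral>x. indicat_real (\<Union>i. A i) x *\<^sub>R f x \<partial>U)"
        by (simp only:)
      then show ?case by (simp only: LIMSEQ_const_iff)
    qed
  qed
  show ?thesis
  proof (rule U.density_zero[OF f])
    fix A assume "A \<in> sets U"
    then obtain B where B: "B \<in> sets borel" "A = B \<inter> {0..1}"
      unfolding U_def by (auto simp: sets_restrict_space image_iff)
    have "set_lebesgue_integral U A f = (\<integral>x. indicat_real B x *\<^sub>R f x \<partial>U)"
      unfolding set_lebesgue_integral_def B
      by (intro Bochner_Integration.integral_cong) (auto simp: indicator_def)
    then show "set_lebesgue_integral U A f = 0" using borel[OF B(1)] by simp
  qed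
qed

end

section \<open>Fourier uniqueness on finite products of the torus\<close>

lemma product_sigma_finite_U: "product_sigma_finite (\<lambda>_::nat. U)"
  by unfold_locales

interpretation PU: product_sigma_finite "\<lambda>_::nat. U"
  by (rule product_sigma_finite_U)

lemma prob_space_cube: "prob_space (cube N)"
  unfolding cube_def by (rule prob_space_PiM) (rule prob_space_U)

lemma measurable_component_U: "j \<in> J \<Longrightarrow> (\<lambda>x. x j) \<in> borel_measurable (PiM J (\<lambda>_. U))"
  using measurable_compose[OF measurable_component_singleton[of j J "\<lambda>_. U"] id_measurable_U] .

lemma measurable_cube_component [measurable]: "j < N \<Longrightarrow> (\<lambda>x. x j) \<in> borel_measurable (cube N)"
  unfolding cube_def by (rule measurable_component_U) simp

text \<open>General index sets occur because uniqueness on the cube is proved by adding one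
  coordinate at a time.\<close>

definition emode_on :: "nat set \<Rightarrow> (nat \<Rightarrow> int) \<Rightarrow> (nat \<Rightarrow> real) \<Rightarrow> complex" where
  "emode_on J k x = cis (2 * pi * (\<Sum>j\<in>J. of_int (k j) * x j))"

lemma emode_on_lessThan: "emode_on {..<N} = emode N"
  by (auto simp: fun_eq_iff emode_on_def emode_def)

lemma emode_on_measurable: "emode_on J k \<in> borel_measurable (PiM J (\<lambda>_. U))"
  unfolding emode_on_def
  by (intro measurable_compose[OF _ cis_measurable] borel_measurable_times borel_measurable_sum
      borel_measurable_const measurable_component_U)

lemma norm_emode_on [simp]: "cmod (emode_on J k x) = 1"
  by (simp add: emode_on_def)

lemma emode_measurable [measurable]: "emode N k \<in> borel_measurable (cube N)"
  using emode_on_measurable[of "{..<N}"] by (simp add: emode_on_lessThan cube_def)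

lemma norm_emode [simp]: "cmod (emode N k x) = 1"
  by (simp add: emode_def)

lemma emode_on_insert:
  assumes "finite J" "i \<notin> J"
  shows "emode_on (insert i J) k (y(i := t)) = emode_on J k y * cis (2 * pi * of_int (k i) * t)"
proof -
  have "(\<Sum>j\<in>J. of_int (k j) * (y(i := t)) j) = (\<Sum>j\<in>J. of_int (k j) * y j)"
    using assms by (intro sum.cong) auto
  then show ?thesis using assms
    by (simp add: emode_on_def cis_mult algebra_simps)
qed

lemma emode_on_cong: "(\<And>j. j \<in> J \<Longrightarrow> k j = l j) \<Longrightarrow> emode_on J k = emode_on J l"
  by (simp add: fun_eq_iff emode_on_def)

context
  fixes J :: "nat set" and i :: nat
  assumes J: "finite J" "i \<notin> J"
begin

lemma PU_update_measurable:
  "(\<lambda>(t, y). y(i := t)) \<in> U \<Otimes>\<^sub>M PiM J (\<lambda>_. U) \<rightarrow>\<^sub>M PiM (insert i J) (\<lambda>_. U)"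
  by measurable

lemma PU_update_distr:
  "distr (U \<Otimes>\<^sub>M PiM J (\<lambda>_. U)) (PiM (insert i J) (\<lambda>_. U)) (\<lambda>(t, y). y(i := t)) = PiM (insert i J) (\<lambda>_. U)"
  by (rule distr_pair_PiM_eq_PiM) (rule prob_space_U)+

context
  fixes f :: "(nat \<Rightarrow> real) \<Rightarrow> 'b :: {banach, second_countable_topology}"
  assumes f: "integrable (PiM (insert i J) (\<lambda>_. U)) f"
begin

lemma PU_integrable_pair: "integrable (U \<Otimes>\<^sub>M PiM J (\<lambda>_. U)) (\<lambda>(t, y). f (y(i := t)))"
proof -
  have "integrable (U \<Otimes>\<^sub>M PiM J (\<lambda>_. U)) (\<lambda>z. f ((\<lambda>(t, y). y(i := t)) z))"
    by (rule integrable_distr[OF PU_update_measurable]) (simp only: PU_update_distr f)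
  then show ?thesis by (simp only: split_def)
qed

lemma PU_integral_pair:
  "(\<integral>x. f x \<partial>PiM (insert i J) (\<lambda>_. U)) = (\<integral>(t, y). f (y(i := t)) \<partial>(U \<Otimes>\<^sub>M PiM J (\<lambda>_. U)))"
proof -
  have m: "f \<in> borel_measurable (PiM (insert i J) (\<lambda>_. U))" using f by auto
  have "(\<integral>x. f x \<partial>PiM (insert i J) (\<lambda>_. U)) = (\<integral>z. f ((\<lambda>(t, y). y(i := t)) z) \<partial>(U \<Otimes>\<^sub>M PiM J (\<lambda>_. U)))"
    by (subst PU_update_distr[symmetric]) (rule integral_distr[OF PU_update_measurable m])
  then show ?thesis by (simp only: split_def)
qed

text \<open>Fubini with one coordinate split off. In the first three clauses coordinate
  \<open>i\<close> is integrated innermost, as in the induction for uniqueness; in the last three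
  the remaining coordinates are, which is the shape of a one-particle density.\<close>

lemma PU_slices:
  shows "integrable (PiM J (\<lambda>_. U)) (\<lambda>y. \<integral>t. f (y(i := t)) \<partial>U)"
    and "AE y in PiM J (\<lambda>_. U). integrable U (\<lambda>t. f (y(i := t)))"
    and "(\<integral>x. f x \<partial>PiM (insert i J) (\<lambda>_. U)) = (\<integral>y. (\<integral>t. f (y(i := t)) \<partial>U) \<partial>PiM J (\<lambda>_. U))"
    and "integrable U (\<lambda>t. \<integral>y. f (y(i := t)) \<partial>PiM J (\<lambda>_. U))"
    and "AE t in U. integrable (PiM J (\<lambda>_. U)) (\<lambda>y. f (y(i := t)))"
    and "(\<integral>x. f x \<partial>PiM (insert i J) (\<lambda>_. U)) = (\<integral>t. (\<integral>y. f (y(i := t)) \<partial>PiM J (\<lambda>_. U)) \<partial>U)"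
proof -
  interpret J: prob_space "PiM J (\<lambda>_. U)" by (rule prob_space_PiM) (rule prob_space_U)
  interpret JU: pair_sigma_finite U "PiM J (\<lambda>_. U)" by unfold_locales
  note * = PU_integrable_pair
  show "integrable (PiM J (\<lambda>_. U)) (\<lambda>y. \<integral>t. f (y(i := t)) \<partial>U)"
    by (rule JU.integrable_snd[OF *])
  show "AE y in PiM J (\<lambda>_. U). integrable U (\<lambda>t. f (y(i := t)))"
    by (rule JU.AE_integrable_snd[OF *])
  show "(\<integral>x. f x \<partial>PiM (insert i J) (\<lambda>_. U)) = (\<integral>y. (\<integral>t. f (y(i := t)) \<partial>U) \<partial>PiM J (\<lambda>_. U))"
    unfolding PU_integral_pair by (rule JU.integral_snd[OF *, symmetric])
  show "integrable U (\<lambda>t. \<integral>y. f (y(i := t)) \<partial>PiM J (\<lambda>_. U))"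
    by (rule JU.integrable_fst[OF *])
  show "AE t in U. integrable (PiM J (\<lambda>_. U)) (\<lambda>y. f (y(i := t)))"
    by (rule JU.AE_integrable_fst[OF *])
  show "(\<integral>x. f x \<partial>PiM (insert i J) (\<lambda>_. U)) = (\<integral>t. (\<integral>y. f (y(i := t)) \<partial>PiM J (\<lambda>_. U)) \<partial>U)"
    unfolding PU_integral_pair by (rule JU.integral_fst[OF *, symmetric])
qed

end

end

text \<open>Induction on the coordinates. Integrating \<open>f\<close> against mode \<open>m\<close>
  of the new coordinate gives a function of the others whose coefficients all vanish, hence zero
  almost everywhere. As there are countably many \<open>m\<close>, almost every slice has all
  coefficients zero and the one-dimensional result applies to it.\<close>

theorem fourier_unique_PiM:
  fixes f :: "(nat \<Rightarrow> real) \<Rightarrow> complex"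
  assumes "finite J"
    and "integrable (PiM J (\<lambda>_. U)) f"
    and "\<And>k::nat \<Rightarrow> int. (\<integral>x. f x * cnj (emode_on J k x) \<partial>PiM J (\<lambda>_. U)) = 0"
  shows "AE x in PiM J (\<lambda>_. U). f x = 0"
  using assms
proof (induction arbitrary: f)
  case empty
  have "(\<integral>x. f x * cnj (emode_on {} (\<lambda>_. 0) x) \<partial>PiM {} (\<lambda>_. U)) = f (\<lambda>_. undefined)"
    by (simp add: PiM_empty lebesgue_integral_count_space_finite emode_on_def)
  then have "f (\<lambda>_. undefined) = 0" using empty(2)[of "\<lambda>_. 0"] by (simp only:)
  then show ?case by (intro AE_I2) (auto simp: space_PiM)
next
  case (insert i J)
  let ?P = "PiM J (\<lambda>_. U)" and ?Q = "PiM (insert i J) (\<lambda>_. U)"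
  have J: "finite J" "i \<notin> J" using insert.hyps by auto
  define h where "h m y = (\<integral>t. f (y(i := t)) * cis (- 2 * pi * of_int m * t) \<partial>U)" for m :: int and y
  define F where "F m x = f x * cis (- 2 * pi * of_int m * x i)" for m :: int and x
  have xi: "(\<lambda>x. x i) \<in> borel_measurable ?Q"
    by (rule measurable_component_U) simp
  have F: "integrable ?Q (F m)" for m
    unfolding F_def
    by (rule integrable_bounded_mult[OF insert.prems(1), of _ 1])
      (auto intro!: measurable_compose[OF _ cis_measurable] borel_measurable_times xi)
  have h: "h m = (\<lambda>y. \<integral>t. F m (y(i := t)) \<partial>U)" for m
    by (simp add: h_def F_def fun_eq_iff)
  have hint: "integrable ?P (h m)" for m
    unfolding h by (rule PU_slices(1)[OF J F])
  have "AE y in ?P. h m y = 0" for m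
  proof (rule insert.IH[OF hint])
    fix k :: "nat \<Rightarrow> int"
    \<comment> \<open>With frequency \<open>m\<close> inserted in the new coordinate, the
      \<open>k\<close>-th coefficient of \<open>h m\<close> is a coefficient of \<open>f\<close>
      itself.\<close>
    define k' where "k' = k(i := m)"
    have k': "emode_on J k' = emode_on J k"
      using J by (intro emode_on_cong) (auto simp: k'_def)
    have k'i: "k' i = m" by (simp add: k'_def)
    have i2: "integrable ?Q (\<lambda>x. f x * cnj (emode_on (insert i J) k' x))"
      by (rule integrable_bounded_mult[OF insert.prems(1), of _ 1])
         (auto intro!: measurable_compose[OF emode_on_measurable] borel_measurable_continuous_onI continuous_intros)
    have "0 = (\<integral>x. f x * cnj (emode_on (insert i J) k' x) \<partial>?Q)" using insert.prems(2) by simp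
    also have "\<dots> = (\<integral>y. (\<integral>t. f (y(i := t)) * cnj (emode_on (insert i J) k' (y(i := t))) \<partial>U) \<partial>?P)"
      by (rule PU_slices(3)[OF J i2])
    also have "\<dots> = (\<integral>y. h m y * cnj (emode_on J k y) \<partial>?P)"
    proof (rule Bochner_Integration.integral_cong[OF refl])
      fix y
      have "(\<integral>t. f (y(i := t)) * cnj (emode_on (insert i J) k' (y(i := t))) \<partial>U)
        = (\<integral>t. cnj (emode_on J k y) * (f (y(i := t)) * cis (- 2 * pi * of_int m * t)) \<partial>U)"
        by (intro Bochner_Integration.integral_cong) (auto simp: emode_on_insert[OF J] k' k'i cis_cnj algebra_simps)
      then show "(\<integral>t. f (y(i := t)) * cnj (emode_on (insert i J) k' (y(i := t))) \<partial>U) = h m y * cnj (emode_on J k y)"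
        by (simp add: h_def)
    qed
    finally show "(\<integral>y. h m y * cnj (emode_on J k y) \<partial>?P) = 0" by simp
  qed
  then have "AE y in ?P. \<forall>m. h m y = 0" by (simp add: AE_all_countable)
  then have ae: "AE y in ?P. AE t in U. f (y(i := t)) = 0"
    using PU_slices(2)[OF J insert.prems(1)]
  proof eventually_elim
    case (elim y)
    show ?case using fourier_unique_U[OF elim(2)] elim(1) unfolding h_def by (simp only: simp_thms)
  qed
  have mf: "f \<in> borel_measurable ?Q" using insert.prems(1) by auto
  \<comment> \<open>The nonnegative integral of |f| converts the vanishing of almost every slice
    into vanishing almost everywhere on the product.\<close>
  have "(\<integral>\<^sup>+x. ennreal (cmod (f x)) \<partial>?Q) = (\<integral>\<^sup>+y. (\<integral>\<^sup>+t. ennreal (cmod (f (y(i := t)))) \<partial>U) \<partial>?P)"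
    using mf by (intro PU.product_nn_integral_insert[OF J]) auto
  also have "\<dots> = (\<integral>\<^sup>+y. 0 \<partial>?P)"
  proof (rule nn_integral_cong_AE)
    show "AE y in ?P. (\<integral>\<^sup>+t. ennreal (cmod (f (y(i := t)))) \<partial>U) = 0"
      using ae
    proof eventually_elim
      case (elim y)
      then have "(\<integral>\<^sup>+t. ennreal (cmod (f (y(i := t)))) \<partial>U) = (\<integral>\<^sup>+t. 0 \<partial>U)"
        by (intro nn_integral_cong_AE) auto
      then show ?case by simp
    qed
  qed
  finally have "(\<integral>\<^sup>+x. ennreal (cmod (f x)) \<partial>?Q) = 0" by simp
  then show ?case using mf by (subst (asm) nn_integral_0_iff_AE) auto
qed

lemma fourier_unique_cube:
  fixes f :: "(nat \<Rightarrow> real) \<Rightarrow> complex"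
  assumes "integrable (cube N) f" "\<And>k::nat \<Rightarrow> int. (\<integral>x. f x * cnj (emode N k x) \<partial>cube N) = 0"
  shows "AE x in cube N. f x = 0"
  using fourier_unique_PiM[of "{..<N}" f] assms unfolding cube_def by (simp add: emode_on_lessThan)

lemma integral_U_cis:
  "(\<integral>x. cis (2 * pi * of_int m * x) \<partial>U) = (if m = 0 then 1 else 0)"
proof (cases "m = 0")
  case True
  then show ?thesis using U.prob_space by simp
next
  case False
  let ?F = "\<lambda>x::real. cis (2 * pi * of_int m * x) / (2 * pi * \<i> * of_int m)"
  have "((\<lambda>x. cis (2 * pi * of_int m * x)) has_integral (?F 1 - ?F 0)) {0..1}"
  proof (rule fundamental_theorem_of_calculus)
    fix x :: real
    have "((\<lambda>x. cis (2 * pi * of_int m * x)) has_vector_derivative ((2 * pi * \<i> * of_int m) * cis (2 * pi * of_int m * x))) (at x within {0..1})"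
      unfolding cis_conv_exp of_real_mult
      by (auto intro!: has_vector_derivative_real_field derivative_eq_intros simp: algebra_simps)
    then show "(?F has_vector_derivative cis (2 * pi * of_int m * x)) (at x within {0..1})"
      using False by (auto intro!: derivative_eq_intros simp: field_simps)
  qed simp
  moreover have "cis (2 * pi * of_int m) = 1" 
    using cis_multiple_2pi[of "of_int m"] by (simp add: mult.commute)
  ultimately have hi: "((\<lambda>x. cis (2 * pi * of_int m * x)) has_integral 0) {0..1}" by simp
  have "set_integrable lborel {0..1} (\<lambda>x. cis (2 * pi * of_int m * x))"
    by (intro borel_integrable_atLeastAtMost' continuous_intros)
  then have "(LINT x:{0..1}|lborel. cis (2 * pi * of_int m * x)) = 0"
    using hi by (metis has_integral_integral_real has_integral_unique set_borel_integral_eq_integral(2) integral_unique)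
  then show ?thesis using False
    unfolding U_def set_lebesgue_integral_def by (subst integral_restrict_space) auto
qed

lemma emode_eq_prod: "emode N k x = (\<Prod>j<N. cis (2 * pi * of_int (k j) * x j))"
  unfolding emode_def
  by (induction N) (simp_all add: cis_mult[symmetric] ring_distribs mult.assoc)

lemma emode_orthonormal:
  "(\<integral>x. emode N k x * cnj (emode N l x) \<partial>cube N) = (if \<forall>j<N. k j = l j then 1 else 0)"
proof -
  have "(\<integral>x. emode N k x * cnj (emode N l x) \<partial>cube N)
      = (\<integral>x. (\<Prod>j<N. cis (2 * pi * of_int (k j - l j) * x j)) \<partial>cube N)"
    by (intro Bochner_Integration.integral_cong)
      (auto simp: emode_eq_prod prod.distrib[symmetric] cis_cnj cis_mult algebra_simps)
  also have "\<dots> = (\<Prod>j<N. \<integral>t. cis (2 * pi * of_int (k j - l j) * t) \<partial>U)"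
    unfolding cube_def
  proof (rule PU.product_integral_prod)
    fix j
    show "integrable U (\<lambda>t. cis (2 * pi * of_int (k j - l j) * t))"
      by (rule U.integrable_const_bound[of _ 1]) (auto intro!: measurable_compose[OF _ cis_measurable])
  qed simp
  also have "\<dots> = (\<Prod>j<N. if k j = l j then 1 else 0)"
    unfolding integral_U_cis by simp
  also have "\<dots> = (if \<forall>j<N. k j = l j then 1 else 0)"
    by (auto simp: prod_zero)
  finally show ?thesis .
qed

section \<open>Square-integrable functions and orthonormal bases\<close>

lemma has_sum_subtract:
  fixes f g :: "'a \<Rightarrow> 'b::real_normed_vector"
  assumes "(f has_sum a) A" "(g has_sum b) A"
  shows "((\<lambda>x. f x - g x) has_sum (a - b)) A"
  using has_sum_add[OF assms(1) has_sum_uminus[THEN iffD2], of g "-b"] assms(2) by simp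

definition sqi :: "'a measure \<Rightarrow> ('a \<Rightarrow> complex) \<Rightarrow> bool" where
  "sqi M f \<longleftrightarrow> f \<in> borel_measurable M \<and> integrable M (\<lambda>x. (cmod (f x))\<^sup>2)"

lemma sqi_measurable: "sqi M f \<Longrightarrow> f \<in> borel_measurable M"
  by (simp add: sqi_def)

lemma sqi_integrable_sq: "sqi M f \<Longrightarrow> integrable M (\<lambda>x. (cmod (f x))\<^sup>2)"
  by (simp add: sqi_def)

lemma sqi_mult_integrable:
  assumes "sqi M f" "sqi M g"
  shows "integrable M (\<lambda>x. f x * g x)"
proof (rule Bochner_Integration.integrable_bound)
  show "integrable M (\<lambda>x. (cmod (f x))\<^sup>2 + (cmod (g x))\<^sup>2)"
    using assms by (intro Bochner_Integration.integrable_add sqi_integrable_sq)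
  show "(\<lambda>x. f x * g x) \<in> borel_measurable M"
    using assms by (intro borel_measurable_times sqi_measurable)
  show "AE x in M. norm (f x * g x) \<le> norm ((cmod (f x))\<^sup>2 + (cmod (g x))\<^sup>2)"
  proof (rule AE_I2)
    fix x
    have "2 * (cmod (f x) * cmod (g x)) \<le> (cmod (f x))\<^sup>2 + (cmod (g x))\<^sup>2"
      using sum_squares_bound[of "cmod (f x)" "cmod (g x)"] by simp
    moreover have "0 \<le> cmod (f x) * cmod (g x)" by simp
    ultimately show "norm (f x * g x) \<le> norm ((cmod (f x))\<^sup>2 + (cmod (g x))\<^sup>2)"
      unfolding norm_mult real_norm_def by linarith
  qed
qed

lemma cnj_measurable: "f \<in> borel_measurable M \<Longrightarrow> (\<lambda>x. cnj (f x)) \<in> borel_measurable M"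
  by (erule measurable_compose) (intro borel_measurable_continuous_onI continuous_intros)

lemma sqi_cnj: "sqi M f \<Longrightarrow> sqi M (\<lambda>x. cnj (f x))"
  unfolding sqi_def by (simp add: cnj_measurable)

lemma sqi_bounded_mult:
  assumes f: "sqi M f" and g: "g \<in> borel_measurable M" "\<And>x. x \<in> space M \<Longrightarrow> cmod (g x) \<le> B"
  shows "sqi M (\<lambda>x. g x * f x)"
  unfolding sqi_def
proof
  show m: "(\<lambda>x. g x * f x) \<in> borel_measurable M"
    using sqi_measurable[OF f] g(1) by (intro borel_measurable_times)
  show "integrable M (\<lambda>x. (cmod (g x * f x))\<^sup>2)"
  proof (rule Bochner_Integration.integrable_bound)
    show "integrable M (\<lambda>x. B\<^sup>2 * (cmod (f x))\<^sup>2)" using sqi_integrable_sq[OF f] by simp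
    show "(\<lambda>x. (cmod (g x * f x))\<^sup>2) \<in> borel_measurable M" using m by simp
    show "AE x in M. norm ((cmod (g x * f x))\<^sup>2) \<le> norm (B\<^sup>2 * (cmod (f x))\<^sup>2)"
      by (rule AE_I2) (auto simp: norm_mult power_mult_distrib intro!: mult_right_mono power_mono g)
  qed
qed

lemma sqi_cmult: "sqi M f \<Longrightarrow> sqi M (\<lambda>x. a * f x)"
  by (rule sqi_bounded_mult[of M f "\<lambda>_. a" "cmod a"]) auto

lemma sqi_add:
  assumes "sqi M f" "sqi M g"
  shows "sqi M (\<lambda>x. f x + g x)"
  unfolding sqi_def
proof
  show m: "(\<lambda>x. f x + g x) \<in> borel_measurable M"
    using assms by (intro borel_measurable_add sqi_measurable)
  show "integrable M (\<lambda>x. (cmod (f x + g x))\<^sup>2)"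
  proof (rule Bochner_Integration.integrable_bound)
    show "integrable M (\<lambda>x. 2 * (cmod (f x))\<^sup>2 + 2 * (cmod (g x))\<^sup>2)"
      using assms[THEN sqi_integrable_sq] by simp
    show "(\<lambda>x. (cmod (f x + g x))\<^sup>2) \<in> borel_measurable M" using m by simp
    show "AE x in M. norm ((cmod (f x + g x))\<^sup>2) \<le> norm (2 * (cmod (f x))\<^sup>2 + 2 * (cmod (g x))\<^sup>2)"
    proof (rule AE_I2)
      fix x
      have "(cmod (f x + g x))\<^sup>2 \<le> (cmod (f x) + cmod (g x))\<^sup>2"
        by (intro power_mono norm_triangle_ineq) simp
      also have "\<dots> \<le> 2 * (cmod (f x))\<^sup>2 + 2 * (cmod (g x))\<^sup>2"
        using sum_squares_bound[of "cmod (f x)" "cmod (g x)"] by (simp add: power2_sum)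
      finally show "norm ((cmod (f x + g x))\<^sup>2) \<le> norm (2 * (cmod (f x))\<^sup>2 + 2 * (cmod (g x))\<^sup>2)" by simp
    qed
  qed
qed

lemma sqi_diff:
  assumes "sqi M f" "sqi M g"
  shows "sqi M (\<lambda>x. f x - g x)"
  using sqi_add[OF assms(1) sqi_cmult[OF assms(2), of "-1"]] by simp

lemma sqi_zero: "sqi M (\<lambda>_. 0)"
  by (simp add: sqi_def)

lemma sqi_sum: "(\<And>k. k \<in> F \<Longrightarrow> sqi M (f k)) \<Longrightarrow> sqi M (\<lambda>x. \<Sum>k\<in>F. f k x)"
  by (induction F rule: infinite_finite_induct) (auto simp: sqi_zero intro: sqi_add)

text \<open>The single step of Bessel's identity: it is applied with one basis function subtracted
  at a time.\<close>

lemma integral_sq_diff: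
  assumes "sqi M f" "sqi M g"
  shows "(\<integral>x. (cmod (f x - a * g x))\<^sup>2 \<partial>M)
    = (\<integral>x. (cmod (f x))\<^sup>2 \<partial>M) - 2 * Re (cnj a * (\<integral>x. f x * cnj (g x) \<partial>M)) + (cmod a)\<^sup>2 * (\<integral>x. (cmod (g x))\<^sup>2 \<partial>M)"
proof -
  have i: "integrable M (\<lambda>x. f x * cnj (g x))"
    using assms by (intro sqi_mult_integrable sqi_cnj)
  have i1: "integrable M (\<lambda>x. (cmod (f x))\<^sup>2)" using assms(1) by (rule sqi_integrable_sq)
  have i2: "integrable M (\<lambda>x. 2 * Re (cnj a * (f x * cnj (g x))))"
    using i by (intro integrable_mult_right integrable_Re)
  have i3: "integrable M (\<lambda>x. (cmod a)\<^sup>2 * (cmod (g x))\<^sup>2)"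
    using sqi_integrable_sq[OF assms(2)] by (rule integrable_mult_right)
  have "(cmod (f x - a * g x))\<^sup>2 = (cmod (f x))\<^sup>2 - 2 * Re (cnj a * (f x * cnj (g x))) + (cmod a)\<^sup>2 * (cmod (g x))\<^sup>2" for x
    by (simp only: cmod_power2) (simp add: power2_eq_square algebra_simps)
  then have "(\<integral>x. (cmod (f x - a * g x))\<^sup>2 \<partial>M)
    = (\<integral>x. (cmod (f x))\<^sup>2 - 2 * Re (cnj a * (f x * cnj (g x))) + (cmod a)\<^sup>2 * (cmod (g x))\<^sup>2 \<partial>M)"
    by simp
  also have "\<dots> = (\<integral>x. (cmod (f x))\<^sup>2 \<partial>M) - (\<integral>x. 2 * Re (cnj a * (f x * cnj (g x))) \<partial>M) + (\<integral>x. (cmod a)\<^sup>2 * (cmod (g x))\<^sup>2 \<partial>M)"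
    by (simp only: Bochner_Integration.integral_add Bochner_Integration.integral_diff Bochner_Integration.integrable_diff i1 i2 i3)
  also have "(\<integral>x. 2 * Re (cnj a * (f x * cnj (g x))) \<partial>M) = 2 * Re (cnj a * (\<integral>x. f x * cnj (g x) \<partial>M))"
    by (simp only: integral_mult_right_zero integral_Re integrable_mult_right i)
  finally show ?thesis by simp
qed

section \<open>Completeness of the square-integrable functions\<close>

context prob_space
begin

lemma sqi_integrable:
  assumes "sqi M f"
  shows "integrable M f"
proof (rule Bochner_Integration.integrable_bound)
  show "integrable M (\<lambda>x. 1 + (cmod (f x))\<^sup>2)" using sqi_integrable_sq[OF assms] by simp
  show "f \<in> borel_measurable M" using assms by (rule sqi_measurable)
  show "AE x in M. norm (f x) \<le> norm (1 + (cmod (f x))\<^sup>2)"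
  proof (rule AE_I2)
    fix x
    show "norm (f x) \<le> norm (1 + (cmod (f x))\<^sup>2)"
      using sum_squares_bound[of "cmod (f x)" 1] by (simp, smt (verit) norm_ge_zero)
  qed
qed

text \<open>Cauchy-Schwarz against the constant 1, obtained by integrating |f| \<le> t/2 +
  |f|^2/(2t) over a probability space.\<close>

lemma integral_norm_le_of_sq:
  assumes "sqi M f" "(\<integral>x. (cmod (f x))\<^sup>2 \<partial>M) \<le> t\<^sup>2" "0 < t"
  shows "(\<integral>x. cmod (f x) \<partial>M) \<le> t"
proof -
  have "(\<integral>x. cmod (f x) \<partial>M) \<le> (\<integral>x. t / 2 + (cmod (f x))\<^sup>2 / (2 * t) \<partial>M)"
  proof (rule integral_mono)
    show "integrable M (\<lambda>x. cmod (f x))" using sqi_integrable[OF assms(1)] by simp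
    show "integrable M (\<lambda>x. t / 2 + (cmod (f x))\<^sup>2 / (2 * t))" using sqi_integrable_sq[OF assms(1)] by simp
    show "cmod (f x) \<le> t / 2 + (cmod (f x))\<^sup>2 / (2 * t)" for x
      using sum_squares_bound[of "cmod (f x)" t] assms(3) by (simp add: field_simps power2_eq_square)
  qed
  also have "\<dots> = t / 2 + (\<integral>x. (cmod (f x))\<^sup>2 \<partial>M) / (2 * t)"
    using sqi_integrable_sq[OF assms(1)] by (simp add: prob_space)
  also have "\<dots> \<le> t / 2 + t\<^sup>2 / (2 * t)" using assms by (intro add_left_mono divide_right_mono) auto
  also have "\<dots> = t" using assms(3) by (simp add: power2_eq_square)
  finally show ?thesis .
qed

text \<open>Increments of geometric size in L2, hence in L1, make the telescoping series converge
  absolutely almost everywhere; Fatou's lemma transfers the Cauchy bound to the limit, so the rate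
  is retained.\<close>

lemma fast_Cauchy_L2:
  assumes g: "\<And>n. sqi M (g n)"
    and C: "\<And>m n. n \<le> m \<Longrightarrow> (\<integral>x. (cmod (g m x - g n x))\<^sup>2 \<partial>M) \<le> ((1/2)^n)\<^sup>2"
  shows "\<exists>f. sqi M f \<and> (\<forall>n. (\<integral>x. (cmod (f x - g n x))\<^sup>2 \<partial>M) \<le> ((1/2)^n)\<^sup>2)"
proof -
  have gm: "g n \<in> borel_measurable M" for n using g by (rule sqi_measurable)
  define f where "f x = lim (\<lambda>n. g n x)" for x
  have fm: "f \<in> borel_measurable M"
    unfolding f_def by (rule borel_measurable_lim_metric) (rule gm)
  have "(\<lambda>x. cmod (g (Suc n) x - g n x)) \<in> borel_measurable M" for n
    by (intro measurable_compose[OF _ borel_measurable_norm] borel_measurable_diff gm)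
  then have dm: "(\<lambda>x. \<Sum>n. ennreal (cmod (g (Suc n) x - g n x))) \<in> borel_measurable M" by measurable
  have L1: "(\<integral>\<^sup>+x. ennreal (cmod (g (Suc n) x - g n x)) \<partial>M) \<le> ennreal ((1/2)^n)" for n
  proof -
    have "(\<integral>x. cmod (g (Suc n) x - g n x) \<partial>M) \<le> (1/2)^n"
      by (rule integral_norm_le_of_sq) (auto intro: sqi_diff g C)
    then show ?thesis
      by (subst nn_integral_eq_integral) (auto intro!: integrable_norm sqi_integrable sqi_diff g)
  qed
  have "(\<integral>\<^sup>+x. (\<Sum>n. ennreal (cmod (g (Suc n) x - g n x))) \<partial>M) = (\<Sum>n. \<integral>\<^sup>+x. ennreal (cmod (g (Suc n) x - g n x)) \<partial>M)"
    using gm by (intro nn_integral_suminf) auto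
  also have "\<dots> \<le> (\<Sum>n. ennreal ((1/2)^n))" by (intro suminf_le L1) auto
  also have "\<dots> = ennreal (\<Sum>n. (1/2)^n)" by (intro suminf_ennreal2) (auto simp: summable_geometric)
  also have "\<dots> < \<infinity>" by simp
  finally have fin: "(\<integral>\<^sup>+x. (\<Sum>n. ennreal (cmod (g (Suc n) x - g n x))) \<partial>M) \<noteq> \<infinity>"
    unfolding less_top infinity_ennreal_def .
  have "AE x in M. (\<Sum>n. ennreal (cmod (g (Suc n) x - g n x))) \<noteq> \<infinity>"
    by (rule nn_integral_PInf_AE[OF dm fin])
  then have conv: "AE x in M. (\<lambda>n. g n x) \<longlonglongrightarrow> f x"
  proof eventually_elim
    case (elim x)
    have "summable (\<lambda>n. cmod (g (Suc n) x - g n x))"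
      by (rule summable_suminf_not_top) (use elim in auto)
    then have "summable (\<lambda>n. g (Suc n) x - g n x)" by (rule summable_norm_cancel)
    then have "convergent (\<lambda>n. \<Sum>i<n. g (Suc i) x - g i x)" by (simp add: summable_iff_convergent)
    then have "convergent (\<lambda>n. g n x - g 0 x)" using sum_lessThan_telescope[of "\<lambda>n. g n x"] by simp
    then have "convergent (\<lambda>n. g n x)" 
      using convergent_add[OF _ convergent_const[of "g 0 x"]] by fastforce
    then show ?case by (simp add: f_def convergent_LIMSEQ_iff)
  qed
  have Fatou: "(\<integral>\<^sup>+x. ennreal ((cmod (f x - g n x))\<^sup>2) \<partial>M) \<le> ennreal (((1/2)^n)\<^sup>2)" for n
  proof -
    have "(\<integral>\<^sup>+x. ennreal ((cmod (f x - g n x))\<^sup>2) \<partial>M)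
       = (\<integral>\<^sup>+x. liminf (\<lambda>m. ennreal ((cmod (g m x - g n x))\<^sup>2)) \<partial>M)"
    proof (rule nn_integral_cong_AE, use conv in eventually_elim)
      case (elim x)
      have "(\<lambda>m. ennreal ((cmod (g m x - g n x))\<^sup>2)) \<longlonglongrightarrow> ennreal ((cmod (f x - g n x))\<^sup>2)"
        by (intro tendsto_intros tendsto_ennrealI elim)
      then show ?case by (metis lim_imp_Liminf sequentially_bot)
    qed
    also have "\<dots> \<le> liminf (\<lambda>m. \<integral>\<^sup>+x. ennreal ((cmod (g m x - g n x))\<^sup>2) \<partial>M)"
      using gm by (intro nn_integral_liminf) auto
    also have "\<dots> \<le> ennreal (((1/2)^n)\<^sup>2)"
    proof (rule order_trans[OF Liminf_le_Limsup Limsup_bounded], simp, rule eventually_sequentiallyI[of n])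
      fix m assume "n \<le> m"
      then show "(\<integral>\<^sup>+x. ennreal ((cmod (g m x - g n x))\<^sup>2) \<partial>M) \<le> ennreal (((1/2)^n)\<^sup>2)"
        using C[of n m] sqi_integrable_sq[OF sqi_diff[OF g g], of m n] by (subst nn_integral_eq_integral) auto
    qed
    finally show ?thesis .
  qed
  have "integrable M (\<lambda>x. (cmod (f x - g n x))\<^sup>2)" for n
    using Fatou[of n] fm gm by (intro integrableI_bounded) (auto simp: le_less_trans)
  then have d: "sqi M (\<lambda>x. f x - g n x)" for n
    unfolding sqi_def using fm gm by auto
  have "sqi M f" using sqi_add[OF d[of 0] g[of 0]] by simp
  moreover have "(\<integral>x. (cmod (f x - g n x))\<^sup>2 \<partial>M) \<le> ((1/2)^n)\<^sup>2" for n
    using Fatou[of n] by (subst (asm) nn_integral_eq_integral) (auto intro: sqi_integrable_sq d)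
  ultimately show ?thesis by blast
qed

end

text \<open>Completeness is assumed as uniqueness of the coefficients of integrable functions.
  Parseval's identity is derived from it through Riesz-Fischer, with no appeal to density of finite
  sums in L2.\<close>

locale fourier_basis = prob_space M for M :: "'a measure" +
  fixes K :: "'k set" and e :: "'k \<Rightarrow> 'a \<Rightarrow> complex"
  assumes e_measurable: "k \<in> K \<Longrightarrow> e k \<in> borel_measurable M"
    and e_norm: "k \<in> K \<Longrightarrow> cmod (e k x) = 1"
    and e_orthonormal: "k \<in> K \<Longrightarrow> l \<in> K \<Longrightarrow> (\<integral>x. e k x * cnj (e l x) \<partial>M) = (if k = l then 1 else 0)"
    and complete: "integrable M f \<Longrightarrow> (\<And>k. k \<in> K \<Longrightarrow> (\<integral>x. f x * cnj (e k x) \<partial>M) = 0) \<Longrightarrow> AE x in M. f x = 0"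
begin

definition fc :: "('a \<Rightarrow> complex) \<Rightarrow> 'k \<Rightarrow> complex" where
  "fc f k = (\<integral>x. f x * cnj (e k x) \<partial>M)"

lemma sqi_e: "k \<in> K \<Longrightarrow> sqi M (e k)"
  unfolding sqi_def using e_measurable e_norm by auto

lemma fc_integrable: "sqi M f \<Longrightarrow> k \<in> K \<Longrightarrow> integrable M (\<lambda>x. f x * cnj (e k x))"
  by (intro sqi_mult_integrable sqi_cnj sqi_e)

lemma fc_lincomb:
  assumes "sqi M f" "sqi M g" "k \<in> K"
  shows "fc (\<lambda>x. a * f x + b * g x) k = a * fc f k + b * fc g k"
proof -
  have "fc (\<lambda>x. a * f x + b * g x) k = (\<integral>x. a * (f x * cnj (e k x)) + b * (g x * cnj (e k x)) \<partial>M)"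
    unfolding fc_def by (intro Bochner_Integration.integral_cong) (auto simp: algebra_simps)
  also have "\<dots> = a * fc f k + b * fc g k"
    unfolding fc_def using assms by (simp add: fc_integrable)
  finally show ?thesis .
qed

lemma fc_diff:
  assumes "sqi M f" "sqi M g" "k \<in> K"
  shows "fc (\<lambda>x. f x - g x) k = fc f k - fc g k"
  using fc_lincomb[OF assms, of 1 "-1"] by simp

lemma fc_sum:
  assumes "finite F" "F \<subseteq> K" "k \<in> K"
  shows "fc (\<lambda>x. \<Sum>l\<in>F. a l * e l x) k = (if k \<in> F then a k else 0)"
proof -
  have "fc (\<lambda>x. \<Sum>l\<in>F. a l * e l x) k = (\<integral>x. (\<Sum>l\<in>F. a l * (e l x * cnj (e k x))) \<partial>M)"
    unfolding fc_def by (intro Bochner_Integration.integral_cong) (auto simp: sum_distrib_right mult.assoc)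
  also have "\<dots> = (\<Sum>l\<in>F. a l * (\<integral>x. e l x * cnj (e k x) \<partial>M))"
    using assms by (subst Bochner_Integration.integral_sum) (auto intro!: fc_integrable sqi_e)
  also have "\<dots> = (\<Sum>l\<in>F. if l = k then a l else 0)"
    using assms by (intro sum.cong) (auto simp: e_orthonormal subset_iff)
  finally show ?thesis using assms by simp
qed

lemma norm_e: "k \<in> K \<Longrightarrow> (\<integral>x. (cmod (e k x))\<^sup>2 \<partial>M) = 1"
  by (simp add: e_norm prob_space)

text \<open>The coefficients \<open>a\<close> are arbitrary: \<open>a = fc f\<close> gives Bessel's
  inequality, and \<open>f = 0\<close> gives the norm of a finite sum.\<close>

lemma Bessel_identity:
  assumes f: "sqi M f" and F: "finite F" "F \<subseteq> K"
  shows "(\<integral>x. (cmod (f x - (\<Sum>k\<in>F. a k * e k x)))\<^sup>2 \<partial>M)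
    = (\<integral>x. (cmod (f x))\<^sup>2 \<partial>M) - (\<Sum>k\<in>F. 2 * Re (cnj (a k) * fc f k)) + (\<Sum>k\<in>F. (cmod (a k))\<^sup>2)"
  using F
proof (induction F)
  case (insert k F)
  let ?S = "\<lambda>x. \<Sum>l\<in>F. a l * e l x"
  have F: "F \<subseteq> K" "k \<in> K" using insert by auto
  have S: "sqi M ?S" using F by (intro sqi_sum sqi_cmult sqi_e) auto
  have fS: "sqi M (\<lambda>x. f x - ?S x)" by (rule sqi_diff[OF f S])
  have c: "(\<integral>x. (f x - ?S x) * cnj (e k x) \<partial>M) = fc f k"
    using fc_diff[OF f S F(2)] fc_sum[OF insert.hyps(1) F] insert.hyps(2) by (simp add: fc_def)
  have "(\<integral>x. (cmod (f x - (\<Sum>k\<in>insert k F. a k * e k x)))\<^sup>2 \<partial>M) = (\<integral>x. (cmod ((f x - ?S x) - a k * e k x))\<^sup>2 \<partial>M)"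
    using insert.hyps by (intro Bochner_Integration.integral_cong) (auto simp: algebra_simps)
  also have "\<dots> = (\<integral>x. (cmod (f x - ?S x))\<^sup>2 \<partial>M) - 2 * Re (cnj (a k) * fc f k) + (cmod (a k))\<^sup>2"
    unfolding integral_sq_diff[OF fS sqi_e[OF F(2)]] c norm_e[OF F(2)] by simp
  finally show ?case using insert by simp
qed simp

text \<open>Finite sets that capture the total up to the square of (1/2)^n take the place of an
  enumeration of \<open>K\<close>. Unions make them increasing, so that the difference of two
  partial sums is carried by a tail and the partial sums are fast Cauchy.\<close>

lemma Riesz_Fischer:
  assumes sm: "(\<lambda>k. (cmod (a k))\<^sup>2) summable_on K"
  shows "\<exists>f. sqi M f \<and> (\<forall>k\<in>K. fc f k = a k) \<and> ((\<lambda>k. (cmod (a k))\<^sup>2) has_sum (\<integral>x. (cmod (f x))\<^sup>2 \<partial>M)) K"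
proof -
  define S where "S = infsum (\<lambda>k. (cmod (a k))\<^sup>2) K"
  have hs: "((\<lambda>k. (cmod (a k))\<^sup>2) has_sum S) K" using sm by (simp add: S_def)
  have "\<exists>F. finite F \<and> F \<subseteq> K \<and> (\<Sum>k\<in>F. (cmod (a k))\<^sup>2) > S - ((1/2)^n)\<^sup>2" for n :: nat
  proof -
    have "\<forall>\<^sub>F F in finite_subsets_at_top K. (\<Sum>k\<in>F. (cmod (a k))\<^sup>2) > S - ((1/2)^n)\<^sup>2"
      using hs unfolding has_sum_def by (rule order_tendstoD) simp
    then show ?thesis unfolding eventually_finite_subsets_at_top by blast
  qed
  then obtain F0 where F0: "\<And>n. finite (F0 n) \<and> F0 n \<subseteq> K \<and> (\<Sum>k\<in>F0 n. (cmod (a k))\<^sup>2) > S - ((1/2)^n)\<^sup>2"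
    by metis
  define F where "F n = (\<Union>m\<le>n. F0 m)" for n
  have F: "finite (F n)" "F n \<subseteq> K" for n unfolding F_def using F0 by auto
  have Fmono: "n \<le> m \<Longrightarrow> F n \<subseteq> F m" for n m unfolding F_def by (auto intro: order_trans)
  have FS: "(\<Sum>k\<in>F n. (cmod (a k))\<^sup>2) > S - ((1/2)^n)\<^sup>2" for n
  proof -
    have "(\<Sum>k\<in>F0 n. (cmod (a k))\<^sup>2) \<le> (\<Sum>k\<in>F n. (cmod (a k))\<^sup>2)"
      using F by (intro sum_mono2) (auto simp: F_def)
    then show ?thesis using F0[of n] by linarith
  qed
  have le_S: "(\<Sum>k\<in>G. (cmod (a k))\<^sup>2) \<le> S" if "finite G" "G \<subseteq> K" for G
    using finite_sum_le_has_sum[OF hs that(1)] that by auto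
  have tail: "(\<Sum>k\<in>G. (cmod (a k))\<^sup>2) \<le> ((1/2)^n)\<^sup>2" if G: "finite G" "G \<subseteq> K" "G \<inter> F n = {}" for G n
  proof -
    have "(\<Sum>k\<in>G \<union> F n. (cmod (a k))\<^sup>2) = (\<Sum>k\<in>G. (cmod (a k))\<^sup>2) + (\<Sum>k\<in>F n. (cmod (a k))\<^sup>2)"
      using G F by (intro sum.union_disjoint) auto
    moreover have "(\<Sum>k\<in>G \<union> F n. (cmod (a k))\<^sup>2) \<le> S" using G F by (intro le_S) auto
    ultimately show ?thesis using FS[of n] by linarith
  qed
  define g where "g n x = (\<Sum>k\<in>F n. a k * e k x)" for n x
  have g: "sqi M (g n)" for n
    unfolding g_def using F by (intro sqi_sum sqi_cmult sqi_e) auto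
  have "(\<integral>x. (cmod (g m x - g n x))\<^sup>2 \<partial>M) \<le> ((1/2)^n)\<^sup>2" if "n \<le> m" for m n
  proof -
    have "g m x - g n x = (\<Sum>k\<in>F m - F n. a k * e k x)" for x
      unfolding g_def using F Fmono[OF that] by (simp add: sum_diff)
    then have "(\<integral>x. (cmod (g m x - g n x))\<^sup>2 \<partial>M) = (\<integral>x. (cmod (0 - (\<Sum>k\<in>F m - F n. a k * e k x)))\<^sup>2 \<partial>M)"
      by simp
    also have "\<dots> = (\<Sum>k\<in>F m - F n. (cmod (a k))\<^sup>2)"
      using F by (subst Bessel_identity) (auto simp: sqi_zero fc_def)
    also have "\<dots> \<le> ((1/2)^n)\<^sup>2" using F by (intro tail) auto
    finally show ?thesis .
  qed
  then obtain f where f: "sqi M f" "\<And>n. (\<integral>x. (cmod (f x - g n x))\<^sup>2 \<partial>M) \<le> ((1/2)^n)\<^sup>2"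
    using fast_Cauchy_L2[of g] g by blast
  have fc_f: "fc f k = a k" if k: "k \<in> K" for k
  proof -
    have b: "cmod (fc f k - a k) \<le> 2 * (1/2)^n" for n
    proof -
      have "cmod (fc f k - fc (g n) k) = cmod (\<integral>x. (f x - g n x) * cnj (e k x) \<partial>M)"
        using fc_diff[OF f(1) g k] by (simp add: fc_def)
      also have "\<dots> \<le> (\<integral>x. cmod ((f x - g n x) * cnj (e k x)) \<partial>M)" by (rule integral_norm_bound)
      also have "\<dots> = (\<integral>x. cmod (f x - g n x) \<partial>M)" by (simp add: norm_mult e_norm k)
      also have "\<dots> \<le> (1/2)^n" by (rule integral_norm_le_of_sq) (auto intro: sqi_diff f g)
      finally have 1: "cmod (fc f k - fc (g n) k) \<le> (1/2)^n" .
      have "cmod (fc (g n) k - a k) \<le> (1/2)^n"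
      proof (cases "k \<in> F n")
        case True
        then show ?thesis using fc_sum[OF F k] by (simp add: g_def[abs_def])
      next
        case False
        then have "(cmod (a k))\<^sup>2 \<le> ((1/2)^n)\<^sup>2" using tail[of "{k}" n] k by simp
        then have "cmod (a k) \<le> (1/2)^n" by (rule power2_le_imp_le) simp
        then show ?thesis using fc_sum[OF F k] False by (simp add: g_def[abs_def])
      qed
      then show ?thesis using 1 norm_triangle_ineq[of "fc f k - fc (g n) k" "fc (g n) k - a k"] by simp
    qed
    have "(\<lambda>n. 2 * (1/2::real)^n) \<longlonglongrightarrow> 2 * 0" by (intro tendsto_intros LIMSEQ_power_zero) simp
    then have "cmod (fc f k - a k) \<le> 0" using b by (intro LIMSEQ_le_const[where X = "\<lambda>n. 2 * (1/2)^n"]) auto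
    then show ?thesis by simp
  qed
  have "\<bar>(\<integral>x. (cmod (f x))\<^sup>2 \<partial>M) - S\<bar> \<le> ((1/2)^n)\<^sup>2" for n
  proof -
    have "(\<integral>x. (cmod (f x - g n x))\<^sup>2 \<partial>M) = (\<integral>x. (cmod (f x))\<^sup>2 \<partial>M) - (\<Sum>k\<in>F n. 2 * Re (cnj (a k) * fc f k)) + (\<Sum>k\<in>F n. (cmod (a k))\<^sup>2)"
      unfolding g_def by (rule Bessel_identity[OF f(1) F])
    also have "(\<Sum>k\<in>F n. 2 * Re (cnj (a k) * fc f k)) = (\<Sum>k\<in>F n. 2 * (cmod (a k))\<^sup>2)"
    proof (rule sum.cong[OF refl])
      fix k assume "k \<in> F n"
      then have "k \<in> K" using F by blast
      then show "2 * Re (cnj (a k) * fc f k) = 2 * (cmod (a k))\<^sup>2"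
        by (simp only: fc_f cmod_power2) (simp add: power2_eq_square)
    qed
    finally have eq: "(\<integral>x. (cmod (f x - g n x))\<^sup>2 \<partial>M) = (\<integral>x. (cmod (f x))\<^sup>2 \<partial>M) - (\<Sum>k\<in>F n. (cmod (a k))\<^sup>2)"
      by (simp add: sum_distrib_left[symmetric])
    have "0 \<le> (\<integral>x. (cmod (f x - g n x))\<^sup>2 \<partial>M)" by simp
    then show ?thesis using eq f(2)[of n] le_S[OF F(1) F(2), of n] FS[of n] by linarith
  qed
  moreover have "(\<lambda>n. ((1/2::real)^n)\<^sup>2) \<longlonglongrightarrow> 0\<^sup>2" by (intro tendsto_intros LIMSEQ_power_zero) simp
  ultimately have "\<bar>(\<integral>x. (cmod (f x))\<^sup>2 \<partial>M) - S\<bar> \<le> 0"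
    by (intro LIMSEQ_le_const[where X = "\<lambda>n. ((1/2)^n)\<^sup>2"]) auto
  then have "(\<integral>x. (cmod (f x))\<^sup>2 \<partial>M) = S" by simp
  then show ?thesis using f(1) fc_f hs by auto
qed

text \<open>Bessel's inequality makes the coefficients square summable; the function that
  Riesz-Fischer builds from them satisfies the identity and coincides with \<open>f\<close> almost
  everywhere by completeness.\<close>

lemma Parseval:
  assumes f: "sqi M f"
  shows "((\<lambda>k. (cmod (fc f k))\<^sup>2) has_sum (\<integral>x. (cmod (f x))\<^sup>2 \<partial>M)) K"
proof -
  have "(\<lambda>k. (cmod (fc f k))\<^sup>2) summable_on K"
  proof (rule nonneg_bdd_above_summable_on)
    show "bdd_above (sum (\<lambda>k. (cmod (fc f k))\<^sup>2) ` {F. F \<subseteq> K \<and> finite F})"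
    proof (rule bdd_aboveI2)
      fix F assume "F \<in> {F. F \<subseteq> K \<and> finite F}"
      then have F: "finite F" "F \<subseteq> K" by auto
      have "0 \<le> (\<integral>x. (cmod (f x - (\<Sum>k\<in>F. fc f k * e k x)))\<^sup>2 \<partial>M)" by simp
      also have "\<dots> = (\<integral>x. (cmod (f x))\<^sup>2 \<partial>M) - (\<Sum>k\<in>F. 2 * Re (cnj (fc f k) * fc f k)) + (\<Sum>k\<in>F. (cmod (fc f k))\<^sup>2)"
        by (rule Bessel_identity[OF f F])
      also have "(\<Sum>k\<in>F. 2 * Re (cnj (fc f k) * fc f k)) = 2 * (\<Sum>k\<in>F. (cmod (fc f k))\<^sup>2)"
        by (simp add: sum_distrib_left cmod_power2) (simp add: power2_eq_square)
      finally show "(\<Sum>k\<in>F. (cmod (fc f k))\<^sup>2) \<le> (\<integral>x. (cmod (f x))\<^sup>2 \<partial>M)" by simp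
    qed
  qed simp
  from Riesz_Fischer[OF this] obtain g where g: "sqi M g" "\<And>k. k \<in> K \<Longrightarrow> fc g k = fc f k"
    "((\<lambda>k. (cmod (fc f k))\<^sup>2) has_sum (\<integral>x. (cmod (g x))\<^sup>2 \<partial>M)) K" by blast
  have "AE x in M. f x - g x = 0"
  proof (rule complete)
    show "integrable M (\<lambda>x. f x - g x)" by (intro sqi_integrable sqi_diff f g)
    show "(\<integral>x. (f x - g x) * cnj (e k x) \<partial>M) = 0" if "k \<in> K" for k
      using fc_diff[OF f g(1) that] g(2)[OF that] by (simp add: fc_def)
  qed
  then have "(\<integral>x. (cmod (f x))\<^sup>2 \<partial>M) = (\<integral>x. (cmod (g x))\<^sup>2 \<partial>M)"
    by (intro integral_cong_AE borel_measurable_integrable sqi_integrable_sq f g) auto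
  then show ?thesis using g(3) by simp
qed

text \<open>Polarization. The same identity for cnj a * b is applied to the coefficients and,
  pointwise, to the function values.\<close>

lemma Parseval_inner:
  assumes f: "sqi M f" and g: "sqi M g"
  shows "((\<lambda>k. cnj (fc f k) * fc g k) has_sum (\<integral>x. cnj (f x) * g x \<partial>M)) K"
proof -
  have polar: "cnj a * b = (of_real ((cmod (1 * a + 1 * b))\<^sup>2) - of_real ((cmod (1 * a + (-1) * b))\<^sup>2)
      - \<i> * (of_real ((cmod (1 * a + \<i> * b))\<^sup>2) - of_real ((cmod (1 * a + (-\<i>) * b))\<^sup>2))) / 4" for a b
    unfolding cmod_power2 by (simp add: complex_eq_iff power2_eq_square algebra_simps)
  have sq: "sqi M (\<lambda>x. 1 * f x + b * g x)" for b
    by (intro sqi_add sqi_cmult f g)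
  define I where "I b = (\<integral>x. (cmod (1 * f x + b * g x))\<^sup>2 \<partial>M)" for b
  have hs: "((\<lambda>k. complex_of_real ((cmod (1 * fc f k + b * fc g k))\<^sup>2)) has_sum complex_of_real (I b)) K" for b
  proof -
    have "((\<lambda>k. (cmod (fc (\<lambda>x. 1 * f x + b * g x) k))\<^sup>2) has_sum I b) K"
      unfolding I_def by (rule Parseval[OF sq])
    then have "((\<lambda>k. (cmod (1 * fc f k + b * fc g k))\<^sup>2) has_sum I b) K"
      by (rule has_sum_cong[THEN iffD1, rotated]) (simp only: fc_lincomb[OF f g])
    then show ?thesis by (rule has_sum_of_real)
  qed
  have "((\<lambda>k. cnj (fc f k) * fc g k) has_sum ((of_real (I 1) - of_real (I (-1)) - \<i> * (of_real (I \<i>) - of_real (I (-\<i>)))) / 4)) K"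
    unfolding polar by (intro has_sum_divide_const has_sum_subtract has_sum_cmult_right hs)
  also have "(of_real (I 1) - of_real (I (-1)) - \<i> * (of_real (I \<i>) - of_real (I (-\<i>)))) / 4
    = (\<integral>x. cnj (f x) * g x \<partial>M)"
  proof -
    have iI: "integrable M (\<lambda>x. complex_of_real ((cmod (1 * f x + b * g x))\<^sup>2))" for b
      using sqi_integrable_sq[OF sq] by (rule integrable_of_real)
    have II: "complex_of_real (I b) = (\<integral>x. complex_of_real ((cmod (1 * f x + b * g x))\<^sup>2) \<partial>M)" for b
      unfolding I_def using sqi_integrable_sq[OF sq, of b] by (intro integral_of_real[symmetric])
    show ?thesis
      unfolding polar[of "f _" "g _"] II using iI
      by (simp only: integral_divide_zero Bochner_Integration.integral_diff integral_mult_right_zero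
          Bochner_Integration.integrable_diff integrable_mult_right)
  qed
  finally show ?thesis .
qed

end

section \<open>Wave functions in Fourier coordinates\<close>

text \<open>Extensional on the particle indices, so that distinct elements are distinct modes and
  orthonormality holds with equality of indices.\<close>

definition modes :: "nat \<Rightarrow> (nat \<Rightarrow> int) set" where
  "modes N = PiE {..<N} (\<lambda>_. UNIV)"

definition idx :: "nat \<Rightarrow> ((nat \<Rightarrow> int) \<times> (nat \<Rightarrow> bool)) set" where
  "idx N = modes N \<times> spins N"

definition coef :: "nat \<Rightarrow> wavefn \<Rightarrow> (nat \<Rightarrow> int) \<times> (nat \<Rightarrow> bool) \<Rightarrow> complex" where
  "coef N \<Psi> i = (\<integral>x. \<Psi> x (snd i) * cnj (emode N (fst i) x) \<partial>cube N)"

definition lc :: "complex \<Rightarrow> wavefn \<Rightarrow> complex \<Rightarrow> wavefn \<Rightarrow> wavefn" where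
  "lc a \<Phi> b \<Psi> = (\<lambda>x s. a * \<Phi> x s + b * \<Psi> x s)"

text \<open>The eigenvalue of minus one half of the Laplacian on a mode: half of (2 pi)^2 times the
  squared length of the momentum. It does not depend on the spins.\<close>

definition kap :: "nat \<Rightarrow> (nat \<Rightarrow> int) \<times> (nat \<Rightarrow> bool) \<Rightarrow> real" where
  "kap N i = 2 * pi\<^sup>2 * (\<Sum>j<N. (of_int (fst i j))\<^sup>2)"

lemma kap_nonneg: "0 \<le> kap N i"
  by (simp add: kap_def sum_nonneg)

lemma finite_spins [simp]: "finite (spins N)"
  unfolding spins_def by (intro finite_PiE) auto

lemma countable_idx: "countable (idx N)"
  unfolding idx_def modes_def by (intro countable_SIGMA countable_PiE countable_finite[OF finite_spins]) auto

lemma emode_restrict: "emode N (restrict k {..<N}) = emode N k"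
  unfolding emode_on_lessThan[symmetric] by (intro emode_on_cong) auto

lemma restrict_in_modes: "restrict k {..<N} \<in> modes N"
  by (simp add: modes_def)

lemma fourier_basis_cube: "fourier_basis (cube N) (modes N) (emode N)"
proof -
  interpret prob_space "cube N" by (rule prob_space_cube)
  show ?thesis
  proof
    show "(\<integral>x. emode N k x * cnj (emode N l x) \<partial>cube N) = (if k = l then 1 else 0)" if "k \<in> modes N" "l \<in> modes N" for k l
    proof -
      have "(\<forall>j<N. k j = l j) \<longleftrightarrow> k = l"
        using that unfolding modes_def by (auto intro: PiE_ext)
      then show ?thesis by (simp add: emode_orthonormal)
    qed
    fix f assume f: "integrable (cube N) f" "\<And>k. k \<in> modes N \<Longrightarrow> (\<integral>x. f x * cnj (emode N k x) \<partial>cube N) = 0"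
    show "AE x in cube N. f x = 0"
      by (rule fourier_unique_cube[OF f(1)]) (metis f(2) emode_restrict restrict_in_modes)
  qed simp_all
qed

interpretation cube: fourier_basis "cube N" "modes N" "emode N" for N
  by (rule fourier_basis_cube)

lemma coef_fc: "coef N \<Psi> (k, s) = cube.fc N (\<lambda>x. \<Psi> x s) k"
  by (simp add: coef_def cube.fc_def)

lemma L2_iff_sqi: "L2 N \<Psi> \<longleftrightarrow> (\<forall>s\<in>spins N. sqi (cube N) (\<lambda>x. \<Psi> x s))"
  by (auto simp: L2_def sqi_def)

lemma L2D: "L2 N \<Psi> \<Longrightarrow> s \<in> spins N \<Longrightarrow> sqi (cube N) (\<lambda>x. \<Psi> x s)"
  by (simp add: L2_iff_sqi)

lemma L2_lc: "L2 N \<Phi> \<Longrightarrow> L2 N \<Psi> \<Longrightarrow> L2 N (lc a \<Phi> b \<Psi>)"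
  unfolding L2_iff_sqi lc_def by (auto intro!: sqi_add sqi_cmult)

lemma coef_lc:
  assumes "L2 N \<Phi>" "L2 N \<Psi>" "i \<in> idx N"
  shows "coef N (lc a \<Phi> b \<Psi>) i = a * coef N \<Phi> i + b * coef N \<Psi> i"
proof -
  obtain k s where i: "i = (k, s)" "k \<in> modes N" "s \<in> spins N" using assms(3) by (auto simp: idx_def)
  show ?thesis unfolding i(1) coef_fc lc_def
    by (rule cube.fc_lincomb) (use assms i in \<open>auto intro: L2D\<close>)
qed

lemma has_sum_Times_finite:
  fixes f :: "'a \<times> 'b \<Rightarrow> 'c :: {topological_comm_monoid_add}"
  assumes "finite S" "\<And>s. s \<in> S \<Longrightarrow> ((\<lambda>k. f (k, s)) has_sum g s) A"
  shows "(f has_sum (\<Sum>s\<in>S. g s)) (A \<times> S)"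
  using assms
proof (induction S rule: finite_induct)
  case empty
  then show ?case by simp
next
  case (insert s S)
  have "(f \<circ> (\<lambda>k. (k, s)) has_sum g s) A" using insert.prems by (simp add: o_def)
  then have "(f has_sum g s) ((\<lambda>k. (k, s)) ` A)"
    by (subst has_sum_reindex) (auto simp: inj_on_def)
  moreover have "(f has_sum (\<Sum>s\<in>S. g s)) (A \<times> S)" using insert by auto
  ultimately have "(f has_sum (g s + (\<Sum>s\<in>S. g s))) ((\<lambda>k. (k, s)) ` A \<union> A \<times> S)"
    using insert.hyps by (intro has_sum_Un_disjoint) auto
  moreover have "(\<lambda>k. (k, s)) ` A \<union> A \<times> S = A \<times> insert s S" by auto
  ultimately show ?case using insert.hyps by simp
qed

lemma has_sum_sum_finite:
  fixes f :: "'b \<Rightarrow> 'a \<Rightarrow> 'c :: {topological_comm_monoid_add}"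
  assumes "\<And>j. j \<in> J \<Longrightarrow> (f j has_sum g j) A"
  shows "((\<lambda>i. \<Sum>j\<in>J. f j i) has_sum (\<Sum>j\<in>J. g j)) A"
  using assms by (induction J rule: infinite_finite_induct) (auto intro: has_sum_add)

lemma inner_has_sum:
  assumes "L2 N \<Phi>" "L2 N \<Psi>"
  shows "((\<lambda>i. cnj (coef N \<Phi> i) * coef N \<Psi> i) has_sum inner_wf N \<Phi> \<Psi>) (idx N)"
  unfolding idx_def inner_wf_def
  by (rule has_sum_Times_finite) (use assms in \<open>auto simp: coef_fc intro!: cube.Parseval_inner L2D\<close>)

lemma normsq_has_sum:
  assumes "L2 N \<Psi>"
  shows "((\<lambda>i. (cmod (coef N \<Psi> i))\<^sup>2) has_sum normsq N \<Psi>) (idx N)"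
  unfolding idx_def normsq_def
  by (rule has_sum_Times_finite) (use assms in \<open>auto simp: coef_fc intro!: cube.Parseval L2D\<close>)

lemma L2_synthesis:
  assumes "(\<lambda>i. (cmod (c i))\<^sup>2) summable_on idx N"
  shows "\<exists>\<Psi>. L2 N \<Psi> \<and> (\<forall>i\<in>idx N. coef N \<Psi> i = c i)"
proof -
  have "\<exists>f. sqi (cube N) f \<and> (\<forall>k\<in>modes N. cube.fc N f k = c (k, s))" if s: "s \<in> spins N" for s
  proof -
    have "(\<lambda>i. (cmod (c i))\<^sup>2) summable_on (\<lambda>k. (k, s)) ` modes N"
      by (rule summable_on_subset_banach[OF assms]) (use s in \<open>auto simp: idx_def\<close>)
    then have "(\<lambda>k. (cmod (c (k, s)))\<^sup>2) summable_on modes N"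
      by (subst (asm) summable_on_reindex) (auto simp: inj_on_def o_def)
    from cube.Riesz_Fischer[OF this] show ?thesis by blast
  qed
  then obtain f where f: "\<And>s. s \<in> spins N \<Longrightarrow> sqi (cube N) (f s) \<and> (\<forall>k\<in>modes N. cube.fc N (f s) k = c (k, s))"
    by metis
  have "L2 N (\<lambda>x s. f s x)" unfolding L2_iff_sqi using f by simp
  moreover have "\<forall>i\<in>idx N. coef N (\<lambda>x s. f s x) i = c i"
    using f by (auto simp: idx_def coef_fc)
  ultimately show ?thesis by blast
qed

lemma AE_eq_of_coef_eq:
  assumes "L2 N \<Phi>" "L2 N \<Psi>" "\<And>i. i \<in> idx N \<Longrightarrow> coef N \<Phi> i = coef N \<Psi> i" "s \<in> spins N"
  shows "AE x in cube N. \<Phi> x s = \<Psi> x s"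
proof -
  have sq: "sqi (cube N) (\<lambda>x. \<Phi> x s)" "sqi (cube N) (\<lambda>x. \<Psi> x s)" using assms by (auto intro: L2D)
  have "AE x in cube N. \<Phi> x s - \<Psi> x s = 0"
  proof (rule cube.complete)
    show "integrable (cube N) (\<lambda>x. \<Phi> x s - \<Psi> x s)" by (intro cube.sqi_integrable sqi_diff sq)
    show "(\<integral>x. (\<Phi> x s - \<Psi> x s) * cnj (emode N k x) \<partial>cube N) = 0" if k: "k \<in> modes N" for k
      using cube.fc_diff[OF sq k] assms(3)[of "(k, s)"] assms(4) k
      by (simp add: cube.fc_def[symmetric] coef_fc idx_def)
  qed
  then show ?thesis by simp
qed

text \<open>A mode depends only on the restriction of its frequency to the particle indices, so
  testing the members of \<open>idx N\<close> is as strong as testing all integer-valued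
  functions.\<close>

lemma is_pderiv_iff:
  assumes "j < N"
  shows "is_pderiv N j \<Psi> G \<longleftrightarrow> L2 N \<Psi> \<and> L2 N G \<and>
    (\<forall>i\<in>idx N. coef N G i = 2 * pi * \<i> * of_int (fst i j) * coef N \<Psi> i)"
    (is "?L \<longleftrightarrow> ?R")
proof
  assume ?L
  then show ?R by (auto simp: is_pderiv_def idx_def coef_def)
next
  assume R: ?R
  have "(\<integral>x. G x s * cnj (emode N k x) \<partial>cube N)
      = 2 * pi * \<i> * of_int (k j) * (\<integral>x. \<Psi> x s * cnj (emode N k x) \<partial>cube N)" if "s \<in> spins N" for s k
  proof -
    have "(restrict k {..<N}, s) \<in> idx N" using that restrict_in_modes by (auto simp: idx_def)
    then show ?thesis using R assms by (fastforce simp: coef_def emode_restrict)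
  qed
  then show ?L using R by (simp add: is_pderiv_def)
qed

lemma H1_L2: "H1 N \<Psi> \<Longrightarrow> L2 N \<Psi>"
  by (simp add: H1_def)

lemma is_pderiv_pderiv_wf: "H1 N \<Psi> \<Longrightarrow> j < N \<Longrightarrow> is_pderiv N j \<Psi> (pderiv_wf N j \<Psi>)"
proof -
  assume "H1 N \<Psi>" "j < N"
  then have "\<exists>G. is_pderiv N j \<Psi> G" unfolding H1_def by blast
  then show ?thesis unfolding pderiv_wf_def by (rule someI_ex)
qed

lemma pderiv_has_sum:
  assumes "is_pderiv N j \<Psi> G" "j < N"
  shows "((\<lambda>i. (2 * pi * of_int (fst i j))\<^sup>2 * (cmod (coef N \<Psi> i))\<^sup>2) has_sum normsq N G) (idx N)"
proof -
  have G: "L2 N G" "\<And>i. i \<in> idx N \<Longrightarrow> coef N G i = 2 * pi * \<i> * of_int (fst i j) * coef N \<Psi> i"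
    using assms by (auto simp: is_pderiv_iff)
  show ?thesis
    by (rule has_sum_cong[THEN iffD1, OF _ normsq_has_sum[OF G(1)]])
      (simp add: G(2) norm_mult power_mult_distrib)
qed

lemma kin_has_sum:
  assumes "H1 N \<Psi>"
  shows "((\<lambda>i. kap N i * (cmod (coef N \<Psi> i))\<^sup>2) has_sum kin N \<Psi>) (idx N)"
proof -
  have "((\<lambda>i. \<Sum>j\<in>{..<N}. (2 * pi * of_int (fst i j))\<^sup>2 * (cmod (coef N \<Psi> i))\<^sup>2) has_sum (\<Sum>j\<in>{..<N}. normsq N (pderiv_wf N j \<Psi>))) (idx N)"
    by (rule has_sum_sum_finite) (use assms in \<open>auto intro!: pderiv_has_sum is_pderiv_pderiv_wf\<close>)
  then have "((\<lambda>i. 1/2 * (\<Sum>j\<in>{..<N}. (2 * pi * of_int (fst i j))\<^sup>2 * (cmod (coef N \<Psi> i))\<^sup>2)) has_sum kin N \<Psi>) (idx N)"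
    unfolding kin_def by (rule has_sum_cmult_right)
  also have "(\<lambda>i. 1/2 * (\<Sum>j\<in>{..<N}. (2 * pi * of_int (fst i j))\<^sup>2 * (cmod (coef N \<Psi> i))\<^sup>2)) = (\<lambda>i. kap N i * (cmod (coef N \<Psi> i))\<^sup>2)"
    by (auto simp: kap_def power_mult_distrib sum_distrib_left sum_distrib_right algebra_simps)
  finally show ?thesis .
qed

text \<open>Each squared frequency is at most the sum of all, so finite kinetic energy makes the
  candidate coefficients of every partial derivative square summable; Riesz-Fischer then provides
  the derivative.\<close>

lemma H1I:
  assumes "L2 N \<Psi>" "(\<lambda>i. kap N i * (cmod (coef N \<Psi> i))\<^sup>2) summable_on idx N"
  shows "H1 N \<Psi>"
proof -
  have "\<exists>G. is_pderiv N j \<Psi> G" if j: "j < N" for j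
  proof -
    let ?c = "\<lambda>i. 2 * pi * \<i> * of_int (fst i j) * coef N \<Psi> i"
    have "(\<lambda>i. (cmod (?c i))\<^sup>2) summable_on idx N"
    proof (rule summable_on_comparison_test)
      show "(\<lambda>i. 2 * (kap N i * (cmod (coef N \<Psi> i))\<^sup>2)) summable_on idx N"
        by (rule summable_on_cmult_right[OF assms(2)])
      fix i :: "(nat \<Rightarrow> int) \<times> (nat \<Rightarrow> bool)"
      have "(of_int (fst i j) :: real)\<^sup>2 \<le> (\<Sum>j<N. (of_int (fst i j))\<^sup>2)"
        using j by (intro member_le_sum) auto
      then have "4 * pi\<^sup>2 * (of_int (fst i j))\<^sup>2 \<le> 2 * kap N i"
        by (simp add: kap_def)
      then have "4 * pi\<^sup>2 * (of_int (fst i j))\<^sup>2 * (cmod (coef N \<Psi> i))\<^sup>2 \<le> 2 * kap N i * (cmod (coef N \<Psi> i))\<^sup>2"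
        by (intro mult_right_mono) auto
      then show "(cmod (?c i))\<^sup>2 \<le> 2 * (kap N i * (cmod (coef N \<Psi> i))\<^sup>2)"
        by (simp add: norm_mult power_mult_distrib)
    qed simp
    from L2_synthesis[OF this] obtain G where "L2 N G" "\<forall>i\<in>idx N. coef N G i = ?c i"
      by blast
    then show ?thesis using assms(1) j by (auto simp: is_pderiv_iff)
  qed
  then show ?thesis using assms(1) by (simp add: H1_def)
qed

section \<open>Permutations of particles and antisymmetry\<close>

context
  fixes N :: nat and p :: "nat \<Rightarrow> nat"
  assumes p: "p permutes {..<N}"
begin

lemma measurable_permute: "(\<lambda>x. x \<circ> p) \<in> cube N \<rightarrow>\<^sub>M cube N"
  and distr_permute: "distr (cube N) (cube N) (\<lambda>x. x \<circ> p) = cube N"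
proof -
  have pin: "p n \<in> {..<N} \<longleftrightarrow> n \<in> {..<N}" for n using permutes_in_image[OF p] .
  have eq: "x \<circ> p = (\<lambda>n\<in>{..<N}. x (p n))" if "x \<in> space (cube N)" for x
    using that pin by (auto simp: fun_eq_iff cube_def space_PiM PiE_iff extensional_def restrict_def)
  have d: "distr (cube N) (cube N) (\<lambda>x. \<lambda>n\<in>{..<N}. x (p n)) = cube N"
    unfolding cube_def using permutes_inj_on[OF p] pin
    by (intro distr_PiM_reindex[of "{..<N}" "\<lambda>_. U" p "{..<N}"]) (auto simp: prob_space_U)
  have m: "(\<lambda>x. \<lambda>n\<in>{..<N}. x (p n)) \<in> cube N \<rightarrow>\<^sub>M cube N"
    unfolding cube_def
    by (rule measurable_restrict) (use pin in \<open>auto intro: measurable_component_singleton\<close>)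
  show "(\<lambda>x. x \<circ> p) \<in> cube N \<rightarrow>\<^sub>M cube N"
    using m eq by (subst measurable_cong[of _ _ "\<lambda>x. \<lambda>n\<in>{..<N}. x (p n)"]) auto
  show "distr (cube N) (cube N) (\<lambda>x. x \<circ> p) = cube N"
    using d eq by (subst distr_cong[of _ _ _ _ _ "\<lambda>x. \<lambda>n\<in>{..<N}. x (p n)"]) auto
qed

lemma spins_permute: "s \<in> spins N \<Longrightarrow> s \<circ> p \<in> spins N"
  using permutes_in_image[OF p] permutes_not_in[OF p]
  by (auto simp: spins_def PiE_iff extensional_def)

lemma modes_permute: "k \<in> modes N \<Longrightarrow> k \<circ> p \<in> modes N"
  using permutes_in_image[OF p] permutes_not_in[OF p]
  by (auto simp: modes_def PiE_iff extensional_def)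

lemma emode_permute: "emode N (k \<circ> p) (x \<circ> p) = emode N k x"
proof -
  have "(\<Sum>j<N. of_int (k (p j)) * x (p j)) = (\<Sum>j<N. of_int (k j) * x j)"
    using sum.permute[OF p, of "\<lambda>j. of_int (k j) * x j"] by (simp add: o_def)
  then show ?thesis by (simp add: emode_def)
qed

lemma sqi_permute: "sqi (cube N) f \<Longrightarrow> sqi (cube N) (\<lambda>x. f (x \<circ> p))"
  unfolding sqi_def
  using measurable_compose[OF measurable_permute, of f borel]
    integrable_distr[OF measurable_permute, of "\<lambda>x. (cmod (f x))\<^sup>2"]
  by (simp add: distr_permute)

lemma L2_permute: "L2 N \<Psi> \<Longrightarrow> L2 N (\<lambda>x s. \<Psi> (x \<circ> p) (s \<circ> p))"
  unfolding L2_iff_sqi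
proof
  fix s assume "\<forall>s\<in>spins N. sqi (cube N) (\<lambda>x. \<Psi> x s)" "s \<in> spins N"
  then have "sqi (cube N) (\<lambda>x. \<Psi> x (s \<circ> p))" using spins_permute by blast
  then show "sqi (cube N) (\<lambda>x. \<Psi> (x \<circ> p) (s \<circ> p))" by (rule sqi_permute)
qed

lemma coef_permute:
  assumes "L2 N \<Psi>" "k \<in> modes N" "s \<in> spins N"
  shows "coef N (\<lambda>x s. \<Psi> (x \<circ> p) (s \<circ> p)) (k, s) = coef N \<Psi> (k \<circ> p, s \<circ> p)"
proof -
  let ?f = "\<lambda>y. \<Psi> y (s \<circ> p) * cnj (emode N (k \<circ> p) y)"
  have m: "?f \<in> borel_measurable (cube N)"
    using cube.fc_integrable[OF L2D[OF assms(1) spins_permute[OF assms(3)]] modes_permute[OF assms(2)]] by auto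
  have "coef N \<Psi> (k \<circ> p, s \<circ> p) = (\<integral>x. ?f x \<partial>distr (cube N) (cube N) (\<lambda>x. x \<circ> p))"
    unfolding coef_def distr_permute by simp
  also have "\<dots> = (\<integral>x. ?f (x \<circ> p) \<partial>cube N)"
    by (rule integral_distr[OF measurable_permute m])
  also have "\<dots> = coef N (\<lambda>x s. \<Psi> (x \<circ> p) (s \<circ> p)) (k, s)"
    by (simp add: coef_def emode_permute)
  finally show ?thesis by simp
qed

end

text \<open>Each condition on the right involves two coefficients only, so antisymmetry is preserved
  when the coefficients converge one by one.\<close>

lemma antisym_iff_coef:
  assumes L: "L2 N \<Psi>"
  shows "antisym_wf N \<Psi> \<longleftrightarrow> (\<forall>p. p permutes {..<N} \<longrightarrow>
    (\<forall>(k, s)\<in>idx N. coef N \<Psi> (k \<circ> p, s \<circ> p) = of_int (sign p) * coef N \<Psi> (k, s)))"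
    (is "?L \<longleftrightarrow> ?R")
proof
  assume A: ?L
  show ?R
  proof (intro allI impI ballI, clarify)
    fix p k s assume p: "p permutes {..<N}" and i: "(k, s) \<in> idx N"
    then have ks: "k \<in> modes N" "s \<in> spins N" by (auto simp: idx_def)
    have L': "L2 N (\<lambda>x s. \<Psi> (x \<circ> p) (s \<circ> p))" by (rule L2_permute[OF p L])
    have "coef N \<Psi> (k \<circ> p, s \<circ> p) = (\<integral>x. \<Psi> (x \<circ> p) (s \<circ> p) * cnj (emode N k x) \<partial>cube N)"
      using coef_permute[OF p L ks] by (simp add: coef_def)
    also have "\<dots> = (\<integral>x. of_int (sign p) * (\<Psi> x s * cnj (emode N k x)) \<partial>cube N)"
    proof (rule integral_cong_AE)
      show "(\<lambda>x. \<Psi> (x \<circ> p) (s \<circ> p) * cnj (emode N k x)) \<in> borel_measurable (cube N)"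
        using cube.fc_integrable[OF L2D[OF L' ks(2)] ks(1)] by auto
      show "(\<lambda>x. of_int (sign p) * (\<Psi> x s * cnj (emode N k x))) \<in> borel_measurable (cube N)"
        using cube.fc_integrable[OF L2D[OF L ks(2)] ks(1)] by auto
      have "AE x in cube N. \<Psi> (x \<circ> p) (s \<circ> p) = of_int (sign p) * \<Psi> x s"
        using A p ks(2) unfolding antisym_wf_def by blast
      then show "AE x in cube N. \<Psi> (x \<circ> p) (s \<circ> p) * cnj (emode N k x) = of_int (sign p) * (\<Psi> x s * cnj (emode N k x))"
        by eventually_elim simp
    qed
    finally show "coef N \<Psi> (k \<circ> p, s \<circ> p) = of_int (sign p) * coef N \<Psi> (k, s)"
      by (simp add: coef_def)
  qed
next
  assume R: ?R
  show ?L
    unfolding antisym_wf_def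
  proof (intro allI impI ballI)
    fix p s assume p: "p permutes {..<N}" and s: "s \<in> spins N"
    have "AE x in cube N. (\<lambda>x s. \<Psi> (x \<circ> p) (s \<circ> p)) x s = lc (of_int (sign p)) \<Psi> 0 \<Psi> x s"
    proof (rule AE_eq_of_coef_eq[OF L2_permute[OF p L] L2_lc[OF L L] _ s])
      fix i assume i: "i \<in> idx N"
      then obtain k s' where ks: "i = (k, s')" "k \<in> modes N" "s' \<in> spins N" by (auto simp: idx_def)
      show "coef N (\<lambda>x s. \<Psi> (x \<circ> p) (s \<circ> p)) i = coef N (lc (of_int (sign p)) \<Psi> 0 \<Psi>) i"
        using R p i unfolding coef_lc[OF L L i] unfolding ks(1) coef_permute[OF p L ks(2,3)] by auto
    qed
    then show "AE x in cube N. \<Psi> (x \<circ> p) (s \<circ> p) = of_int (sign p) * \<Psi> x s"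
      by (simp add: lc_def)
  qed
qed

lemma H1_lc:
  assumes H: "H1 N \<Phi>" "H1 N \<Psi>"
  shows "H1 N (lc a \<Phi> b \<Psi>)"
  unfolding H1_def
proof (intro conjI allI impI L2_lc H1_L2 H)
  fix j assume j: "j < N"
  obtain G G' where G: "is_pderiv N j \<Phi> G" "is_pderiv N j \<Psi> G'" using H j unfolding H1_def by blast
  have "is_pderiv N j (lc a \<Phi> b \<Psi>) (lc a G b G')"
    using G by (auto simp: is_pderiv_iff[OF j] L2_lc coef_lc algebra_simps)
  then show "\<exists>G. is_pderiv N j (lc a \<Phi> b \<Psi>) G" by blast
qed

lemma Vspace_lc:
  assumes "\<Phi> \<in> Vspace N" "\<Psi> \<in> Vspace N"
  shows "lc a \<Phi> b \<Psi> \<in> Vspace N"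
proof -
  have L: "L2 N \<Phi>" "L2 N \<Psi>" and H: "H1 N \<Phi>" "H1 N \<Psi>" using assms by (auto simp: Vspace_def H1_def)
  have "H1 N (lc a \<Phi> b \<Psi>)" by (rule H1_lc[OF H])
  moreover have "antisym_wf N (lc a \<Phi> b \<Psi>)"
    unfolding antisym_iff_coef[OF L2_lc[OF L]]
  proof (intro allI impI ballI, clarify)
    fix p k s assume p: "p permutes {..<N}" and i: "(k, s) \<in> idx N"
    then have i': "(k \<circ> p, s \<circ> p) \<in> idx N" by (auto simp: idx_def modes_permute spins_permute)
    have "coef N \<Phi> (k \<circ> p, s \<circ> p) = of_int (sign p) * coef N \<Phi> (k, s)"
      "coef N \<Psi> (k \<circ> p, s \<circ> p) = of_int (sign p) * coef N \<Psi> (k, s)"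
      using assms p i L by (auto simp: Vspace_def antisym_iff_coef)
    then show "coef N (lc a \<Phi> b \<Psi>) (k \<circ> p, s \<circ> p) = of_int (sign p) * coef N (lc a \<Phi> b \<Psi>) (k, s)"
      by (simp add: coef_lc[OF L i] coef_lc[OF L i'] algebra_simps)
  qed
  ultimately show ?thesis by (simp add: Vspace_def)
qed

lemma Vspace_L2: "\<Psi> \<in> Vspace N \<Longrightarrow> L2 N \<Psi>"
  by (simp add: Vspace_def H1_def)

lemma Vspace_H1: "\<Psi> \<in> Vspace N \<Longrightarrow> H1 N \<Psi>"
  by (simp add: Vspace_def)

section \<open>Quadratic forms on the form domain\<close>

text \<open>\<open>B\<close> is the polar form; its existence is all that is recorded. Norm, kinetic
  energy, interaction and tested densities all have this shape, so rotation, parallelogram and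
  triangle arguments are carried out once for all of them.\<close>

definition quadf :: "nat \<Rightarrow> (wavefn \<Rightarrow> real) \<Rightarrow> bool" where
  "quadf N Q \<longleftrightarrow> (\<exists>B. \<forall>\<Phi>\<in>Vspace N. \<forall>\<Psi>\<in>Vspace N. \<forall>a b.
     Q (lc a \<Phi> b \<Psi>) = (cmod a)\<^sup>2 * Q \<Phi> + (cmod b)\<^sup>2 * Q \<Psi> + 2 * Re (cnj a * b * B \<Phi> \<Psi>))"

text \<open>The expectation of multiplication by \<open>h\<close>. When \<open>h\<close> is a
  function of coordinate 0 times the particle number, it is the integral of that function against
  the density.\<close>

definition wnormsq :: "nat \<Rightarrow> ((nat \<Rightarrow> real) \<Rightarrow> real) \<Rightarrow> wavefn \<Rightarrow> real" where
  "wnormsq N h \<Psi> = (\<Sum>s\<in>spins N. \<integral>x. h x * (cmod (\<Psi> x s))\<^sup>2 \<partial>cube N)"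

definition winner :: "nat \<Rightarrow> ((nat \<Rightarrow> real) \<Rightarrow> real) \<Rightarrow> wavefn \<Rightarrow> wavefn \<Rightarrow> complex" where
  "winner N h \<Phi> \<Psi> = (\<Sum>s\<in>spins N. \<integral>x. of_real (h x) * (cnj (\<Phi> x s) * \<Psi> x s) \<partial>cube N)"

lemma wnormsq_1: "wnormsq N (\<lambda>_. 1) \<Psi> = normsq N \<Psi>"
  by (simp add: wnormsq_def normsq_def)

lemma winner_1: "winner N (\<lambda>_. 1) \<Phi> \<Psi> = inner_wf N \<Phi> \<Psi>"
  by (simp add: winner_def inner_wf_def)

lemma integrable_bounded_mult_real:
  fixes f g :: "'a \<Rightarrow> real"
  assumes "integrable M f" "g \<in> borel_measurable M" "\<And>x. x \<in> space M \<Longrightarrow> \<bar>g x\<bar> \<le> B"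
  shows "integrable M (\<lambda>x. g x * f x)"
proof (rule Bochner_Integration.integrable_bound)
  show "integrable M (\<lambda>x. B * \<bar>f x\<bar>)" using assms by auto
  show "(\<lambda>x. g x * f x) \<in> borel_measurable M"
    using borel_measurable_integrable[OF assms(1)] assms(2) by (intro borel_measurable_times)
  show "AE x in M. norm (g x * f x) \<le> norm (B * \<bar>f x\<bar>)"
  proof (rule AE_I2)
    fix x assume "x \<in> space M"
    then have "\<bar>g x\<bar> \<le> \<bar>B\<bar>" using assms(3) by (meson abs_ge_self order_trans)
    then show "norm (g x * f x) \<le> norm (B * \<bar>f x\<bar>)"
      by (simp add: abs_mult mult_right_mono)
  qed
qed

lemma wnormsq_lc:
  assumes L: "L2 N \<Phi>" "L2 N \<Psi>"
    and h: "h \<in> borel_measurable (cube N)" "\<And>x. x \<in> space (cube N) \<Longrightarrow> \<bar>h x\<bar> \<le> C"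
  shows "wnormsq N h (lc a \<Phi> b \<Psi>) = (cmod a)\<^sup>2 * wnormsq N h \<Phi> + (cmod b)\<^sup>2 * wnormsq N h \<Psi>
    + 2 * Re (cnj a * b * winner N h \<Phi> \<Psi>)"
proof -
  have "(\<integral>x. h x * (cmod (lc a \<Phi> b \<Psi> x s))\<^sup>2 \<partial>cube N)
    = (cmod a)\<^sup>2 * (\<integral>x. h x * (cmod (\<Phi> x s))\<^sup>2 \<partial>cube N) + (cmod b)\<^sup>2 * (\<integral>x. h x * (cmod (\<Psi> x s))\<^sup>2 \<partial>cube N)
      + 2 * Re (cnj a * b * (\<integral>x. of_real (h x) * (cnj (\<Phi> x s) * \<Psi> x s) \<partial>cube N))" if s: "s \<in> spins N" for s
  proof -
    have sq: "sqi (cube N) (\<lambda>x. \<Phi> x s)" "sqi (cube N) (\<lambda>x. \<Psi> x s)" using L s by (auto intro: L2D)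
    have i1: "integrable (cube N) (\<lambda>x. h x * (cmod (\<Phi> x s))\<^sup>2)"
      "integrable (cube N) (\<lambda>x. h x * (cmod (\<Psi> x s))\<^sup>2)"
      using integrable_bounded_mult_real[OF _ h] sq[THEN sqi_integrable_sq] by auto
    have "integrable (cube N) (\<lambda>x. cnj (\<Phi> x s) * \<Psi> x s)"
      by (intro sqi_mult_integrable sqi_cnj sq)
    then have "integrable (cube N) (\<lambda>x. (cnj (\<Phi> x s) * \<Psi> x s) * of_real (h x))"
      by (rule integrable_bounded_mult[of _ _ _ C]) (use h in auto)
    then have i2: "integrable (cube N) (\<lambda>x. of_real (h x) * (cnj (\<Phi> x s) * \<Psi> x s))"
      by (simp add: mult.commute)
    have i3: "integrable (cube N) (\<lambda>x. 2 * Re (cnj a * b * (of_real (h x) * (cnj (\<Phi> x s) * \<Psi> x s))))"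
      using i2 by (intro integrable_mult_right integrable_Re)
    have "h x * (cmod (lc a \<Phi> b \<Psi> x s))\<^sup>2
      = (cmod a)\<^sup>2 * (h x * (cmod (\<Phi> x s))\<^sup>2) + (cmod b)\<^sup>2 * (h x * (cmod (\<Psi> x s))\<^sup>2)
        + 2 * Re (cnj a * b * (of_real (h x) * (cnj (\<Phi> x s) * \<Psi> x s)))" for x
      unfolding lc_def by (simp only: cmod_power2) (simp add: power2_eq_square algebra_simps)
    then have "(\<integral>x. h x * (cmod (lc a \<Phi> b \<Psi> x s))\<^sup>2 \<partial>cube N)
      = (\<integral>x. (cmod a)\<^sup>2 * (h x * (cmod (\<Phi> x s))\<^sup>2) + (cmod b)\<^sup>2 * (h x * (cmod (\<Psi> x s))\<^sup>2)
        + 2 * Re (cnj a * b * (of_real (h x) * (cnj (\<Phi> x s) * \<Psi> x s))) \<partial>cube N)" by presburger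
    also have "\<dots> = (cmod a)\<^sup>2 * (\<integral>x. h x * (cmod (\<Phi> x s))\<^sup>2 \<partial>cube N) + (cmod b)\<^sup>2 * (\<integral>x. h x * (cmod (\<Psi> x s))\<^sup>2 \<partial>cube N)
      + 2 * Re (cnj a * b * (\<integral>x. of_real (h x) * (cnj (\<Phi> x s) * \<Psi> x s) \<partial>cube N))"
      by (simp only: Bochner_Integration.integral_add Bochner_Integration.integrable_add i1 i3 integrable_mult_right
          integral_mult_right_zero integral_Re i2)
    finally show ?thesis .
  qed
  then show ?thesis
    unfolding wnormsq_def winner_def
    by (simp add: sum.distrib sum_distrib_left Re_sum)
qed

lemma normsq_lc:
  assumes L: "L2 N \<Phi>" "L2 N \<Psi>"
  shows "normsq N (lc a \<Phi> b \<Psi>) = (cmod a)\<^sup>2 * normsq N \<Phi> + (cmod b)\<^sup>2 * normsq N \<Psi>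
    + 2 * Re (cnj a * b * inner_wf N \<Phi> \<Psi>)"
  using wnormsq_lc[OF L, of "\<lambda>_. 1" 1 a b] by (simp add: wnormsq_1 winner_1)

lemma quadf_wnormsq:
  assumes "h \<in> borel_measurable (cube N)" "\<And>x. x \<in> space (cube N) \<Longrightarrow> \<bar>h x\<bar> \<le> C"
  shows "quadf N (wnormsq N h)"
  unfolding quadf_def
  by (intro exI[of _ "winner N h"] ballI allI wnormsq_lc[OF _ _ assms] Vspace_L2)

lemma quadf_normsq: "quadf N (normsq N)"
  unfolding quadf_def
  by (intro exI[of _ "inner_wf N"] ballI allI normsq_lc Vspace_L2)

lemma quadf_add:
  assumes "quadf N Q" "quadf N R"
  shows "quadf N (\<lambda>\<Psi>. Q \<Psi> + R \<Psi>)"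
proof -
  obtain B C where B: "\<And>\<Phi> \<Psi> a b. \<Phi> \<in> Vspace N \<Longrightarrow> \<Psi> \<in> Vspace N \<Longrightarrow>
      Q (lc a \<Phi> b \<Psi>) = (cmod a)\<^sup>2 * Q \<Phi> + (cmod b)\<^sup>2 * Q \<Psi> + 2 * Re (cnj a * b * B \<Phi> \<Psi>)"
    and C: "\<And>\<Phi> \<Psi> a b. \<Phi> \<in> Vspace N \<Longrightarrow> \<Psi> \<in> Vspace N \<Longrightarrow>
      R (lc a \<Phi> b \<Psi>) = (cmod a)\<^sup>2 * R \<Phi> + (cmod b)\<^sup>2 * R \<Psi> + 2 * Re (cnj a * b * C \<Phi> \<Psi>)"
    using assms unfolding quadf_def by metis
  show ?thesis unfolding quadf_def
    by (intro exI[of _ "\<lambda>\<Phi> \<Psi>. B \<Phi> \<Psi> + C \<Phi> \<Psi>"]) (simp add: B C algebra_simps)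
qed

lemma quadf_scale:
  assumes "quadf N Q" "\<Phi> \<in> Vspace N"
  shows "Q (lc a \<Phi> 0 \<Phi>) = (cmod a)\<^sup>2 * Q \<Phi>"
  using assms unfolding quadf_def by fastforce

text \<open>The two cross terms are opposite. A unitary rotation of two vectors thus leaves
  unchanged every quantity that a mixture assigns by summing a quadratic form, that is, it leaves
  the density matrix unchanged.\<close>

lemma quadf_rotation:
  assumes "quadf N Q" "\<Phi> \<in> Vspace N" "\<Psi> \<in> Vspace N" "cmod u = 1" "c\<^sup>2 + s\<^sup>2 = 1"
  shows "Q (lc (of_real c) \<Phi> (of_real s * u) \<Psi>) + Q (lc (of_real (- s)) \<Phi> (of_real c * u) \<Psi>) = Q \<Phi> + Q \<Psi>"
proof -
  obtain B where B: "\<And>a b. Q (lc a \<Phi> b \<Psi>) = (cmod a)\<^sup>2 * Q \<Phi> + (cmod b)\<^sup>2 * Q \<Psi> + 2 * Re (cnj a * b * B \<Phi> \<Psi>)"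
    using assms unfolding quadf_def by metis
  have "Q (lc (of_real c) \<Phi> (of_real s * u) \<Psi>) + Q (lc (of_real (- s)) \<Phi> (of_real c * u) \<Psi>)
    = (c\<^sup>2 + s\<^sup>2) * (Q \<Phi> + Q \<Psi>)"
    unfolding B using assms(4) by (simp add: norm_mult power_mult_distrib algebra_simps)
  then show ?thesis using assms(5) by simp
qed

lemma quadf_parallelogram:
  assumes "quadf N Q" "\<Phi> \<in> Vspace N" "\<Psi> \<in> Vspace N"
  shows "Q (lc (1/2) \<Phi> (1/2) \<Psi>) + Q (lc (1/2) \<Phi> (-1/2) \<Psi>) = Q \<Phi> / 2 + Q \<Psi> / 2"
proof -
  obtain B where B: "\<And>a b. Q (lc a \<Phi> b \<Psi>) = (cmod a)\<^sup>2 * Q \<Phi> + (cmod b)\<^sup>2 * Q \<Psi> + 2 * Re (cnj a * b * B \<Phi> \<Psi>)"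
    using assms unfolding quadf_def by metis
  show ?thesis unfolding B by (simp add: power2_eq_square norm_divide)
qed

text \<open>Positivity of \<open>Q\<close> at the combination with coefficients sqrt \<delta> and -t
  / sqrt \<delta> bounds the cross term. With \<delta> free, a small perturbation costs a factor 1 +
  \<delta> only.\<close>

lemma quadf_triangle:
  assumes "quadf N Q" "\<Phi> \<in> Vspace N" "\<Psi> \<in> Vspace N" "0 < \<delta>"
    and nn: "\<And>\<Psi>. \<Psi> \<in> Vspace N \<Longrightarrow> 0 \<le> Q \<Psi>"
  shows "Q (lc 1 \<Phi> (of_real t) \<Psi>) \<le> (1 + \<delta>) * Q \<Phi> + (1 + 1 / \<delta>) * t\<^sup>2 * Q \<Psi>"
proof -
  obtain B where B: "\<And>a b. Q (lc a \<Phi> b \<Psi>) = (cmod a)\<^sup>2 * Q \<Phi> + (cmod b)\<^sup>2 * Q \<Psi> + 2 * Re (cnj a * b * B \<Phi> \<Psi>)"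
    using assms unfolding quadf_def by metis
  let ?r = "sqrt \<delta>"
  have "0 \<le> Q (lc (of_real ?r) \<Phi> (of_real (- t / ?r)) \<Psi>)"
    using assms by (intro nn Vspace_lc)
  also have "\<dots> = \<delta> * Q \<Phi> + t\<^sup>2 / \<delta> * Q \<Psi> - 2 * t * Re (B \<Phi> \<Psi>)"
    unfolding B using assms(4) by (simp add: norm_divide power_divide)
  finally have "2 * t * Re (B \<Phi> \<Psi>) \<le> \<delta> * Q \<Phi> + t\<^sup>2 / \<delta> * Q \<Psi>" by simp
  then show ?thesis unfolding B by (simp add: algebra_simps)
qed

lemma normsq_nonneg: "0 \<le> normsq N \<Psi>"
  by (simp add: normsq_def sum_nonneg)

lemma kin_nonneg: "0 \<le> kin N \<Psi>"
  by (simp add: kin_def sum_nonneg normsq_nonneg)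

lemma quadf_kin: "quadf N (kin N)"
  unfolding quadf_def
proof (intro exI[of _ "\<lambda>\<Phi> \<Psi>. 1/2 * (\<Sum>j<N. inner_wf N (pderiv_wf N j \<Phi>) (pderiv_wf N j \<Psi>))"] ballI allI)
  fix \<Phi> \<Psi> a b assume V: "\<Phi> \<in> Vspace N" "\<Psi> \<in> Vspace N"
  have "normsq N (pderiv_wf N j (lc a \<Phi> b \<Psi>)) = (cmod a)\<^sup>2 * normsq N (pderiv_wf N j \<Phi>)
    + (cmod b)\<^sup>2 * normsq N (pderiv_wf N j \<Psi>) + 2 * Re (cnj a * b * inner_wf N (pderiv_wf N j \<Phi>) (pderiv_wf N j \<Psi>))"
    if j: "j < N" for j
  proof -
    have d: "is_pderiv N j \<Phi> (pderiv_wf N j \<Phi>)" "is_pderiv N j \<Psi> (pderiv_wf N j \<Psi>)"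
      "is_pderiv N j (lc a \<Phi> b \<Psi>) (pderiv_wf N j (lc a \<Phi> b \<Psi>))"
      using V j by (auto intro!: is_pderiv_pderiv_wf Vspace_H1 Vspace_lc)
    have "is_pderiv N j (lc a \<Phi> b \<Psi>) (lc a (pderiv_wf N j \<Phi>) b (pderiv_wf N j \<Psi>))"
      using d(1,2) by (auto simp: is_pderiv_iff[OF j] L2_lc coef_lc algebra_simps)
    \<comment> \<open>\<open>pderiv_wf\<close> is a choice and hence linear only up to null sets.
      The norms agree because \<open>pderiv_has_sum\<close> computes them from the coefficients of
      the differentiated function.\<close>
    then have "normsq N (pderiv_wf N j (lc a \<Phi> b \<Psi>)) = normsq N (lc a (pderiv_wf N j \<Phi>) b (pderiv_wf N j \<Psi>))"
      using pderiv_has_sum[OF _ j] d(3) has_sum_unique by blast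
    then show ?thesis using d(1,2) by (simp add: normsq_lc is_pderiv_iff[OF j])
  qed
  then have "(\<Sum>j<N. normsq N (pderiv_wf N j (lc a \<Phi> b \<Psi>))) = (\<Sum>j<N. (cmod a)\<^sup>2 * normsq N (pderiv_wf N j \<Phi>)
    + (cmod b)\<^sup>2 * normsq N (pderiv_wf N j \<Psi>) + 2 * Re (cnj a * b * inner_wf N (pderiv_wf N j \<Phi>) (pderiv_wf N j \<Psi>)))"
    by (intro sum.cong) (auto simp only: lessThan_iff)
  also have "\<dots> = (cmod a)\<^sup>2 * (\<Sum>j<N. normsq N (pderiv_wf N j \<Phi>)) + (cmod b)\<^sup>2 * (\<Sum>j<N. normsq N (pderiv_wf N j \<Psi>))
    + 2 * Re (cnj a * b * (\<Sum>j<N. inner_wf N (pderiv_wf N j \<Phi>) (pderiv_wf N j \<Psi>)))"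
    by (simp add: sum.distrib sum_distrib_left Re_sum)
  finally have eq: "(\<Sum>j<N. normsq N (pderiv_wf N j (lc a \<Phi> b \<Psi>))) = \<dots>" .
  have half: "Re (c * (1/2 * X)) = Re (c * X) / 2" for c X :: complex by simp
  show "kin N (lc a \<Phi> b \<Psi>) = (cmod a)\<^sup>2 * kin N \<Phi> + (cmod b)\<^sup>2 * kin N \<Psi>
    + 2 * Re (cnj a * b * (1/2 * (\<Sum>j<N. inner_wf N (pderiv_wf N j \<Phi>) (pderiv_wf N j \<Psi>))))"
    unfolding kin_def eq half by (simp only: distrib_left; simp)
qed

lemma normsq_zero_coef:
  assumes "L2 N \<Psi>" "normsq N \<Psi> = 0" "i \<in> idx N"
  shows "coef N \<Psi> i = 0"
proof -
  have "((\<lambda>i. (cmod (coef N \<Psi> i))\<^sup>2) has_sum 0) (idx N)" using normsq_has_sum[OF assms(1)] assms(2) by simp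
  then have "(\<Sum>i\<in>{i}. (cmod (coef N \<Psi> i))\<^sup>2) \<le> 0"
    by (rule finite_sum_le_has_sum) (use assms(3) in auto)
  then show ?thesis by simp
qed

section \<open>The energy as a quadratic form\<close>

locale hamiltonian =
  fixes N :: nat and W :: "wavefn \<Rightarrow> wavefn \<Rightarrow> complex"
  assumes N1: "1 \<le> N" and pos: "positive_sesq_form N W" and bdd: "kin_bounded_lt1 N W"
begin

abbreviation "V \<equiv> Vspace N"
abbreviation "E \<equiv> energy N W"

lemma W_zero: "\<Psi> \<in> V \<Longrightarrow> Z \<in> V \<Longrightarrow> normsq N \<Psi> = 0 \<Longrightarrow> W \<Psi> Z = 0"
  using pos unfolding positive_sesq_form_def by blast

lemma W_herm: "\<Psi> \<in> V \<Longrightarrow> \<Phi> \<in> V \<Longrightarrow> W \<Psi> \<Phi> = cnj (W \<Phi> \<Psi>)"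
  using pos unfolding positive_sesq_form_def by blast

lemma W_nonneg: "\<Psi> \<in> V \<Longrightarrow> 0 \<le> Re (W \<Psi> \<Psi>)"
  using pos unfolding positive_sesq_form_def by blast

lemma W_add: "\<Phi> \<in> V \<Longrightarrow> \<Psi> \<in> V \<Longrightarrow> Z \<in> V \<Longrightarrow> W (lc 1 \<Phi> c \<Psi>) Z = W \<Phi> Z + cnj c * W \<Psi> Z"
  using pos[unfolded positive_sesq_form_def, THEN conjunct1, rule_format, of \<Phi> \<Psi> Z c] by (simp add: lc_def)

lemma W_lc_left:
  assumes "\<Phi> \<in> V" "\<Psi> \<in> V" "Z \<in> V"
  shows "W (lc a \<Phi> b \<Psi>) Z = cnj a * W \<Phi> Z + cnj b * W \<Psi> Z"
proof -
  \<comment> \<open>Additivity of \<open>W\<close> is given with leading coefficient 1, so a general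
    combination is built up from the zero vector, which \<open>W\<close> annihilates by the
    condition on null vectors.\<close>
  let ?O = "lc 0 \<Phi> 0 \<Phi>"
  have O: "?O \<in> V" using assms by (intro Vspace_lc)
  have "normsq N ?O = 0" by (simp add: normsq_def lc_def)
  then have 0: "W ?O Z = 0" using W_zero O assms by blast
  have "lc a \<Phi> b \<Psi> = lc 1 (lc 1 ?O a \<Phi>) b \<Psi>" by (simp add: lc_def)
  then show ?thesis using assms O by (simp add: W_add Vspace_lc 0)
qed

lemma W_lc_right:
  assumes "\<Phi> \<in> V" "\<Psi> \<in> V" "Z \<in> V"
  shows "W Z (lc a \<Phi> b \<Psi>) = a * W Z \<Phi> + b * W Z \<Psi>"
proof -
  have "W Z (lc a \<Phi> b \<Psi>) = cnj (W (lc a \<Phi> b \<Psi>) Z)" using assms by (intro W_herm Vspace_lc)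
  also have "\<dots> = a * cnj (W \<Phi> Z) + b * cnj (W \<Psi> Z)" using assms by (simp add: W_lc_left)
  also have "\<dots> = a * W Z \<Phi> + b * W Z \<Psi>" using assms by (simp add: W_herm[of Z])
  finally show ?thesis .
qed

lemma quadf_W: "quadf N (\<lambda>\<Psi>. Re (W \<Psi> \<Psi>))"
  unfolding quadf_def
proof (intro exI[of _ W] ballI allI)
  fix \<Phi> \<Psi> a b assume V: "\<Phi> \<in> V" "\<Psi> \<in> V"
  have "W (lc a \<Phi> b \<Psi>) (lc a \<Phi> b \<Psi>) = cnj a * (a * W \<Phi> \<Phi> + b * W \<Phi> \<Psi>) + cnj b * (a * W \<Psi> \<Phi> + b * W \<Psi> \<Psi>)"
    using V by (simp add: W_lc_left W_lc_right Vspace_lc algebra_simps)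
  also have "W \<Psi> \<Phi> = cnj (W \<Phi> \<Psi>)" using V by (intro W_herm)
  finally show "Re (W (lc a \<Phi> b \<Psi>) (lc a \<Phi> b \<Psi>)) = (cmod a)\<^sup>2 * Re (W \<Phi> \<Phi>) + (cmod b)\<^sup>2 * Re (W \<Psi> \<Psi>) + 2 * Re (cnj a * b * W \<Phi> \<Psi>)"
    using W_herm[OF V(1) V(1)] W_herm[OF V(2) V(2)]
    by (simp only: cmod_power2) (simp add: power2_eq_square algebra_simps complex_eq_iff)
qed

lemma quadf_energy: "quadf N E"
  unfolding energy_def[abs_def] by (intro quadf_add quadf_kin quadf_W)

lemma kin_le_energy: "\<Psi> \<in> V \<Longrightarrow> kin N \<Psi> \<le> E \<Psi>"
  using W_nonneg by (simp add: energy_def)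

lemma energy_nonneg: "\<Psi> \<in> V \<Longrightarrow> 0 \<le> E \<Psi>"
  using kin_le_energy kin_nonneg order_trans by blast

lemma normalize_in_Wset:
  assumes "\<Psi> \<in> V" "0 < normsq N \<Psi>"
  shows "lc (of_real (1 / sqrt (normsq N \<Psi>))) \<Psi> 0 \<Psi> \<in> Wset N"
  using assms quadf_scale[OF quadf_normsq assms(1)]
  by (simp add: Wset_def Vspace_lc norm_divide power_divide)

text \<open>Homogeneity extends the kinetic bound from unit vectors to the whole form domain.
  Together with \<open>kin_le_energy\<close> this makes the form norm of the energy equivalent to
  the Sobolev norm, so errors may be estimated in the latter.\<close>

lemma energy_bounded: "\<exists>C>0. \<forall>\<Psi>\<in>V. E \<Psi> \<le> C * (kin N \<Psi> + normsq N \<Psi>)"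
proof -
  obtain a b where ab: "0 \<le> a" "a < 1" "0 \<le> b" "\<And>\<Psi>. \<Psi> \<in> Wset N \<Longrightarrow> cmod (W \<Psi> \<Psi>) \<le> a * kin N \<Psi> + b"
    using bdd unfolding kin_bounded_lt1_def by blast
  have "E \<Psi> \<le> (1 + a + b) * (kin N \<Psi> + normsq N \<Psi>)" if V: "\<Psi> \<in> V" for \<Psi>
  proof -
    have "Re (W \<Psi> \<Psi>) \<le> a * kin N \<Psi> + b * normsq N \<Psi>"
    proof (cases "normsq N \<Psi> = 0")
      case True
      then show ?thesis using W_zero[OF V V] ab by (simp add: kin_nonneg)
    next
      case False
      then have n: "0 < normsq N \<Psi>" using normsq_nonneg[of N \<Psi>] by linarith
      let ?c = "complex_of_real (1 / sqrt (normsq N \<Psi>))"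
      have c: "(cmod ?c)\<^sup>2 = 1 / normsq N \<Psi>" using n by (simp add: norm_divide power_divide)
      have "Re (W (lc ?c \<Psi> 0 \<Psi>) (lc ?c \<Psi> 0 \<Psi>)) \<le> a * kin N (lc ?c \<Psi> 0 \<Psi>) + b"
        using ab(4)[OF normalize_in_Wset[OF V n]] complex_Re_le_cmod order_trans by blast
      then have "Re (W \<Psi> \<Psi>) / normsq N \<Psi> \<le> a * (kin N \<Psi> / normsq N \<Psi>) + b"
        unfolding quadf_scale[OF quadf_W V] quadf_scale[OF quadf_kin V] c by simp
      then show ?thesis using n by (simp add: field_simps)
    qed
    moreover have "0 \<le> b * kin N \<Psi>" "0 \<le> (1 + a) * normsq N \<Psi>"
      using ab kin_nonneg normsq_nonneg by simp_all
    ultimately show ?thesis unfolding energy_def by (simp add: algebra_simps)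
  qed
  then show ?thesis using ab by (intro exI[of _ "1 + a + b"]) auto
qed

end

section \<open>Lower semicontinuity of the energy\<close>

lemma finite_sum_normsq_le:
  assumes "L2 N \<Psi>" "finite F" "F \<subseteq> idx N"
  shows "(\<Sum>i\<in>F. (cmod (coef N \<Psi> i))\<^sup>2) \<le> normsq N \<Psi>"
  by (rule finite_sum_le_has_sum[OF normsq_has_sum[OF assms(1)] assms(2,3)]) simp

lemma finite_sum_kin_le:
  assumes "H1 N \<Psi>" "finite F" "F \<subseteq> idx N"
  shows "(\<Sum>i\<in>F. kap N i * (cmod (coef N \<Psi> i))\<^sup>2) \<le> kin N \<Psi>"
  by (rule finite_sum_le_has_sum[OF kin_has_sum[OF assms(1)] assms(2,3)]) (simp add: kap_nonneg)

lemma antisym_limit: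
  assumes L: "L2 N \<Phi>" and V: "\<And>n. \<xi> n \<in> Vspace N"
    and lim: "\<And>i. i \<in> idx N \<Longrightarrow> (\<lambda>n. coef N (\<xi> n) i) \<longlonglongrightarrow> coef N \<Phi> i"
  shows "antisym_wf N \<Phi>"
  unfolding antisym_iff_coef[OF L]
proof (intro allI impI ballI, clarify)
  fix p k s assume p: "p permutes {..<N}" and i: "(k, s) \<in> idx N"
  then have i': "(k \<circ> p, s \<circ> p) \<in> idx N" by (auto simp: idx_def modes_permute spins_permute)
  have "coef N (\<xi> n) (k \<circ> p, s \<circ> p) = of_int (sign p) * coef N (\<xi> n) (k, s)" for n
    using V[of n] p i by (auto simp: Vspace_def antisym_iff_coef[OF Vspace_L2[OF V]])
  then have "(\<lambda>n. of_int (sign p) * coef N (\<xi> n) (k, s)) \<longlonglongrightarrow> coef N \<Phi> (k \<circ> p, s \<circ> p)"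
    using lim[OF i'] by simp
  moreover have "(\<lambda>n. of_int (sign p) * coef N (\<xi> n) (k, s)) \<longlonglongrightarrow> of_int (sign p) * coef N \<Phi> (k, s)"
    by (intro tendsto_intros lim i)
  ultimately show "coef N \<Phi> (k \<circ> p, s \<circ> p) = of_int (sign p) * coef N \<Phi> (k, s)"
    by (rule LIMSEQ_unique)
qed

text \<open>Fatou's lemma in coordinates: over a finite set of modes the sums converge and stay
  below \<eta>, and the supremum over finite sets is the Sobolev norm of the limit.\<close>

lemma H1_limit:
  assumes L: "L2 N T" and V: "\<And>n. H1 N (D n)"
    and lim: "\<And>i. i \<in> idx N \<Longrightarrow> (\<lambda>n. coef N (D n) i) \<longlonglongrightarrow> coef N T i"
    and bd: "\<forall>\<^sub>F n in sequentially. kin N (D n) + normsq N (D n) \<le> \<eta>"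
  shows "H1 N T" "kin N T + normsq N T \<le> \<eta>"
proof -
  let ?f = "\<lambda>i. (kap N i + 1) * (cmod (coef N T i))\<^sup>2"
  have fin: "sum ?f F \<le> \<eta>" if F: "finite F" "F \<subseteq> idx N" for F
  proof (rule tendsto_upperbound)
    show "(\<lambda>n. \<Sum>i\<in>F. (kap N i + 1) * (cmod (coef N (D n) i))\<^sup>2) \<longlonglongrightarrow> sum ?f F"
      using F by (intro tendsto_intros lim) auto
    show "\<forall>\<^sub>F n in sequentially. (\<Sum>i\<in>F. (kap N i + 1) * (cmod (coef N (D n) i))\<^sup>2) \<le> \<eta>"
      using bd
    proof eventually_elim
      case (elim n)
      have "(\<Sum>i\<in>F. (kap N i + 1) * (cmod (coef N (D n) i))\<^sup>2)
        = (\<Sum>i\<in>F. kap N i * (cmod (coef N (D n) i))\<^sup>2) + (\<Sum>i\<in>F. (cmod (coef N (D n) i))\<^sup>2)"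
        by (simp add: sum.distrib[symmetric] algebra_simps)
      then show ?case using finite_sum_kin_le[OF V F, of n] finite_sum_normsq_le[OF H1_L2[OF V] F, of n] elim by linarith
    qed
  qed simp
  have sm: "?f summable_on idx N"
    by (rule nonneg_bdd_above_summable_on) (use fin kap_nonneg in \<open>auto intro!: bdd_aboveI2[of _ _ \<eta>]\<close>)
  have "(\<lambda>i. kap N i * (cmod (coef N T i))\<^sup>2) summable_on idx N"
    by (rule summable_on_comparison_test[OF sm]) (auto simp: kap_nonneg distrib_right)
  then show H: "H1 N T" using L by (rule H1I[rotated])
  have "((\<lambda>i. kap N i * (cmod (coef N T i))\<^sup>2 + (cmod (coef N T i))\<^sup>2) has_sum (kin N T + normsq N T)) (idx N)"
    by (intro has_sum_add kin_has_sum normsq_has_sum H L)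
  then have "(?f has_sum (kin N T + normsq N T)) (idx N)" by (simp add: algebra_simps)
  then show "kin N T + normsq N T \<le> \<eta>"
    by (rule has_sum_le_finite_sums) (use fin in auto)
qed

context hamiltonian
begin

text \<open>Weak lower semicontinuity by Mazur's argument: near-minimizers of the energy over the convex
  sets of wave functions approximating the tail of the sequence are Cauchy in the form norm.\<close>

theorem energy_lsc:
  assumes L: "L2 N \<Phi>" and V: "\<And>n. \<xi> n \<in> V" and E: "\<And>n. E (\<xi> n) \<le> b" and nrm: "\<And>n. normsq N (\<xi> n) \<le> 1"
    and lim: "\<And>i. i \<in> idx N \<Longrightarrow> (\<lambda>n. coef N (\<xi> n) i) \<longlonglongrightarrow> coef N \<Phi> i"
  shows "\<Phi> \<in> V" "E \<Phi> \<le> b"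
proof -
  define q where "q \<psi> = E \<psi> + normsq N \<psi>" for \<psi>
  have qq: "quadf N q" unfolding q_def[abs_def] by (intro quadf_add quadf_energy quadf_normsq)
  have q0: "0 \<le> q \<psi>" if "\<psi> \<in> V" for \<psi> using that by (simp add: q_def energy_nonneg normsq_nonneg)
  have b0: "0 \<le> b" using E[of 0] energy_nonneg[OF V[of 0]] by linarith
  \<comment> \<open>Instead of convex hulls of tails: every bound on the distance of a coefficient
    from its limit that holds along the tail must also hold for \<psi>. These conditions are stable
    under midpoints and force the coefficients of elements of \<open>K n\<close> to
    converge.\<close>
  define K where "K n = {\<psi> \<in> V. E \<psi> \<le> b \<and> normsq N \<psi> \<le> 1 \<and>
    (\<forall>i\<in>idx N. \<forall>\<epsilon>. (\<forall>m\<ge>n. cmod (coef N (\<xi> m) i - coef N \<Phi> i) \<le> \<epsilon>) \<longrightarrow> cmod (coef N \<psi> i - coef N \<Phi> i) \<le> \<epsilon>)}" for n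
  have KV: "\<psi> \<in> V" if "\<psi> \<in> K n" for \<psi> n using that by (simp add: K_def)
  have Kc: "cmod (coef N \<psi> i - coef N \<Phi> i) \<le> \<epsilon>"
    if "\<psi> \<in> K n" "i \<in> idx N" "\<forall>m\<ge>n. cmod (coef N (\<xi> m) i - coef N \<Phi> i) \<le> \<epsilon>" for \<psi> n i \<epsilon>
    using that unfolding K_def by blast
  have \<xi>K: "\<xi> n \<in> K n" for n using V E nrm by (auto simp: K_def)
  have Kmono: "K m \<subseteq> K n" if "n \<le> m" for m n
    unfolding K_def using that by (auto dest: order_trans)
  have Kmid: "lc (1/2) \<psi> (1/2) \<psi>' \<in> K n" if "\<psi> \<in> K n" "\<psi>' \<in> K n" for \<psi> \<psi>' n
  proof -
    let ?m = "lc (1/2) \<psi> (1/2) \<psi>'" and ?d = "lc (1/2) \<psi> (-1/2) \<psi>'"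
    have v: "\<psi> \<in> V" "\<psi>' \<in> V" and mv: "?m \<in> V" "?d \<in> V" using that KV by (auto intro: Vspace_lc)
    have "E ?m \<le> b" using quadf_parallelogram[OF quadf_energy v] energy_nonneg[OF mv(2)] that by (simp add: K_def)
    moreover have "normsq N ?m \<le> 1" using quadf_parallelogram[OF quadf_normsq v] normsq_nonneg[of N ?d] that by (simp add: K_def)
    moreover have "cmod (coef N ?m i - coef N \<Phi> i) \<le> \<epsilon>"
      if i: "i \<in> idx N" and "\<forall>m\<ge>n. cmod (coef N (\<xi> m) i - coef N \<Phi> i) \<le> \<epsilon>" for i \<epsilon>
    proof -
      have "cmod (coef N \<psi> i - coef N \<Phi> i) \<le> \<epsilon>" "cmod (coef N \<psi>' i - coef N \<Phi> i) \<le> \<epsilon>"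
        using Kc[OF \<open>\<psi> \<in> K n\<close> that] Kc[OF \<open>\<psi>' \<in> K n\<close> that] by auto
      then have "cmod ((coef N \<psi> i - coef N \<Phi> i) + (coef N \<psi>' i - coef N \<Phi> i)) \<le> 2 * \<epsilon>"
        using norm_triangle_ineq[of "coef N \<psi> i - coef N \<Phi> i" "coef N \<psi>' i - coef N \<Phi> i"] by linarith
      moreover have "coef N ?m i - coef N \<Phi> i = ((coef N \<psi> i - coef N \<Phi> i) + (coef N \<psi>' i - coef N \<Phi> i)) / 2"
        using coef_lc[OF Vspace_L2[OF v(1)] Vspace_L2[OF v(2)] i, of "1/2" "1/2"] by (simp add: field_simps)
      ultimately show ?thesis by (simp only: norm_divide norm_numeral)
    qed
    ultimately show ?thesis using mv by (simp add: K_def)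
  qed
  define d where "d n = Inf (q ` K n)" for n
  have bdd: "bdd_below (q ` K n)" for n
    by (rule bdd_belowI2[of _ 0]) (auto intro: q0 KV)
  have ne: "q ` K n \<noteq> {}" for n using \<xi>K by blast
  have d_le: "d n \<le> q \<psi>" if "\<psi> \<in> K n" for \<psi> n
    unfolding d_def using that bdd by (auto intro: cInf_lower)
  have "\<exists>\<psi>\<in>K n. q \<psi> < d n + 1 / real (Suc n)" for n
  proof -
    have "Inf (q ` K n) < d n + 1 / real (Suc n)" by (simp add: d_def)
    then show ?thesis using cInf_lessD[OF ne] by blast
  qed
  then obtain \<psi> where \<psi>: "\<And>n. \<psi> n \<in> K n" "\<And>n. q (\<psi> n) < d n + 1 / real (Suc n)" by metis
  have dmono: "d n \<le> d m" if "n \<le> m" for n m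
    unfolding d_def by (rule cInf_superset_mono) (use ne bdd Kmono[OF that] in auto)
  have dbd: "d n \<le> b + 1" for n
    using d_le[OF \<xi>K[of n]] E[of n] nrm[of n] unfolding q_def by linarith
  have "incseq d" using dmono by (auto simp: incseq_def)
  then obtain D where D: "d \<longlonglongrightarrow> D" "\<And>n. d n \<le> D" using incseq_convergent[of d "b + 1"] dbd by metis
  \<comment> \<open>The parallelogram bound: half of d n + d m plus the errors of near-minimality,
    minus the lower bound d n at the midpoint, with d m \<le> D.\<close>
  define \<eta> where "\<eta> n = (D - d n) / 2 + 1 / real (Suc n)" for n
  have \<eta>: "\<eta> \<longlonglongrightarrow> (D - D) / 2 + 0"
    unfolding \<eta>_def[abs_def] by (intro tendsto_intros D LIMSEQ_inverse_real_of_nat[unfolded inverse_eq_divide]) simp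
  have diff: "q (lc (1/2) (\<psi> n) (-1/2) (\<psi> m)) \<le> \<eta> n" if "n \<le> m" for n m
  proof -
    have k: "\<psi> n \<in> K n" "\<psi> m \<in> K n" using \<psi> Kmono[OF that] by auto
    have "d n \<le> q (lc (1/2) (\<psi> n) (1/2) (\<psi> m))" by (rule d_le[OF Kmid[OF k]])
    moreover have "1 / real (Suc m) \<le> 1 / real (Suc n)" using that by (simp add: frac_le)
    ultimately show ?thesis
      using quadf_parallelogram[OF qq KV[OF k(1)] KV[OF k(2)]] \<psi>(2)[of n] \<psi>(2)[of m] D(2)[of m]
      unfolding \<eta>_def by argo
  qed
  have \<psi>V: "\<psi> n \<in> V" for n using \<psi> KV by blast
  note \<psi>L = Vspace_L2[OF \<psi>V]
  have \<psi>lim: "(\<lambda>n. coef N (\<psi> n) i) \<longlonglongrightarrow> coef N \<Phi> i" if i: "i \<in> idx N" for i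
  proof (rule LIMSEQ_I)
    fix r :: real assume r: "0 < r"
    then obtain n0 where n0: "\<forall>m\<ge>n0. cmod (coef N (\<xi> m) i - coef N \<Phi> i) < r/2"
      using LIMSEQ_D[OF lim[OF i], of "r/2"] by auto
    have "cmod (coef N (\<psi> n) i - coef N \<Phi> i) < r" if "n0 \<le> n" for n
    proof -
      have "\<forall>m\<ge>n. cmod (coef N (\<xi> m) i - coef N \<Phi> i) \<le> r/2" using n0 that by (meson less_imp_le order_trans)
      then have "cmod (coef N (\<psi> n) i - coef N \<Phi> i) \<le> r/2" using \<psi>(1)[of n] i unfolding K_def by blast
      then show ?thesis using r by simp
    qed
    then show "\<exists>no. \<forall>n\<ge>no. cmod (coef N (\<psi> n) i - coef N \<Phi> i) < r" by blast
  qed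
  \<comment> \<open>Half the error of \<psi> n, the half being that of the parallelogram identity;
    this is why the coefficient -2 recovers \<Phi> below.\<close>
  define T where "T n = lc (1/2) (\<psi> n) (-1/2) \<Phi>" for n
  have T: "H1 N (T n) \<and> kin N (T n) + normsq N (T n) \<le> \<eta> n" for n
  proof -
    let ?D = "\<lambda>m. lc (1/2) (\<psi> n) (-1/2) (\<psi> m)"
    have 1: "L2 N (T n)" unfolding T_def by (intro L2_lc \<psi>L L)
    have 2: "H1 N (?D m)" for m by (intro Vspace_H1 Vspace_lc \<psi>V)
    have 3: "(\<lambda>m. coef N (?D m) i) \<longlonglongrightarrow> coef N (T n) i" if "i \<in> idx N" for i
      using that unfolding T_def by (simp only: coef_lc \<psi>L L) (intro tendsto_intros \<psi>lim)
    have 4: "\<forall>\<^sub>F m in sequentially. kin N (?D m) + normsq N (?D m) \<le> \<eta> n"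
      using eventually_ge_at_top[of n]
    proof eventually_elim
      case (elim m)
      have "kin N (?D m) \<le> E (?D m)"
        by (intro kin_le_energy Vspace_lc \<psi>V)
      then show ?case using diff[OF elim] unfolding q_def by linarith
    qed
    show ?thesis using H1_limit[OF 1 2 3 4] by simp
  qed
  have \<Phi>eq: "\<Phi> = lc 1 (\<psi> n) (of_real (-2)) (T n)" for n by (simp add: T_def lc_def)
  have "H1 N \<Phi>" by (subst \<Phi>eq[of 0]) (intro H1_lc Vspace_H1 \<psi>V T[THEN conjunct1])
  then show \<Phi>V: "\<Phi> \<in> V" using antisym_limit[OF L V lim] by (simp add: Vspace_def)
  have TV: "T n \<in> V" for n unfolding T_def by (intro Vspace_lc \<psi>V \<Phi>V)
  obtain C where C: "0 < C" "\<And>\<psi>. \<psi> \<in> V \<Longrightarrow> E \<psi> \<le> C * (kin N \<psi> + normsq N \<psi>)" using energy_bounded by blast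
  have ineq: "E \<Phi> \<le> (1 + \<delta>) * b" if \<delta>: "0 < \<delta>" for \<delta>
  proof -
    have "E \<Phi> \<le> (1 + \<delta>) * b + (1 + 1 / \<delta>) * (-2)\<^sup>2 * (C * \<eta> n)" for n
    proof -
      have "E \<Phi> \<le> (1 + \<delta>) * E (\<psi> n) + (1 + 1 / \<delta>) * (-2)\<^sup>2 * E (T n)"
        by (subst \<Phi>eq[of n]) (rule quadf_triangle[OF quadf_energy \<psi>V TV \<delta> energy_nonneg])
      also have "\<dots> \<le> (1 + \<delta>) * b + (1 + 1 / \<delta>) * (-2)\<^sup>2 * (C * \<eta> n)"
      proof (intro add_mono mult_left_mono)
        show "E (\<psi> n) \<le> b" using \<psi>(1) by (simp add: K_def)
        show "E (T n) \<le> C * \<eta> n"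
          using C(2)[OF TV[of n]] C(1) T[of n] by (meson mult_left_mono less_imp_le order_trans)
      qed (use \<delta> in auto)
      finally show ?thesis .
    qed
    moreover have lm: "(\<lambda>n. (1 + \<delta>) * b + (1 + 1 / \<delta>) * (-2)\<^sup>2 * (C * \<eta> n)) \<longlonglongrightarrow> (1 + \<delta>) * b + (1 + 1 / \<delta>) * (-2)\<^sup>2 * (C * ((D - D) / 2 + 0))"
      by (intro tendsto_intros \<eta>)
    ultimately have "E \<Phi> \<le> (1 + \<delta>) * b + (1 + 1 / \<delta>) * (-2)\<^sup>2 * (C * ((D - D) / 2 + 0))"
      by (intro LIMSEQ_le_const[OF lm]) blast
    then show ?thesis by simp
  qed
  show "E \<Phi> \<le> b"
  proof (rule tendsto_lowerbound)
    show "((\<lambda>\<delta>. (1 + \<delta>) * b) \<longlongrightarrow> b) (at_right 0)" by (auto intro!: tendsto_eq_intros)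
    show "\<forall>\<^sub>F \<delta> in at_right 0. E \<Phi> \<le> (1 + \<delta>) * b"
      by (rule eventually_at_rightI[of 0 1]) (use ineq in auto)
  qed simp
qed

end

section \<open>Compactness of mixtures with bounded energy\<close>

text \<open>Bolzano-Weierstrass for each coordinate, followed by Cantor's diagonal sequence.\<close>

lemma countable_diagonal_subseq:
  fixes f :: "nat \<Rightarrow> 'a \<Rightarrow> complex"
  assumes A: "countable A" and bd: "\<And>n a. a \<in> A \<Longrightarrow> cmod (f n a) \<le> B a"
  shows "\<exists>r. strict_mono r \<and> (\<forall>a\<in>A. convergent (\<lambda>n. f (r n) a))"
proof (cases "A = {}")
  case True
  then show ?thesis by (auto intro: exI[of _ id] simp: strict_mono_def)
next
  case False
  define P where "P j s \<longleftrightarrow> convergent (\<lambda>n. f (s n) (from_nat_into A j))" for j and s :: "nat \<Rightarrow> nat"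
  interpret subseqs P
  proof
    fix j and s :: "nat \<Rightarrow> nat" assume "strict_mono s"
    have "bounded (range (\<lambda>n. f (s n) (from_nat_into A j)))"
      by (rule boundedI[of _ "B (from_nat_into A j)"]) (use bd from_nat_into[OF False] in auto)
    then obtain l r where "strict_mono r" "((\<lambda>n. f (s n) (from_nat_into A j)) \<circ> r) \<longlonglongrightarrow> l"
      using bounded_imp_convergent_subsequence by blast
    then show "\<exists>r'. strict_mono r' \<and> P j (s \<circ> r')"
      unfolding P_def convergent_def by (auto simp: o_def)
  qed
  have "P j (diagseq \<circ> (+) (Suc j))" for j
  proof (rule diagseq_holds)
    fix r s n assume "strict_mono (r :: nat \<Rightarrow> nat)" "P n s"
    then show "P n (s \<circ> r)" unfolding P_def convergent_def
      using LIMSEQ_subseq_LIMSEQ[of "\<lambda>m. f (s m) (from_nat_into A n)" _ r] by (auto simp: o_def)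
  qed
  then have "convergent (\<lambda>n. f (diagseq (n + Suc j)) (from_nat_into A j))" for j
    unfolding P_def by (simp only: o_def add.commute[of "Suc _"])
  then have "convergent (\<lambda>n. f (diagseq n) (from_nat_into A j))" for j
    using convergent_ignore_initial_segment[of "\<lambda>n. f (diagseq n) (from_nat_into A j)" "Suc j"] by simp
  then have "\<forall>a\<in>A. convergent (\<lambda>n. f (diagseq n) a)"
    using A by (metis from_nat_into_surj)
  then show ?thesis using subseq_diagseq by blast
qed

text \<open>Dominated convergence for series with a majorant C * w n that moves with n. Tightness of
  the weights bounds all tails uniformly, so convergence of the terms suffices.\<close>

lemma tight_sums:
  fixes x w :: "nat \<Rightarrow> nat \<Rightarrow> real"
  assumes w: "\<And>n. w n sums 1" "\<And>n k. 0 \<le> w n k"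
    and tight: "\<And>\<epsilon>. 0 < \<epsilon> \<Longrightarrow> \<exists>K. \<forall>n. 1 - \<epsilon> \<le> (\<Sum>k<K. w n k)"
    and xw: "\<And>n k. \<bar>x n k\<bar> \<le> C * w n k"
    and lim: "\<And>k. (\<lambda>n. x n k) \<longlonglongrightarrow> y k"
    and s: "\<And>n. x n sums s n" "s \<longlonglongrightarrow> S"
  shows "y sums S"
proof -
  have C: "0 \<le> C"
  proof (rule ccontr)
    assume "\<not> 0 \<le> C"
    then have "w 0 k = 0" for k
      using xw[of 0 k] w(2)[of 0 k] by (smt (verit) mult_neg_pos)
    then have "w 0 = (\<lambda>_. 0)" by auto
    then show False using w(1)[of 0] sums_unique2[OF _ sums_zero] by force
  qed
  have tail: "\<bar>s n - (\<Sum>k<K. x n k)\<bar> \<le> C * (1 - (\<Sum>k<K. w n k))" for n K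
  proof -
    have 1: "(\<lambda>k. x n (k + K)) sums (s n - (\<Sum>k<K. x n k))" using s(1) by (rule sums_split_initial_segment)
    have 2: "(\<lambda>k. C * w n (k + K)) sums (C * (1 - (\<Sum>k<K. w n k)))"
      using sums_mult[OF sums_split_initial_segment[OF w(1)]] .
    have "s n - (\<Sum>k<K. x n k) \<le> C * (1 - (\<Sum>k<K. w n k))"
      by (rule sums_le[OF _ 1 2]) (use xw abs_le_D1 in blast)
    moreover have "- (s n - (\<Sum>k<K. x n k)) \<le> C * (1 - (\<Sum>k<K. w n k))"
      by (rule sums_le[OF _ sums_minus[OF 1] 2]) (use xw abs_le_D2 in blast)
    ultimately show ?thesis by linarith
  qed
  show ?thesis unfolding sums_def
  proof (rule LIMSEQ_I)
    fix r :: real assume r: "0 < r"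
    \<comment> \<open>\<open>C + 1\<close> rather than \<open>C\<close>, since \<open>C\<close> may
      be 0.\<close>
    define \<epsilon> where "\<epsilon> = r / (2 * (C + 1))"
    have \<epsilon>: "0 < \<epsilon>" "C * \<epsilon> < r"
    proof -
      show "0 < \<epsilon>" using r C by (simp add: \<epsilon>_def)
      have "C * \<epsilon> \<le> (C + 1) * \<epsilon>" using \<open>0 < \<epsilon>\<close> by (intro mult_right_mono) auto
      also have "\<dots> = r / 2" using C unfolding \<epsilon>_def by (simp add: field_simps)
      finally show "C * \<epsilon> < r" using r by simp
    qed
    obtain K where K: "\<And>n. 1 - \<epsilon> \<le> (\<Sum>k<K. w n k)" using tight[OF \<epsilon>(1)] by blast
    have "norm ((\<Sum>k<L. y k) - S) < r" if "K \<le> L" for L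
    proof -
      have "\<bar>S - (\<Sum>k<L. y k)\<bar> \<le> C * \<epsilon>"
      proof (rule tendsto_upperbound)
        show "(\<lambda>n. \<bar>s n - (\<Sum>k<L. x n k)\<bar>) \<longlonglongrightarrow> \<bar>S - (\<Sum>k<L. y k)\<bar>"
          by (intro tendsto_intros s lim)
        have "\<bar>s n - (\<Sum>k<L. x n k)\<bar> \<le> C * \<epsilon>" for n
        proof -
          have "(\<Sum>k<K. w n k) \<le> (\<Sum>k<L. w n k)" using that w(2) by (intro sum_mono2) auto
          then have "1 - (\<Sum>k<L. w n k) \<le> \<epsilon>" using K[of n] by linarith
          then show ?thesis using tail[of n L] C by (meson mult_left_mono order_trans)
        qed
        then show "\<forall>\<^sub>F n in sequentially. \<bar>s n - (\<Sum>k<L. x n k)\<bar> \<le> C * \<epsilon>" by simp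
      qed simp
      then show ?thesis using \<epsilon>(2) by simp
    qed
    then show "\<exists>no. \<forall>n\<ge>no. norm ((\<Sum>k<n. y k) - S) < r" by blast
  qed
qed

definition low :: "nat \<Rightarrow> real \<Rightarrow> ((nat \<Rightarrow> int) \<times> (nat \<Rightarrow> bool)) set" where
  "low N M = {i \<in> idx N. kap N i \<le> M}"

text \<open>An integer is at most its square in absolute value, and 2 pi^2 is at least 1, so the
  bound on \<open>kap\<close> confines every frequency to an interval.\<close>

lemma finite_low: "finite (low N M)"
proof (rule finite_subset)
  let ?m = "\<lceil>M\<rceil>"
  show "low N M \<subseteq> PiE {..<N} (\<lambda>_. {- ?m..?m}) \<times> spins N"
  proof
    fix i assume i: "i \<in> low N M"
    have "fst i j \<in> {- ?m..?m}" if j: "j < N" for j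
    proof -
      have "\<bar>fst i j\<bar> \<le> (fst i j)\<^sup>2"
      proof (cases "fst i j = 0")
        case False
        then have "\<bar>fst i j\<bar> * 1 \<le> \<bar>fst i j\<bar> * \<bar>fst i j\<bar>" by (intro mult_left_mono) auto
        then show ?thesis by (simp add: power2_eq_square flip: abs_mult)
      qed simp
      then have "\<bar>of_int (fst i j) :: real\<bar> \<le> (of_int (fst i j))\<^sup>2"
        by (metis of_int_abs of_int_le_iff of_int_power)
      also have "\<dots> \<le> (\<Sum>j<N. (of_int (fst i j))\<^sup>2)" using j by (intro member_le_sum) auto
      also have "\<dots> \<le> 2 * pi\<^sup>2 * (\<Sum>j<N. (of_int (fst i j))\<^sup>2)"
      proof -
        have "1 \<le> pi * pi" using pi_ge_two mult_mono[of 1 pi 1 pi] by linarith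
        then have "1 * (\<Sum>j<N. (real_of_int (fst i j))\<^sup>2) \<le> 2 * pi\<^sup>2 * (\<Sum>j<N. (of_int (fst i j))\<^sup>2)"
          by (intro mult_right_mono sum_nonneg) (auto simp: power2_eq_square)
        then show ?thesis by simp
      qed
      also have "\<dots> \<le> M" using i by (simp add: low_def kap_def)
      finally have "real_of_int \<bar>fst i j\<bar> \<le> M" by simp
      then have "\<bar>fst i j\<bar> \<le> ?m" by linarith
      then show ?thesis by auto
    qed
    then show "i \<in> PiE {..<N} (\<lambda>_. {- ?m..?m}) \<times> spins N"
      using i by (cases i) (auto simp: low_def idx_def modes_def PiE_iff)
  qed
  show "finite (PiE {..<N} (\<lambda>_. {- ?m..?m}) \<times> spins N)"
    by (intro finite_cartesian_product finite_PiE) auto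
qed

text \<open>Chebyshev's inequality: a mode outside \<open>low N M\<close> has \<open>kap\<close>
  above \<open>M\<close>, so those modes together carry at most the kinetic energy divided by
  \<open>M\<close>.\<close>

lemma normsq_le_low:
  assumes H: "H1 N T" and M: "0 < M"
  shows "normsq N T \<le> (\<Sum>i\<in>low N M. (cmod (coef N T i))\<^sup>2) + kin N T / M"
proof -
  let ?f = "\<lambda>i. (cmod (coef N T i))\<^sup>2"
  have "((\<lambda>i. if i \<in> low N M then ?f i else 0) has_sum (\<Sum>i\<in>low N M. ?f i)) (idx N)"
  proof (rule has_sum_cong_neutral[THEN iffD1])
    show "(?f has_sum (\<Sum>i\<in>low N M. ?f i)) (low N M)" by (rule has_sum_finite[OF finite_low])
  qed (auto simp: low_def)
  moreover have "((\<lambda>i. kap N i * ?f i / M) has_sum (kin N T / M)) (idx N)"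
    by (intro has_sum_divide_const kin_has_sum H)
  ultimately have "((\<lambda>i. (if i \<in> low N M then ?f i else 0) + kap N i * ?f i / M) has_sum
    ((\<Sum>i\<in>low N M. ?f i) + kin N T / M)) (idx N)"
    by (rule has_sum_add)
  then show ?thesis
  proof (rule has_sum_mono[OF normsq_has_sum[OF H1_L2[OF H]]])
    fix i assume i: "i \<in> idx N"
    show "?f i \<le> (if i \<in> low N M then ?f i else 0) + kap N i * ?f i / M"
    proof (cases "i \<in> low N M")
      case True
      then show ?thesis using M kap_nonneg[of N i] by simp
    next
      case False
      then have "1 \<le> kap N i / M" using i M by (simp add: low_def)
      then have "1 * ?f i \<le> kap N i / M * ?f i" by (intro mult_right_mono) auto
      then show ?thesis using False by simp
    qed
  qed
qed

text \<open>Rellich's compactness in coordinates: finitely many low modes converge one by one, while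
  the high modes of the difference are uniformly small because its kinetic energy is
  bounded.\<close>

lemma strong_convergence:
  assumes V: "\<And>n. X n \<in> Vspace N" "\<Phi> \<in> Vspace N" and kin: "\<And>n. kin N (X n) \<le> C"
    and lim: "\<And>i. i \<in> idx N \<Longrightarrow> (\<lambda>n. coef N (X n) i) \<longlonglongrightarrow> coef N \<Phi> i"
  shows "(\<lambda>n. normsq N (lc 1 (X n) (of_real (-1)) \<Phi>)) \<longlonglongrightarrow> 0"
proof (rule LIMSEQ_I)
  fix r :: real assume r: "0 < r"
  let ?T = "\<lambda>n. lc 1 (X n) (of_real (-1)) \<Phi>"
  have T: "?T n \<in> Vspace N" for n by (intro Vspace_lc V)
  define D where "D = 2 * C + 2 * kin N \<Phi>"
  have kT: "kin N (?T n) \<le> D" for n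
    using quadf_triangle[OF quadf_kin V(1)[of n] V(2), where \<delta> = 1 and t = "-1"] kin[of n] kin_nonneg by (simp add: D_def)
  have D0: "0 \<le> D" using kT[of 0] kin_nonneg[of N "?T 0"] by linarith
  define M where "M = 2 * (D + 1) / r"
  have M: "0 < M" using D0 r by (simp add: M_def)
  have "D < r * M" using r D0 by (simp add: M_def)
  then have "D / M < r" using M by (simp add: pos_divide_less_eq)
  have "(\<lambda>n. \<Sum>i\<in>low N M. (cmod (coef N (?T n) i))\<^sup>2) \<longlonglongrightarrow> (\<Sum>i\<in>low N M. (cmod 0)\<^sup>2)"
  proof (intro tendsto_sum tendsto_power tendsto_norm)
    fix i assume "i \<in> low N M"
    then have i: "i \<in> idx N" by (simp add: low_def)
    have "(\<lambda>n. 1 * coef N (X n) i + of_real (-1) * coef N \<Phi> i) \<longlonglongrightarrow> 1 * coef N \<Phi> i + of_real (-1) * coef N \<Phi> i"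
      by (intro tendsto_intros lim i)
    then show "(\<lambda>n. coef N (?T n) i) \<longlonglongrightarrow> 0"
      using V by (simp add: coef_lc Vspace_L2 i)
  qed
  then have "(\<lambda>n. \<Sum>i\<in>low N M. (cmod (coef N (?T n) i))\<^sup>2) \<longlonglongrightarrow> 0" by simp
  then obtain n0 where n0: "\<And>n. n0 \<le> n \<Longrightarrow> (\<Sum>i\<in>low N M. (cmod (coef N (?T n) i))\<^sup>2) < r - D / M"
    using order_tendstoD(2)[of _ 0 sequentially "r - D / M"] \<open>D / M < r\<close> unfolding eventually_sequentially by fastforce
  have "norm (normsq N (?T n) - 0) < r" if "n0 \<le> n" for n
  proof -
    have "normsq N (?T n) \<le> (\<Sum>i\<in>low N M. (cmod (coef N (?T n) i))\<^sup>2) + kin N (?T n) / M"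
      by (rule normsq_le_low[OF Vspace_H1[OF T] M])
    also have "\<dots> \<le> (\<Sum>i\<in>low N M. (cmod (coef N (?T n) i))\<^sup>2) + D / M"
      using kT[of n] M by (intro add_left_mono divide_right_mono) auto
    also have "\<dots> < r" using n0[OF that] by simp
    finally show ?thesis using normsq_nonneg[of N "?T n"] by simp
  qed
  then show "\<exists>no. \<forall>n\<ge>no. norm (normsq N (?T n) - 0) < r" by blast
qed

text \<open>A nonnegative form bounded by the norm is continuous under strong convergence. Each of
  \<open>X n\<close> and \<Phi> is a perturbation of the other by their difference, and
  \<open>quadf_triangle\<close> used both ways gives the two bounds.\<close>

lemma quadf_convergence:
  assumes Q: "quadf N Q" "\<And>\<Psi>. \<Psi> \<in> Vspace N \<Longrightarrow> 0 \<le> Q \<Psi>" "\<And>\<Psi>. \<Psi> \<in> Vspace N \<Longrightarrow> Q \<Psi> \<le> c * normsq N \<Psi>"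
    and V: "\<And>n. X n \<in> Vspace N" "\<Phi> \<in> Vspace N" and kin: "\<And>n. kin N (X n) \<le> C"
    and lim: "\<And>i. i \<in> idx N \<Longrightarrow> (\<lambda>n. coef N (X n) i) \<longlonglongrightarrow> coef N \<Phi> i"
  shows "(\<lambda>n. Q (X n)) \<longlonglongrightarrow> Q \<Phi>"
proof -
  let ?T = "\<lambda>n. lc 1 (X n) (of_real (-1)) \<Phi>"
  have T: "?T n \<in> Vspace N" for n by (intro Vspace_lc V)
  have "(\<lambda>n. c * normsq N (?T n)) \<longlonglongrightarrow> c * 0"
    by (intro tendsto_intros strong_convergence[OF V kin lim])
  then have "(\<lambda>n. c * normsq N (?T n)) \<longlonglongrightarrow> 0" by simp
  then have QT: "(\<lambda>n. Q (?T n)) \<longlonglongrightarrow> 0"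
    by (intro tendsto_sandwich[OF _ _ tendsto_const, of 0 "\<lambda>n. Q (?T n)" sequentially "\<lambda>n. c * normsq N (?T n)"])
      (auto intro!: always_eventually simp only: Q T)
  show ?thesis
  proof (rule LIMSEQ_I)
    fix r :: real assume r: "0 < r"
    \<comment> \<open>Small enough for \<delta> (Q \<Phi> + r) \<le> r / 4, which serves both
      directions: once the upper bound is known, Q (X n) is below Q \<Phi> + r.\<close>
    define \<delta> where "\<delta> = min 1 (r / (4 * (Q \<Phi> + r)))"
    have Q\<Phi>: "0 \<le> Q \<Phi>" using Q V by blast
    have \<delta>: "0 < \<delta>" "\<delta> \<le> 1" using r Q\<Phi> by (auto simp: \<delta>_def)
    have "\<delta> * (Q \<Phi> + r) \<le> r / (4 * (Q \<Phi> + r)) * (Q \<Phi> + r)"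
      using r Q\<Phi> by (intro mult_right_mono) (auto simp: \<delta>_def)
    moreover have "Q \<Phi> + r \<noteq> 0" using r Q\<Phi> by simp
    moreover have "r / (4 * z) * z = r / 4" if "z \<noteq> 0" for z using that by simp
    ultimately have \<delta>r: "\<delta> * (Q \<Phi> + r) \<le> r / 4" by metis
    have "(\<lambda>n. (1 + 1 / \<delta>) * Q (?T n)) \<longlonglongrightarrow> (1 + 1 / \<delta>) * 0" by (intro tendsto_intros QT)
    then obtain n0 where n0: "\<And>n. n0 \<le> n \<Longrightarrow> (1 + 1 / \<delta>) * Q (?T n) < r / 4"
      using order_tendstoD(2)[of _ 0 sequentially "r / 4"] r unfolding eventually_sequentially by fastforce
    have "norm (Q (X n) - Q \<Phi>) < r" if n: "n0 \<le> n" for n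
    proof -
      have X: "X n = lc 1 \<Phi> (of_real 1) (?T n)" and P: "\<Phi> = lc 1 (X n) (of_real (-1)) (?T n)" by (auto simp: lc_def)
      have 1: "Q (X n) \<le> (1 + \<delta>) * Q \<Phi> + (1 + 1 / \<delta>) * Q (?T n)"
        using quadf_triangle[OF Q(1) V(2) T[of n] \<delta>(1), where t = 1] Q(2) by (subst X) simp
      have 2: "Q \<Phi> \<le> (1 + \<delta>) * Q (X n) + (1 + 1 / \<delta>) * Q (?T n)"
        using quadf_triangle[OF Q(1) V(1)[of n] T[of n] \<delta>(1), where t = "-1"] Q(2) by (subst P) simp
      have 3: "\<delta> * Q \<Phi> \<le> r / 4" using \<delta>r \<delta>(1) r by (simp add: algebra_simps) (smt (verit) mult_pos_pos)
      have 4: "Q (X n) < Q \<Phi> + r" using 1 3 n0[OF n] r by (simp add: algebra_simps)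
      then have "\<delta> * Q (X n) \<le> r / 4" using \<delta>r \<delta>(1) by (meson less_imp_le mult_left_mono order_trans)
      then have "Q \<Phi> < Q (X n) + r" using 2 n0[OF n] r by (simp add: algebra_simps)
      then show ?thesis using 4 by auto
    qed
    then show "\<exists>no. \<forall>n\<ge>no. norm (Q (X n) - Q \<Phi>) < r" by blast
  qed
qed

context hamiltonian
begin

text \<open>Otherwise infinitely many members lie below the level, and lower semicontinuity along
  them puts \<Phi> below it as well.\<close>

lemma energy_lsc_eventually:
  assumes V: "\<And>n. X n \<in> V" "\<Phi> \<in> V" and nrm: "\<And>n. normsq N (X n) \<le> 1"
    and lim: "\<And>i. i \<in> idx N \<Longrightarrow> (\<lambda>n. coef N (X n) i) \<longlonglongrightarrow> coef N \<Phi> i" and \<epsilon>: "0 < \<epsilon>"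
  shows "\<forall>\<^sub>F n in sequentially. E \<Phi> - \<epsilon> \<le> E (X n)"
proof (rule ccontr)
  assume "\<not> ?thesis"
  then have "\<exists>\<^sub>F n in sequentially. E (X n) < E \<Phi> - \<epsilon>" by (simp add: not_eventually not_le)
  then have "infinite {n. E (X n) < E \<Phi> - \<epsilon>}"
    by (simp add: frequently_cofinite cofinite_eq_sequentially[symmetric])
  from infinite_enumerate[OF this] obtain r :: "nat \<Rightarrow> nat" where r: "strict_mono r" "\<And>n. r n \<in> {n. E (X n) < E \<Phi> - \<epsilon>}"
    by blast
  have "E \<Phi> \<le> E \<Phi> - \<epsilon>"
  proof (rule energy_lsc(2)[where \<xi> = "\<lambda>n. X (r n)"])
    show "E (X (r n)) \<le> E \<Phi> - \<epsilon>" for n using r(2)[of n] by simp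
    show "(\<lambda>n. coef N (X (r n)) i) \<longlonglongrightarrow> coef N \<Phi> i" if "i \<in> idx N" for i
      using LIMSEQ_subseq_LIMSEQ[OF lim[OF that] r(1)] by (simp add: o_def)
  qed (use V nrm in \<open>auto intro: Vspace_L2\<close>)
  then show False using \<epsilon> by simp
qed

text \<open>The limit is taken separately for every component index. The energy is only lower
  semicontinuous, so it is bounded by \<open>c\<close>; forms bounded by the norm converge termwise,
  and tightness in the index carries the limit through the infinite sum, so that norms and tested
  densities are preserved exactly.\<close>

theorem mixture_compactness:
  assumes XV: "\<And>n k. X n k \<in> V" and sum1: "\<And>n. (\<lambda>k. normsq N (X n k)) sums 1"
    and en: "\<And>n K. (\<Sum>k<K. E (X n k)) \<le> b n" and b: "b \<longlonglongrightarrow> c"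
    and tight: "\<And>\<epsilon>. 0 < \<epsilon> \<Longrightarrow> \<exists>K. \<forall>n. 1 - \<epsilon> \<le> (\<Sum>k<K. normsq N (X n k))"
  obtains r \<Phi> where "strict_mono r" "\<And>k. \<Phi> k \<in> V"
    "\<And>k i. i \<in> idx N \<Longrightarrow> (\<lambda>n. coef N (X (r n) k) i) \<longlonglongrightarrow> coef N (\<Phi> k) i"
    "\<And>K. (\<Sum>k<K. E (\<Phi> k)) \<le> c"
    "\<And>Q s S C. quadf N Q \<Longrightarrow> (\<And>\<Psi>. \<Psi> \<in> V \<Longrightarrow> \<bar>Q \<Psi>\<bar> \<le> C * normsq N \<Psi>) \<Longrightarrow> (\<And>n. (\<lambda>k. Q (X n k)) sums s n) \<Longrightarrow> s \<longlonglongrightarrow> S \<Longrightarrow> (\<lambda>k. Q (\<Phi> k)) sums S"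
    "\<And>k. (\<lambda>n. normsq N (X (r n) k)) \<longlonglongrightarrow> normsq N (\<Phi> k)"
    "\<exists>B. \<forall>n k. kin N (X n k) \<le> B"
proof -
  have nrm: "normsq N (X n k) \<le> 1" for n k
    using sum_le_suminf[OF sums_summable[OF sum1], of "{k}" n] sums_unique[OF sum1, of n] normsq_nonneg by simp
  have "bounded (range b)" using b convergent_imp_bounded convergentI by blast
  then obtain B where B: "\<And>n. b n \<le> B" unfolding bounded_iff by (metis abs_le_D1 rangeI real_norm_def)
  have EB: "E (X n k) \<le> B" for n k
  proof -
    have "E (X n k) \<le> (\<Sum>k'<Suc k. E (X n k'))"
      using XV by (intro member_le_sum) (auto intro: energy_nonneg)
    then show ?thesis using en[of n "Suc k"] B[of n] by linarith
  qed
  have kB: "kin N (X n k) \<le> B" for n k using kin_le_energy[OF XV] EB order_trans by blast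
  have cb: "cmod (coef N (X n k) i) \<le> 1" if "i \<in> idx N" for n k i
  proof -
    have "(\<Sum>i\<in>{i}. (cmod (coef N (X n k) i))\<^sup>2) \<le> normsq N (X n k)"
      using that by (intro finite_sum_normsq_le Vspace_L2 XV) auto
    then have "(cmod (coef N (X n k) i))\<^sup>2 \<le> 1" using nrm[of n k] by simp
    then show ?thesis by (simp add: power_le_one_iff abs_square_le_1)
  qed
  have "countable ((UNIV :: nat set) \<times> idx N)" using countable_idx by auto
  from countable_diagonal_subseq[OF this, of "\<lambda>n (k, i). coef N (X n k) i" "\<lambda>_. 1"] cb
  obtain r where r: "strict_mono r" "\<And>k i. i \<in> idx N \<Longrightarrow> convergent (\<lambda>n. coef N (X (r n) k) i)"
    by (force simp: case_prod_beta)
  define a where "a k i = lim (\<lambda>n. coef N (X (r n) k) i)" for k i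
  have a: "(\<lambda>n. coef N (X (r n) k) i) \<longlonglongrightarrow> a k i" if "i \<in> idx N" for k i
    using r(2)[OF that] by (simp add: a_def convergent_LIMSEQ_iff)
  have "\<exists>\<Psi>. L2 N \<Psi> \<and> (\<forall>i\<in>idx N. coef N \<Psi> i = a k i)" for k
  proof (rule L2_synthesis, rule nonneg_bdd_above_summable_on)
    show "bdd_above (sum (\<lambda>i. (cmod (a k i))\<^sup>2) ` {F. F \<subseteq> idx N \<and> finite F})"
    proof (rule bdd_aboveI2)
      fix F assume F: "F \<in> {F. F \<subseteq> idx N \<and> finite F}"
      show "(\<Sum>i\<in>F. (cmod (a k i))\<^sup>2) \<le> 1"
      proof (rule LIMSEQ_le_const2)
        show "(\<lambda>n. \<Sum>i\<in>F. (cmod (coef N (X (r n) k) i))\<^sup>2) \<longlonglongrightarrow> (\<Sum>i\<in>F. (cmod (a k i))\<^sup>2)"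
          using F by (intro tendsto_intros a) auto
        have "(\<Sum>i\<in>F. (cmod (coef N (X (r n) k) i))\<^sup>2) \<le> 1" for n
          using finite_sum_normsq_le[OF Vspace_L2[OF XV], of F "r n" k] nrm[of "r n" k] F by auto
        then show "\<exists>n0. \<forall>n\<ge>n0. (\<Sum>i\<in>F. (cmod (coef N (X (r n) k) i))\<^sup>2) \<le> 1" by blast
      qed
    qed
  qed simp
  then obtain \<Phi> where \<Phi>: "\<And>k. L2 N (\<Phi> k)" "\<And>k i. i \<in> idx N \<Longrightarrow> coef N (\<Phi> k) i = a k i" by metis
  have lim: "(\<lambda>n. coef N (X (r n) k) i) \<longlonglongrightarrow> coef N (\<Phi> k) i" if "i \<in> idx N" for k i
    using a[OF that] \<Phi>(2)[OF that] by simp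
  have \<Phi>V: "\<Phi> k \<in> V" for k
    by (rule energy_lsc(1)[OF \<Phi>(1), of "\<lambda>n. X (r n) k" B]) (use XV EB nrm lim in auto)
  have Esum: "(\<Sum>k<K. E (\<Phi> k)) \<le> c" for K
  proof (rule field_le_epsilon)
    fix \<epsilon> :: real assume \<epsilon>: "0 < \<epsilon>"
    define \<epsilon>' where "\<epsilon>' = \<epsilon> / (real K + 1)"
    have \<epsilon>': "0 < \<epsilon>'" "real K * \<epsilon>' \<le> \<epsilon>" using \<epsilon> by (auto simp: \<epsilon>'_def field_simps)
    have "\<forall>\<^sub>F n in sequentially. \<forall>k\<in>{..<K}. E (\<Phi> k) - \<epsilon>' \<le> E (X (r n) k)"
      by (intro eventually_ball_finite ballI energy_lsc_eventually XV \<Phi>V nrm lim \<epsilon>') auto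
    then have ev: "\<forall>\<^sub>F n in sequentially. (\<Sum>k<K. E (\<Phi> k)) - \<epsilon> \<le> b (r n)"
    proof eventually_elim
      case (elim n)
      have "(\<Sum>k<K. E (\<Phi> k)) - real K * \<epsilon>' = (\<Sum>k<K. E (\<Phi> k) - \<epsilon>')" by (simp add: sum_subtractf)
      also have "\<dots> \<le> (\<Sum>k<K. E (X (r n) k))" using elim by (intro sum_mono) auto
      also have "\<dots> \<le> b (r n)" by (rule en)
      finally show ?case using \<epsilon>' by linarith
    qed
    have "(\<Sum>k<K. E (\<Phi> k)) - \<epsilon> \<le> c"
      by (rule tendsto_lowerbound[OF LIMSEQ_subseq_LIMSEQ[OF b r(1), unfolded o_def] ev]) simp
    then show "(\<Sum>k<K. E (\<Phi> k)) \<le> c + \<epsilon>" by simp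
  qed
  have nlim: "(\<lambda>n. normsq N (X (r n) k)) \<longlonglongrightarrow> normsq N (\<Phi> k)" for k
    by (rule quadf_convergence[OF quadf_normsq, of _ 1 "\<lambda>n. X (r n) k" _ B])
      (use XV \<Phi>V kB lim normsq_nonneg in auto)
  have Qsum: "(\<lambda>k. Q (\<Phi> k)) sums S" if Q: "quadf N Q" and C: "\<And>\<Psi>. \<Psi> \<in> V \<Longrightarrow> \<bar>Q \<Psi>\<bar> \<le> C * normsq N \<Psi>"
    and s: "\<And>n. (\<lambda>k. Q (X n k)) sums s n" "s \<longlonglongrightarrow> S" for Q s S C
  proof (rule tight_sums[where w = "\<lambda>n k. normsq N (X (r n) k)" and x = "\<lambda>n k. Q (X (r n) k)" and C = C and s = "\<lambda>n. s (r n)"])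
    fix k
    \<comment> \<open>\<open>Q\<close> may change sign; adding \<open>C\<close> times the squared
      norm gives a nonnegative form, to which \<open>quadf_convergence\<close> applies.\<close>
    have q2: "quadf N (\<lambda>\<Psi>. Q \<Psi> + C * normsq N \<Psi>)"
    proof -
      have "quadf N (\<lambda>\<Psi>. C * normsq N \<Psi>)" 
        unfolding quadf_def
        by (intro exI[of _ "\<lambda>\<Phi> \<Psi>. of_real C * inner_wf N \<Phi> \<Psi>"] ballI allI) (simp add: normsq_lc Vspace_L2 algebra_simps)
      then show ?thesis by (rule quadf_add[OF Q])
    qed
    have "(\<lambda>n. Q (X (r n) k) + C * normsq N (X (r n) k)) \<longlonglongrightarrow> Q (\<Phi> k) + C * normsq N (\<Phi> k)"
    proof (rule quadf_convergence[OF q2, of "2 * C" "\<lambda>n. X (r n) k" _ B])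
      fix \<Psi> assume "\<Psi> \<in> V"
      then show "0 \<le> Q \<Psi> + C * normsq N \<Psi>" "Q \<Psi> + C * normsq N \<Psi> \<le> 2 * C * normsq N \<Psi>"
        using C[of \<Psi>] by auto
    qed (use XV \<Phi>V kB lim in auto)
    then have "(\<lambda>n. (Q (X (r n) k) + C * normsq N (X (r n) k)) - C * normsq N (X (r n) k)) \<longlonglongrightarrow>
      (Q (\<Phi> k) + C * normsq N (\<Phi> k)) - C * normsq N (\<Phi> k)"
      by (intro tendsto_diff tendsto_mult tendsto_const nlim)
    then show "(\<lambda>n. Q (X (r n) k)) \<longlonglongrightarrow> Q (\<Phi> k)" by simp
  next
    fix \<epsilon> :: real assume "0 < \<epsilon>"
    then show "\<exists>K. \<forall>n. 1 - \<epsilon> \<le> (\<Sum>k<K. normsq N (X (r n) k))" using tight by blast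
  next
    show "(\<lambda>n. s (r n)) \<longlonglongrightarrow> S" using LIMSEQ_subseq_LIMSEQ[OF s(2) r(1)] by (simp add: o_def)
  qed (use sum1 normsq_nonneg C XV s in auto)
  show ?thesis
    by (rule that[of r \<Phi>]) (fact r(1) \<Phi>V lim Esum Qsum nlim | use kB in blast)+
qed

end

section \<open>Orthogonal decomposition of finite mixtures\<close>

lemma wnormsq_bound:
  assumes L: "L2 N \<Psi>" and h: "h \<in> borel_measurable (cube N)" "\<And>x. x \<in> space (cube N) \<Longrightarrow> \<bar>h x\<bar> \<le> C"
  shows "\<bar>wnormsq N h \<Psi>\<bar> \<le> C * normsq N \<Psi>"
proof -
  have "\<bar>\<integral>x. h x * (cmod (\<Psi> x s))\<^sup>2 \<partial>cube N\<bar> \<le> C * (\<integral>x. (cmod (\<Psi> x s))\<^sup>2 \<partial>cube N)" if s: "s \<in> spins N" for s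
  proof -
    have i: "integrable (cube N) (\<lambda>x. (cmod (\<Psi> x s))\<^sup>2)" using L s by (auto intro: sqi_integrable_sq L2D)
    have ih: "integrable (cube N) (\<lambda>x. h x * (cmod (\<Psi> x s))\<^sup>2)" by (rule integrable_bounded_mult_real[OF i h])
    have "\<bar>\<integral>x. h x * (cmod (\<Psi> x s))\<^sup>2 \<partial>cube N\<bar> \<le> (\<integral>x. \<bar>h x * (cmod (\<Psi> x s))\<^sup>2\<bar> \<partial>cube N)"
      by (rule integral_abs_bound)
    also have "\<dots> \<le> (\<integral>x. C * (cmod (\<Psi> x s))\<^sup>2 \<partial>cube N)"
    proof (rule integral_mono)
      show "integrable (cube N) (\<lambda>x. \<bar>h x * (cmod (\<Psi> x s))\<^sup>2\<bar>)" using ih by (rule integrable_abs)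
      show "integrable (cube N) (\<lambda>x. C * (cmod (\<Psi> x s))\<^sup>2)" using i by (rule integrable_mult_right)
      show "\<bar>h x * (cmod (\<Psi> x s))\<^sup>2\<bar> \<le> C * (cmod (\<Psi> x s))\<^sup>2" if "x \<in> space (cube N)" for x
        using h(2)[OF that] by (simp add: abs_mult mult_right_mono)
    qed
    finally show ?thesis by simp
  qed
  then have "(\<Sum>s\<in>spins N. \<bar>\<integral>x. h x * (cmod (\<Psi> x s))\<^sup>2 \<partial>cube N\<bar>) \<le> (\<Sum>s\<in>spins N. C * (\<integral>x. (cmod (\<Psi> x s))\<^sup>2 \<partial>cube N))"
    by (rule sum_mono)
  then show ?thesis unfolding wnormsq_def normsq_def sum_distrib_left by (rule order_trans[OF sum_abs])
qed

lemma inner_zero_of_normsq_zero: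
  assumes L: "L2 N \<Phi>" "L2 N \<Psi>" and 0: "normsq N \<Psi> = 0"
  shows "inner_wf N \<Phi> \<Psi> = 0"
proof -
  have "((\<lambda>i. cnj (coef N \<Phi> i) * coef N \<Psi> i) has_sum 0) (idx N)"
    by (rule has_sum_0) (simp add: normsq_zero_coef[OF L(2) 0])
  then show ?thesis using inner_has_sum[OF L] has_sum_unique by blast
qed

lemma inner_cnj: "inner_wf N \<Psi> \<Phi> = cnj (inner_wf N \<Phi> \<Psi>)"
proof -
  have "(\<integral>x. cnj (\<Psi> x s) * \<Phi> x s \<partial>cube N) = cnj (\<integral>x. cnj (\<Phi> x s) * \<Psi> x s \<partial>cube N)" for s
    unfolding Bochner_Integration.integral_cnj[symmetric] by (simp add: mult.commute)
  then show ?thesis unfolding inner_wf_def by simp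
qed

lemma sum_swap2:
  fixes f g :: "nat \<Rightarrow> real"
  assumes "k < n" "l < n" "k \<noteq> l" "\<And>i. i \<noteq> k \<Longrightarrow> i \<noteq> l \<Longrightarrow> f i = g i"
  shows "sum f {..<n} - sum g {..<n} = (f k - g k) + (f l - g l)"
proof -
  have *: "sum h {..<n} = h k + (h l + sum h ({..<n} - {k} - {l}))" for h :: "nat \<Rightarrow> real"
    using assms(1-3) by (subst sum.remove[of _ k], simp, simp, subst sum.remove[of _ l]) auto
  have "sum f ({..<n} - {k} - {l}) = sum g ({..<n} - {k} - {l})"
    using assms(4) by (intro sum.cong) auto
  then show ?thesis unfolding *[of f] *[of g] by simp
qed

context hamiltonian
begin

lemma energy_zero: "\<Psi> \<in> V \<Longrightarrow> normsq N \<Psi> = 0 \<Longrightarrow> E \<Psi> = 0"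
proof -
  assume V: "\<Psi> \<in> V" and 0: "normsq N \<Psi> = 0"
  have "((\<lambda>i. kap N i * (cmod (coef N \<Psi> i))\<^sup>2) has_sum 0) (idx N)"
    by (rule has_sum_0) (simp add: normsq_zero_coef[OF Vspace_L2[OF V] 0])
  then have "kin N \<Psi> = 0" using kin_has_sum[OF Vspace_H1[OF V]] has_sum_unique by blast
  then show ?thesis using W_zero[OF V V 0] by (simp add: energy_def)
qed

text \<open>Among all mixtures of at most \<open>n\<close> vectors with the same densities and no larger energy, one that maximizes
  \<open>\<Sum>k<n. (n - k) * normsq N (X k)\<close> is orthogonal with decreasing norms, since otherwise
  rotating two of its vectors into each other would increase the sum.\<close>

theorem orthogonal_mixture:
  fixes X :: "nat \<Rightarrow> wavefn"
  assumes XV: "\<And>k. k < n \<Longrightarrow> X k \<in> V" and X1: "(\<Sum>k<n. normsq N (X k)) = 1"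
  obtains Y where "\<And>k. Y k \<in> V" "(\<lambda>k. normsq N (Y k)) sums 1"
    "\<And>K. (\<Sum>k<K. E (Y k)) \<le> (\<Sum>k<n. E (X k))"
    "\<And>h C. h \<in> borel_measurable (cube N) \<Longrightarrow> (\<And>x. x \<in> space (cube N) \<Longrightarrow> \<bar>h x\<bar> \<le> C) \<Longrightarrow>
       (\<lambda>k. wnormsq N h (Y k)) sums (\<Sum>k<n. wnormsq N h (X k))"
    "\<And>k l. k \<noteq> l \<Longrightarrow> inner_wf N (Y k) (Y l) = 0"
    "\<And>k l. k \<le> l \<Longrightarrow> normsq N (Y l) \<le> normsq N (Y k)"
proof -
  define b where "b = (\<Sum>k<n. E (X k))"
  define adm where "adm h \<longleftrightarrow> h \<in> borel_measurable (cube N) \<and> (\<exists>C. \<forall>x\<in>space (cube N). \<bar>h x\<bar> \<le> C)" for h :: "(nat \<Rightarrow> real) \<Rightarrow> real"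
  \<comment> \<open>Bounded weights \<open>h\<close> of all coordinates stand for the densities.
    Vectors beyond index \<open>n\<close> are null rather than absent, so that members are infinite
    sequences as in \<open>mixture_compactness\<close>.\<close>
  define M where "M = {Y. (\<forall>k. Y k \<in> V) \<and> (\<forall>k\<ge>n. normsq N (Y k) = 0) \<and> (\<Sum>k<n. normsq N (Y k)) = 1
    \<and> (\<Sum>k<n. E (Y k)) \<le> b \<and> (\<forall>h. adm h \<longrightarrow> (\<Sum>k<n. wnormsq N h (Y k)) = (\<Sum>k<n. wnormsq N h (X k)))}"
  define \<Omega> where "\<Omega> Y = (\<Sum>k<n. real (n - k) * normsq N (Y k))" for Y :: "nat \<Rightarrow> wavefn"
  have n0: "0 < n" using X1 by (cases n) auto
  have MV: "Y k \<in> V" if "Y \<in> M" for Y k using that by (simp add: M_def)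
  have Msums: "(\<lambda>k. Q (Y k)) sums (\<Sum>k<n. Q (Y k))" if Y: "Y \<in> M" and Q: "\<And>\<Psi>. \<Psi> \<in> V \<Longrightarrow> \<bar>Q \<Psi>\<bar> \<le> C * normsq N \<Psi>" for Y Q C
  proof (rule sums_finite)
    fix k assume "k \<notin> {..<n}"
    then have "normsq N (Y k) = 0" "Y k \<in> V" using Y by (auto simp: M_def)
    then show "Q (Y k) = 0" using Q[of "Y k"] by simp
  qed simp
  have ME: "(\<Sum>k<K. E (Y k)) \<le> b" if Y: "Y \<in> M" for Y K
  proof -
    have "(\<Sum>k<K. E (Y k)) \<le> (\<Sum>k<max K n. E (Y k))"
      using MV[OF Y] by (intro sum_mono2) (auto intro: energy_nonneg)
    also have "\<dots> = (\<Sum>k<n. E (Y k))"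
    proof (rule sum.mono_neutral_right)
      show "\<forall>i\<in>{..<max K n} - {..<n}. E (Y i) = 0" using Y by (auto simp: M_def intro: energy_zero)
    qed auto
    finally show ?thesis using Y by (simp add: M_def)
  qed
  define X0 where "X0 k = (if k < n then X k else lc 0 (X 0) 0 (X 0))" for k
  have "X0 \<in> M"
    using XV n0 X1 by (auto simp: M_def X0_def b_def intro: Vspace_lc) (simp add: normsq_def lc_def)
  have \<Omega>n: "\<Omega> Y \<le> real n" if Y: "Y \<in> M" for Y
  proof -
    have "\<Omega> Y \<le> (\<Sum>k<n. real n * normsq N (Y k))"
      unfolding \<Omega>_def by (intro sum_mono mult_right_mono normsq_nonneg) auto
    also have "\<dots> = real n" using Y by (simp add: M_def flip: sum_distrib_left)
    finally show ?thesis .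
  qed
  define S where "S = Sup (\<Omega> ` M)"
  have bddO: "bdd_above (\<Omega> ` M)" by (rule bdd_aboveI2) (rule \<Omega>n)
  have \<Omega>S: "\<Omega> Y \<le> S" if "Y \<in> M" for Y unfolding S_def using that bddO by (auto intro: cSup_upper)
  have "\<exists>Y\<in>M. S - 1 / real (Suc j) < \<Omega> Y" for j
  proof -
    have "S - 1 / real (Suc j) < Sup (\<Omega> ` M)" by (simp add: S_def)
    moreover have "\<Omega> ` M \<noteq> {}" using \<open>X0 \<in> M\<close> by blast
    ultimately obtain y where "y \<in> \<Omega> ` M" "S - 1 / real (Suc j) < y" using less_cSupD[of "\<Omega> ` M"] by metis
    then show ?thesis by blast
  qed
  then obtain Z where Z: "\<And>j. Z j \<in> M" "\<And>j. S - 1 / real (Suc j) < \<Omega> (Z j)" by metis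
  have z1: "Z j k \<in> V" for j k using Z(1) MV by blast
  have z2: "(\<lambda>k. normsq N (Z j k)) sums 1" for j
    using Msums[OF Z(1), of "normsq N" 1 j] Z(1)[of j] by (simp add: M_def normsq_nonneg)
  have z3: "(\<Sum>k<K. E (Z j k)) \<le> b" for j K by (rule ME[OF Z(1)])
  \<comment> \<open>All weight sits on the first \<open>n\<close> vectors, so the maximizing
    sequence is tight for a trivial reason.\<close>
  have z4: "\<exists>K. \<forall>j. 1 - \<epsilon> \<le> (\<Sum>k<K. normsq N (Z j k))" if "0 < \<epsilon>" for \<epsilon>
    using Z(1) that by (intro exI[of _ n]) (simp add: M_def)
  obtain r Y where r: "strict_mono r" and YV: "\<And>k. Y k \<in> V"
    and YE: "\<And>K. (\<Sum>k<K. E (Y k)) \<le> b"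
    and YQ: "\<And>Q s S C. quadf N Q \<Longrightarrow> (\<And>\<Psi>. \<Psi> \<in> V \<Longrightarrow> \<bar>Q \<Psi>\<bar> \<le> C * normsq N \<Psi>) \<Longrightarrow> (\<And>j. (\<lambda>k. Q (Z j k)) sums s j) \<Longrightarrow> s \<longlonglongrightarrow> S \<Longrightarrow> (\<lambda>k. Q (Y k)) sums S"
    and Yn: "\<And>k. (\<lambda>j. normsq N (Z (r j) k)) \<longlonglongrightarrow> normsq N (Y k)"
  proof (rule mixture_compactness[where X = Z and b = "\<lambda>_. b" and c = b], goal_cases)
    case (5 \<epsilon>)
    show ?case by (rule z4[OF 5(2)])
  next
    case (6 r \<Phi>)
    show ?case by (rule 6(1)[of r \<Phi>]) (fact 6)+
  qed (rule z1 z2 z3 tendsto_const)+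
  have Y0: "normsq N (Y k) = 0" if "n \<le> k" for k
  proof -
    have "normsq N (Z (r j) k) = 0" for j using Z(1)[of "r j"] that by (simp add: M_def)
    then show ?thesis using Yn[of k] LIMSEQ_unique[OF _ tendsto_const] by fastforce
  qed
  have Yfin: "(\<Sum>k<n. Q (Y k)) = q" if "(\<lambda>k. Q (Y k)) sums q" and Q: "\<And>\<Psi>. \<Psi> \<in> V \<Longrightarrow> \<bar>Q \<Psi>\<bar> \<le> C * normsq N \<Psi>" for Q q C
  proof -
    have "(\<lambda>k. Q (Y k)) sums (\<Sum>k<n. Q (Y k))"
    proof (rule sums_finite)
      fix k assume "k \<notin> {..<n}"
      then show "Q (Y k) = 0" using Q[OF YV[of k]] Y0[of k] by simp
    qed simp
    then show ?thesis using that(1) sums_unique2 by blast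
  qed
  have Y1: "(\<lambda>k. normsq N (Y k)) sums 1"
    by (rule YQ[OF quadf_normsq, of 1 "\<lambda>_. 1"])
      (use Msums[OF Z(1), of "normsq N" 1] Z(1) in \<open>auto simp: M_def normsq_nonneg\<close>)
  have Yh: "(\<lambda>k. wnormsq N h (Y k)) sums (\<Sum>k<n. wnormsq N h (X k))"
    if h: "h \<in> borel_measurable (cube N)" "\<And>x. x \<in> space (cube N) \<Longrightarrow> \<bar>h x\<bar> \<le> C" for h C
  proof (rule YQ[OF quadf_wnormsq[OF h], of C "\<lambda>_. \<Sum>k<n. wnormsq N h (X k)"])
    show bd: "\<bar>wnormsq N h \<Psi>\<bar> \<le> C * normsq N \<Psi>" if "\<Psi> \<in> V" for \<Psi>
      by (rule wnormsq_bound[OF Vspace_L2[OF that] h])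
    have "adm h" using h by (auto simp: adm_def)
    then have "(\<Sum>k<n. wnormsq N h (Z j k)) = (\<Sum>k<n. wnormsq N h (X k))" for j
      using Z(1)[of j] by (simp add: M_def)
    then show "(\<lambda>k. wnormsq N h (Z j k)) sums (\<Sum>k<n. wnormsq N h (X k))" for j
      using Msums[OF Z(1) bd, of j] by simp
  qed (assumption | rule tendsto_const)+
  have YM: "Y \<in> M"
    unfolding M_def
  proof (intro CollectI conjI allI impI YV Y0 YE)
    show "(\<Sum>k<n. normsq N (Y k)) = 1" by (rule Yfin[OF Y1, of 1]) (simp add: normsq_nonneg)
    fix h assume "adm h"
    then obtain C where h: "h \<in> borel_measurable (cube N)" "\<And>x. x \<in> space (cube N) \<Longrightarrow> \<bar>h x\<bar> \<le> C"
      unfolding adm_def by blast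
    show "(\<Sum>k<n. wnormsq N h (Y k)) = (\<Sum>k<n. wnormsq N h (X k))"
      by (rule Yfin[OF Yh[OF h], of C]) (auto intro: wnormsq_bound[OF Vspace_L2 h])
  qed
  have l1: "(\<lambda>j. \<Omega> (Z (r j))) \<longlonglongrightarrow> \<Omega> Y" unfolding \<Omega>_def by (intro tendsto_intros Yn)
  have l2: "(\<lambda>j. S - 1 / real (Suc (r j))) \<longlonglongrightarrow> S - 0"
    using LIMSEQ_subseq_LIMSEQ[OF LIMSEQ_inverse_real_of_nat r] by (intro tendsto_intros) (simp add: o_def inverse_eq_divide)
  have S\<Omega>: "S - 0 \<le> \<Omega> Y"
    by (rule LIMSEQ_le[OF l2 l1]) (use Z(2) less_imp_le in blast)
  \<comment> \<open>The rotated pair stays admissible and has the same total norm. Moving an amount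
    of squared norm from \<open>l\<close> to the smaller index \<open>k\<close> would raise \<Omega>
    by l - k times that amount.\<close>
  have rot: "normsq N (lc (of_real c) (Y k) (of_real s * u) (Y l)) \<le> normsq N (Y k)"
    if kl: "k < l" "l < n" and u: "cmod u = 1" and cs: "c\<^sup>2 + s\<^sup>2 = 1" for k l u c s
  proof -
    let ?A = "lc (of_real c) (Y k) (of_real s * u) (Y l)" and ?B = "lc (of_real (- s)) (Y k) (of_real c * u) (Y l)"
    define Y' where "Y' = Y(k := ?A, l := ?B)"
    have Q: "(\<Sum>i<n. Q (Y' i)) = (\<Sum>i<n. Q (Y i))" if "quadf N Q" for Q
    proof -
      have "(\<Sum>i<n. Q (Y' i)) - (\<Sum>i<n. Q (Y i)) = (Q (Y' k) - Q (Y k)) + (Q (Y' l) - Q (Y l))"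
        by (rule sum_swap2) (use kl in \<open>auto simp: Y'_def\<close>)
      also have "\<dots> = 0" using quadf_rotation[OF that YV[of k] YV[of l] u cs] kl by (simp add: Y'_def)
      finally show ?thesis by simp
    qed
    have "Y' \<in> M"
      unfolding M_def
    proof (intro CollectI conjI allI impI)
      show "Y' i \<in> V" for i using YV by (auto simp: Y'_def intro: Vspace_lc)
      show "normsq N (Y' i) = 0" if "n \<le> i" for i using that kl Y0 by (simp add: Y'_def)
      show "(\<Sum>i<n. normsq N (Y' i)) = 1" using Q[OF quadf_normsq] YM by (simp add: M_def)
      show "(\<Sum>i<n. E (Y' i)) \<le> b" using Q[OF quadf_energy] YE[of n] by simp
      fix h assume h: "adm h"
      then obtain C where C: "h \<in> borel_measurable (cube N)" "\<And>x. x \<in> space (cube N) \<Longrightarrow> \<bar>h x\<bar> \<le> C"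
        unfolding adm_def by blast
      have "quadf N (wnormsq N h)" by (rule quadf_wnormsq[OF C])
      then show "(\<Sum>i<n. wnormsq N h (Y' i)) = (\<Sum>i<n. wnormsq N h (X i))"
        using Q[of "wnormsq N h"] YM h by (simp add: M_def)
    qed
    then have "\<Omega> Y' \<le> \<Omega> Y" using \<Omega>S[of Y'] S\<Omega> by simp
    moreover have "\<Omega> Y' - \<Omega> Y = (real (n - k) * normsq N (Y' k) - real (n - k) * normsq N (Y k))
      + (real (n - l) * normsq N (Y' l) - real (n - l) * normsq N (Y l))"
      unfolding \<Omega>_def by (rule sum_swap2) (use kl in \<open>auto simp: Y'_def\<close>)
    moreover have "normsq N (Y' l) = normsq N (Y k) + normsq N (Y l) - normsq N (Y' k)"
      using quadf_rotation[OF quadf_normsq YV[of k] YV[of l] u cs] kl by (simp add: Y'_def)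
    ultimately have "(real l - real k) * (normsq N (Y' k) - normsq N (Y k)) \<le> 0"
      using kl by (simp add: of_nat_diff algebra_simps)
    then have "normsq N (Y' k) \<le> normsq N (Y k)" using kl by (simp add: mult_le_0_iff)
    then show ?thesis using kl by (simp add: Y'_def)
  qed
  have YL: "L2 N (Y k)" for k by (rule Vspace_L2[OF YV])
  have dec: "normsq N (Y l) \<le> normsq N (Y k)" if "k \<le> l" for k l
  proof (cases "k < l \<and> l < n")
    case True
    \<comment> \<open>The rotation with c = 0 and s = 1 exchanges the two vectors.\<close>
    then have "normsq N (lc (of_real 0) (Y k) (of_real 1 * 1) (Y l)) \<le> normsq N (Y k)" by (intro rot) auto
    then show ?thesis by (simp add: lc_def)
  next
    case False
    then show ?thesis using that Y0[of l] normsq_nonneg[of N "Y k"] by (cases "k = l") auto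
  qed
  have orth: "inner_wf N (Y k) (Y l) = 0" if "k < l" for k l
  proof (cases "l < n")
    case False
    then show ?thesis using inner_zero_of_normsq_zero[OF YL YL Y0] by simp
  next
    case True
    let ?z = "inner_wf N (Y k) (Y l)"
    define p q where "p = normsq N (Y k)" and "q = normsq N (Y l)"
    show ?thesis
    proof (rule ccontr)
      assume z: "?z \<noteq> 0"
      \<comment> \<open>The phase that makes the cross term real and positive.\<close>
      define u where "u = cnj ?z / of_real (cmod ?z)"
      have u: "cmod u = 1" using z by (simp add: u_def norm_divide)
      have uz: "u * ?z = of_real (cmod ?z)" 
        using z unfolding u_def by (simp add: complex_norm_square[symmetric] mult.commute[of "cnj _"] power2_eq_square)
      \<comment> \<open>The tangent of the rotation angle. Maximality will require 2 |z| \<le> t (p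
        - q), whereas this choice gives t (p - q + 1) = |z|; the summand 1 keeps the denominator
        positive when p = q.\<close>
      define t where "t = cmod ?z / (p - q + 1)"
      have pq: "q \<le> p" using dec[of k l] that by (simp add: p_def q_def)
      have t: "0 < t" using z pq by (simp add: t_def)
      define w where "w = sqrt (1 + t\<^sup>2)"
      have w: "0 < w" "w\<^sup>2 = 1 + t\<^sup>2" unfolding w_def by (auto simp: add_pos_nonneg)
      have w2: "0 < w\<^sup>2" using w(1) by simp
      have "(1 / w)\<^sup>2 + (t / w)\<^sup>2 = (1 + t\<^sup>2) / w\<^sup>2" by (simp add: power_divide add_divide_distrib)
      then have "(1 / w)\<^sup>2 + (t / w)\<^sup>2 = 1" using w(2) w2 by simp
      then have "normsq N (lc (of_real (1 / w)) (Y k) (of_real (t / w) * u) (Y l)) \<le> p"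
        unfolding p_def by (intro rot) (use that True u in auto)
      also have "normsq N (lc (of_real (1 / w)) (Y k) (of_real (t / w) * u) (Y l))
        = (1 / w)\<^sup>2 * p + (t / w)\<^sup>2 * q + 2 * (1 / w * (t / w) * cmod ?z)"
      proof -
        have e: "cnj (of_real (1 / w)) * (of_real (t / w) * u) * ?z = of_real (1 / w * (t / w) * cmod ?z)"
          using uz by (simp add: mult.assoc)
        have c1: "cmod (of_real (1 / w)) = 1 / w" "cmod (of_real (t / w) * u) = t / w"
          using u w(1) t by (simp_all add: norm_mult norm_divide)
        show ?thesis unfolding normsq_lc[OF YL YL] p_def q_def e c1 Re_complex_of_real by simp
      qed
      also have "\<dots> = (p + t\<^sup>2 * q + 2 * t * cmod ?z) / w\<^sup>2"
        by (simp add: power_divide add_divide_distrib power2_eq_square)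
      finally have "p + t\<^sup>2 * q + 2 * t * cmod ?z \<le> p * (1 + t\<^sup>2)"
        unfolding pos_divide_le_eq[OF w2] by (simp only: w(2))
      then have "t * (2 * cmod ?z) \<le> t * (t * (p - q))" by (simp add: algebra_simps power2_eq_square)
      then have "2 * cmod ?z \<le> t * (p - q)" using t by simp
      also have "\<dots> \<le> t * (p - q + 1)" using t by simp
      also have "\<dots> = cmod ?z" using pq by (simp add: t_def)
      finally show False using z by simp
    qed
  qed
  have orth': "inner_wf N (Y k) (Y l) = 0" if "k \<noteq> l" for k l
    using that orth[of k l] orth[of l k] inner_cnj[of N "Y k" "Y l"] by (cases "k < l") auto
  show ?thesis
    by (rule that[of Y]) (fact YV Y1 YE[unfolded b_def] Yh orth' dec)+
qed

end

section \<open>Orthonormal systems in the form domain\<close>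

lemma Vspace_zero: "(\<lambda>_ _. 0) \<in> Vspace N"
proof -
  have L: "L2 N (\<lambda>_ _. 0)" unfolding L2_iff_sqi by (simp add: sqi_zero)
  have "is_pderiv N j (\<lambda>_ _. 0) (\<lambda>_ _. 0)" for j using L by (simp add: is_pderiv_def)
  then show ?thesis using L by (auto simp: Vspace_def H1_def antisym_wf_def)
qed

lemma inner_lc_right:
  assumes "L2 N Z" "L2 N \<Phi>" "L2 N \<Psi>"
  shows "inner_wf N Z (lc a \<Phi> b \<Psi>) = a * inner_wf N Z \<Phi> + b * inner_wf N Z \<Psi>"
proof -
  have "((\<lambda>i. a * (cnj (coef N Z i) * coef N \<Phi> i) + b * (cnj (coef N Z i) * coef N \<Psi> i)) has_sum
     (a * inner_wf N Z \<Phi> + b * inner_wf N Z \<Psi>)) (idx N)"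
    by (intro has_sum_add has_sum_cmult_right inner_has_sum assms)
  then have "((\<lambda>i. cnj (coef N Z i) * coef N (lc a \<Phi> b \<Psi>) i) has_sum
     (a * inner_wf N Z \<Phi> + b * inner_wf N Z \<Psi>)) (idx N)"
    by (rule has_sum_cong[THEN iffD1, rotated]) (simp add: coef_lc assms algebra_simps)
  then show ?thesis using inner_has_sum[OF assms(1) L2_lc[OF assms(2,3)]] has_sum_unique by blast
qed

lemma inner_self: "inner_wf N \<Psi> \<Psi> = of_real (normsq N \<Psi>)"
proof -
  have e: "cnj z * z = of_real ((cmod z)\<^sup>2)" for z by (simp only: complex_norm_square mult.commute)
  show ?thesis unfolding inner_wf_def normsq_def by (simp only: e integral_complex_of_real of_real_sum)
qed

text \<open>Combinations are available only for two vectors, through \<open>lc\<close>, so a finite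
  one is assembled by induction. Orthogonality enters the norm alone; inner products and
  coefficients are linear.\<close>

lemma orthogonal_combination:
  assumes "finite A" "\<And>k. k \<in> A \<Longrightarrow> Y k \<in> Vspace N"
    and "\<And>k l. k \<in> A \<Longrightarrow> l \<in> A \<Longrightarrow> k \<noteq> l \<Longrightarrow> inner_wf N (Y k) (Y l) = 0"
  shows "\<exists>v\<in>Vspace N. normsq N v = (\<Sum>k\<in>A. (cmod (b k))\<^sup>2 * normsq N (Y k))
    \<and> (\<forall>Z\<in>Vspace N. inner_wf N Z v = (\<Sum>k\<in>A. b k * inner_wf N Z (Y k)))
    \<and> (\<forall>i\<in>idx N. coef N v i = (\<Sum>k\<in>A. b k * coef N (Y k) i))"
  using assms
proof (induction A rule: finite_induct)
  case empty
  show ?case by (rule bexI[OF _ Vspace_zero]) (simp add: normsq_def inner_wf_def coef_def)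
next
  case (insert j A)
  then obtain v where v: "v \<in> Vspace N" "normsq N v = (\<Sum>k\<in>A. (cmod (b k))\<^sup>2 * normsq N (Y k))"
    "\<And>Z. Z \<in> Vspace N \<Longrightarrow> inner_wf N Z v = (\<Sum>k\<in>A. b k * inner_wf N Z (Y k))"
    "\<And>i. i \<in> idx N \<Longrightarrow> coef N v i = (\<Sum>k\<in>A. b k * coef N (Y k) i)" by auto
  have Yj: "Y j \<in> Vspace N" using insert.prems by auto
  have L: "L2 N v" "L2 N (Y j)" using v Yj by (auto intro: Vspace_L2)
  have "inner_wf N (Y j) v = (\<Sum>k\<in>A. b k * 0)"
    unfolding v(3)[OF Yj]
  proof (intro sum.cong refl)
    fix k assume "k \<in> A"
    then have "inner_wf N (Y j) (Y k) = 0" using insert.prems(2)[of j k] insert.hyps by auto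
    then show "b k * inner_wf N (Y j) (Y k) = b k * 0" by simp
  qed
  then have "inner_wf N v (Y j) = 0" using inner_cnj[of N v "Y j"] by simp
  then show ?case
    using insert.hyps v Yj L
    by (intro bexI[of _ "lc 1 v (b j) (Y j)"])
      (auto simp: normsq_lc coef_lc inner_lc_right Vspace_L2 intro: Vspace_lc)
qed

lemma coef_sq_le: "L2 N v \<Longrightarrow> i \<in> idx N \<Longrightarrow> (cmod (coef N v i))\<^sup>2 \<le> normsq N v"
  using finite_sum_normsq_le[of N v "{i}"] by simp

text \<open>A diagonal entry of a density matrix is at most its largest eigenvalue. The combination
  with coefficients conjugate to those of mode \<open>i\<close> has coefficient S at
  \<open>i\<close>, S being the sum to bound, and squared norm at most S \<mu>; hence S^2 \<le> S
  \<mu>.\<close>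

lemma orthogonal_coef_bound:
  assumes A: "finite A" "\<And>k. k \<in> A \<Longrightarrow> Y k \<in> Vspace N"
    "\<And>k l. k \<in> A \<Longrightarrow> l \<in> A \<Longrightarrow> k \<noteq> l \<Longrightarrow> inner_wf N (Y k) (Y l) = 0"
    and \<mu>: "\<And>k. k \<in> A \<Longrightarrow> normsq N (Y k) \<le> \<mu>" "0 \<le> \<mu>" and i: "i \<in> idx N"
  shows "(\<Sum>k\<in>A. (cmod (coef N (Y k) i))\<^sup>2) \<le> \<mu>"
proof -
  define S where "S = (\<Sum>k\<in>A. (cmod (coef N (Y k) i))\<^sup>2)"
  have "\<exists>v\<in>Vspace N. normsq N v = (\<Sum>k\<in>A. (cmod (cnj (coef N (Y k) i)))\<^sup>2 * normsq N (Y k))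
    \<and> (\<forall>Z\<in>Vspace N. inner_wf N Z v = (\<Sum>k\<in>A. cnj (coef N (Y k) i) * inner_wf N Z (Y k)))
    \<and> (\<forall>j\<in>idx N. coef N v j = (\<Sum>k\<in>A. cnj (coef N (Y k) i) * coef N (Y k) j))"
    by (rule orthogonal_combination) (use A in auto)
  then obtain v where v: "v \<in> Vspace N" "normsq N v = (\<Sum>k\<in>A. (cmod (cnj (coef N (Y k) i)))\<^sup>2 * normsq N (Y k))"
    "coef N v i = (\<Sum>k\<in>A. cnj (coef N (Y k) i) * coef N (Y k) i)"
    using i by blast
  have S0: "0 \<le> S" by (simp add: S_def sum_nonneg)
  have "coef N v i = of_real S" unfolding v(3) S_def by (simp add: complex_norm_square[symmetric] mult.commute)
  then have "S\<^sup>2 \<le> normsq N v" using coef_sq_le[OF Vspace_L2[OF v(1)] i] S0 by simp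
  also have "\<dots> \<le> (\<Sum>k\<in>A. (cmod (coef N (Y k) i))\<^sup>2 * \<mu>)"
    unfolding v(2) by (intro sum_mono mult_mono \<mu>) (auto simp: normsq_nonneg)
  also have "\<dots> = S * \<mu>" by (simp add: S_def sum_distrib_right)
  finally have "S * S \<le> S * \<mu>" by (simp add: power2_eq_square)
  then have "S \<le> \<mu>" using S0 \<mu>(2) by (cases "S = 0") (auto simp: mult_le_cancel_left)
  then show ?thesis by (simp add: S_def)
qed

text \<open>Pythagoras: \<open>w\<close> is the component of \<open>z\<close> orthogonal to the
  span.\<close>

lemma projection_norm:
  assumes A: "finite A" "\<And>k. k \<in> A \<Longrightarrow> Y k \<in> Vspace N"
    "\<And>k l. k \<in> A \<Longrightarrow> l \<in> A \<Longrightarrow> inner_wf N (Y k) (Y l) = (if k = l then 1 else 0)" and z: "z \<in> Vspace N"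
  shows "\<exists>w\<in>Vspace N. normsq N w = normsq N z - (\<Sum>k\<in>A. (cmod (inner_wf N (Y k) z))\<^sup>2) \<and> (\<forall>k\<in>A. inner_wf N (Y k) w = 0)"
proof -
  define b where "b k = inner_wf N (Y k) z" for k
  have n1: "normsq N (Y k) = 1" if "k \<in> A" for k
    using A(3)[OF that that] inner_self[of N "Y k"] by simp
  obtain v where v: "v \<in> Vspace N" "normsq N v = (\<Sum>k\<in>A. (cmod (b k))\<^sup>2 * normsq N (Y k))"
    "\<And>Z. Z \<in> Vspace N \<Longrightarrow> inner_wf N Z v = (\<Sum>k\<in>A. b k * inner_wf N Z (Y k))"
    using orthogonal_combination[of A Y N b] A by auto
  let ?w = "lc 1 z (-1) v"
  have L: "L2 N z" "L2 N v" using z v by (auto intro: Vspace_L2)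
  have "inner_wf N z v = (\<Sum>k\<in>A. b k * cnj (b k))"
    unfolding v(3)[OF z] b_def using inner_cnj[of N z] by simp
  also have "\<dots> = of_real (\<Sum>k\<in>A. (cmod (b k))\<^sup>2)" by (simp add: complex_norm_square[symmetric])
  finally have "normsq N ?w = normsq N z - (\<Sum>k\<in>A. (cmod (b k))\<^sup>2)"
    unfolding normsq_lc[OF L] v(2) by (simp add: n1)
  moreover have "inner_wf N (Y k) ?w = 0" if k: "k \<in> A" for k
  proof -
    have "inner_wf N (Y k) v = (\<Sum>l\<in>A. b l * (if k = l then 1 else 0))"
      unfolding v(3)[OF A(2)[OF k]] using A(3) k by (intro sum.cong) auto
    also have "\<dots> = (\<Sum>l\<in>A. if k = l then b l else 0)" by (intro sum.cong) auto
    also have "\<dots> = b k" using A(1) k by simp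
    finally show ?thesis using A(2)[OF k] L by (simp add: inner_lc_right Vspace_L2 b_def)
  qed
  ultimately show ?thesis unfolding b_def using z v(1) by (blast intro: Vspace_lc)
qed

text \<open>A count of dimensions. By Bessel's inequality each \<open>Y k\<close> has projections of
  total squared length at most 1 onto \<open>card A + 1\<close> vectors of the infinite system; the
  grand total is at most \<open>card A\<close>, so some \<open>X j\<close> is not in the span of the
  given vectors, and its orthogonal part can be normalized.\<close>

lemma orthonormal_extension:
  assumes A: "finite A" "\<And>k. k \<in> A \<Longrightarrow> Y k \<in> Vspace N"
    "\<And>k l. k \<in> A \<Longrightarrow> l \<in> A \<Longrightarrow> inner_wf N (Y k) (Y l) = (if k = l then 1 else 0)"
    and X: "\<And>j::nat. X j \<in> Vspace N" "\<And>j l. inner_wf N (X j) (X l) = (if j = l then 1 else 0)"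
  shows "\<exists>w\<in>Wset N. \<forall>k\<in>A. inner_wf N (Y k) w = 0"
proof -
  let ?J = "{..card A}"
  have "(\<Sum>j\<in>?J. \<Sum>k\<in>A. (cmod (inner_wf N (Y k) (X j)))\<^sup>2) = (\<Sum>k\<in>A. \<Sum>j\<in>?J. (cmod (inner_wf N (Y k) (X j)))\<^sup>2)"
    by (rule sum.swap)
  also have "\<dots> \<le> (\<Sum>k\<in>A. 1)"
  proof (rule sum_mono)
    fix k assume k: "k \<in> A"
    have n1: "normsq N (Y k) = 1" using A(3)[OF k k] inner_self[of N "Y k"] by simp
    have sw: "cmod (inner_wf N (Y k) (X j)) = cmod (inner_wf N (X j) (Y k))" for j
      using inner_cnj[of N "Y k" "X j"] by simp
    show "(\<Sum>j\<in>?J. (cmod (inner_wf N (Y k) (X j)))\<^sup>2) \<le> 1"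
    proof -
      obtain w where "normsq N w = normsq N (Y k) - (\<Sum>j\<in>?J. (cmod (inner_wf N (X j) (Y k)))\<^sup>2)"
        using projection_norm[of ?J X N "Y k", OF _ X(1) X(2) A(2)[OF k]] by auto
      then show ?thesis using normsq_nonneg[of N w] n1 unfolding sw by simp
    qed
  qed
  also have "\<dots> < (\<Sum>j\<in>?J. 1)" by simp
  finally have "\<exists>j\<in>?J. (\<Sum>k\<in>A. (cmod (inner_wf N (Y k) (X j)))\<^sup>2) < 1"
    by (meson not_le sum_mono)
  then obtain j where j: "(\<Sum>k\<in>A. (cmod (inner_wf N (Y k) (X j)))\<^sup>2) < 1" by blast
  have "normsq N (X j) = 1" using X(2)[of j j] inner_self[of N "X j"] by simp
  then obtain w where w: "w \<in> Vspace N" "0 < normsq N w" "\<And>k. k \<in> A \<Longrightarrow> inner_wf N (Y k) w = 0"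
    using projection_norm[OF A X(1)[of j]] j by auto
  let ?w = "lc (of_real (1 / sqrt (normsq N w))) w 0 w"
  have "?w \<in> Wset N" using w quadf_scale[OF quadf_normsq w(1)]
    by (simp add: Wset_def Vspace_lc norm_divide power_divide)
  moreover have "inner_wf N (Y k) ?w = 0" if "k \<in> A" for k
    using w that A(2) by (simp add: inner_lc_right Vspace_L2)
  ultimately show ?thesis by blast
qed

text \<open>\<open>slater_coef j\<close> lists the Fourier coefficients of the Slater determinant of spin-up plane waves with momenta
  \<open>j * N, \<dots>, j * N + N - 1\<close>, which are disjoint sets for distinct \<open>j\<close>.\<close>

context
  fixes N :: nat
begin

definition slater_mode :: "nat \<Rightarrow> nat \<Rightarrow> int" where
  "slater_mode j = (\<lambda>i\<in>{..<N}. int (i + j * N))"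

definition slater_coef :: "nat \<Rightarrow> (nat \<Rightarrow> int) \<times> (nat \<Rightarrow> bool) \<Rightarrow> complex" where
  "slater_coef j i = (\<Sum>p | p permutes {..<N}.
     if fst i = slater_mode j \<circ> p \<and> snd i = (\<lambda>i\<in>{..<N}. True) then of_int (sign p) else 0)"

lemma slater_coef_support:
  assumes "slater_coef j i \<noteq> 0"
  shows "\<exists>p. p permutes {..<N} \<and> i = (slater_mode j \<circ> p, \<lambda>i\<in>{..<N}. True)"
proof (rule ccontr)
  assume *: "\<not> ?thesis"
  have "slater_coef j i = 0" unfolding slater_coef_def
    using * by (intro sum.neutral) (auto simp: prod_eq_iff)
  then show False using assms by simp
qed

text \<open>Only finitely many coefficients are nonzero, so every summability condition is met;
  antisymmetry is the reindexing of the sum over permutations by right composition.\<close>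

lemma slater_exists: "\<exists>\<Psi>\<in>Vspace N. \<forall>i\<in>idx N. coef N \<Psi> i = slater_coef j i"
proof -
  let ?F = "(\<lambda>p. (slater_mode j \<circ> p, \<lambda>i\<in>{..<N}. True)) ` {p. p permutes {..<N}}"
  have F: "finite ?F" by (simp add: finite_permutations)
  have sm: "(\<lambda>i. g i * (cmod (slater_coef j i))\<^sup>2) summable_on idx N" for g
  proof -
    have "(\<lambda>i. g i * (cmod (slater_coef j i))\<^sup>2) summable_on (?F \<inter> idx N)" using F by (intro summable_on_finite) auto
    then show ?thesis
      by (rule summable_on_cong_neutral[THEN iffD1, rotated -1]) (use slater_coef_support in fastforce)+
  qed
  from L2_synthesis[of "slater_coef j" N] sm[of "\<lambda>_. 1"]
  obtain \<Psi> where \<Psi>: "L2 N \<Psi>" "\<And>i. i \<in> idx N \<Longrightarrow> coef N \<Psi> i = slater_coef j i" by auto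
  have "(\<lambda>i. kap N i * (cmod (coef N \<Psi> i))\<^sup>2) summable_on idx N"
    using sm[of "kap N"] by (rule summable_on_cong[THEN iffD1, rotated]) (simp add: \<Psi>)
  then have "H1 N \<Psi>" by (rule H1I[OF \<Psi>(1)])
  moreover have "antisym_wf N \<Psi>"
    unfolding antisym_iff_coef[OF \<Psi>(1)]
  proof (intro allI impI ballI, clarify)
    fix q k s assume q: "q permutes {..<N}" and i: "(k, s) \<in> idx N"
    then have i': "(k \<circ> q, s \<circ> q) \<in> idx N" by (auto simp: idx_def modes_permute spins_permute)
    have s0: "s \<circ> q = (\<lambda>i\<in>{..<N}. True) \<longleftrightarrow> s = (\<lambda>i\<in>{..<N}. True)"
    proof -
      have t: "(\<lambda>i\<in>{..<N}. True) \<circ> q = (\<lambda>i\<in>{..<N}. True)"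
        using permutes_in_image[OF q] by (auto simp: fun_eq_iff restrict_def)
      show ?thesis
      proof
        assume "s \<circ> q = (\<lambda>i\<in>{..<N}. True)"
        then have "s \<circ> q = (\<lambda>i\<in>{..<N}. True) \<circ> q" using t by simp
        then show "s = (\<lambda>i\<in>{..<N}. True)" using permutes_surj[OF q] by (metis fun.map_comp surj_fun_eq surj_iff comp_id)
      qed (use t in simp)
    qed
    have kq: "k \<circ> q = slater_mode j \<circ> (p \<circ> q) \<longleftrightarrow> k = slater_mode j \<circ> p" for p
      using permutes_surj[OF q] by (metis comp_assoc comp_id surj_iff)
    have "slater_coef j (k \<circ> q, s \<circ> q) = (\<Sum>p | p permutes {..<N}.
        if k \<circ> q = slater_mode j \<circ> (p \<circ> q) \<and> s \<circ> q = (\<lambda>i\<in>{..<N}. True) then of_int (sign (p \<circ> q)) else 0)"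
      unfolding slater_coef_def fst_conv snd_conv by (rule sum_permutations_compose_right[OF q])
    also have "\<dots> = (\<Sum>p | p permutes {..<N}. of_int (sign q) *
       (if k = slater_mode j \<circ> p \<and> s = (\<lambda>i\<in>{..<N}. True) then of_int (sign p) else 0))"
    proof (rule sum.cong[OF refl])
      fix p assume "p \<in> {p. p permutes {..<N}}"
      then have "sign (p \<circ> q) = sign p * sign q"
        using q by (intro sign_compose permutation_permutes[THEN iffD2]) auto
      then show "(if k \<circ> q = slater_mode j \<circ> (p \<circ> q) \<and> s \<circ> q = (\<lambda>i\<in>{..<N}. True) then complex_of_int (sign (p \<circ> q)) else 0)
        = of_int (sign q) * (if k = slater_mode j \<circ> p \<and> s = (\<lambda>i\<in>{..<N}. True) then of_int (sign p) else 0)"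
        unfolding s0 kq by simp
    qed
    also have "\<dots> = of_int (sign q) * slater_coef j (k, s)" by (simp add: slater_coef_def sum_distrib_left)
    finally show "coef N \<Psi> (k \<circ> q, s \<circ> q) = of_int (sign q) * coef N \<Psi> (k, s)"
      using \<Psi>(2)[OF i] \<Psi>(2)[OF i'] by simp
  qed
  ultimately show ?thesis using \<Psi> by (auto simp: Vspace_def)
qed

lemma slater_coef_top: "slater_coef j (slater_mode j, \<lambda>i\<in>{..<N}. True) = 1"
proof -
  have "slater_mode j = slater_mode j \<circ> p \<longleftrightarrow> p = id" if p: "p permutes {..<N}" for p
  proof
    assume eq: "slater_mode j = slater_mode j \<circ> p"
    have "p i = i" for i
    proof (cases "i < N")
      case True
      then have "p i < N" using permutes_in_image[OF p, of i] by simp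
      then show ?thesis using fun_cong[OF eq, of i] True by (simp add: slater_mode_def)
    qed (use permutes_not_in[OF p, of i] in simp)
    then show "p = id" by auto
  qed simp
  then have "slater_coef j (slater_mode j, \<lambda>i\<in>{..<N}. True) = (\<Sum>p | p permutes {..<N}. if p = id then 1 else 0)"
    unfolding slater_coef_def by (intro sum.cong) auto
  also have "\<dots> = 1" by (simp add: finite_permutations permutes_id)
  finally show ?thesis .
qed

text \<open>Division by \<open>N\<close> recovers the block number from any momentum of a block, so
  the momentum of particle 0 already separates \<open>j\<close> from \<open>l\<close>.\<close>

lemma slater_coef_disjoint:
  assumes N: "1 \<le> N" and jl: "j \<noteq> l"
  shows "slater_coef j i = 0 \<or> slater_coef l i = 0"
proof (rule ccontr)
  assume "\<not> ?thesis"
  then obtain p q where p: "p permutes {..<N}" "fst i = slater_mode j \<circ> p" and q: "q permutes {..<N}" "fst i = slater_mode l \<circ> q"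
    using slater_coef_support[of j i] slater_coef_support[of l i] by auto
  then have "slater_mode j (p 0) = slater_mode l (q 0)" by (metis comp_apply)
  moreover have "p 0 < N" "q 0 < N" using N permutes_in_image[OF p(1), of 0] permutes_in_image[OF q(1), of 0] by auto
  ultimately have eq: "p 0 + j * N = q 0 + l * N" by (simp add: slater_mode_def flip: of_nat_add of_nat_mult)
  then have "(p 0 + j * N) div N = (q 0 + l * N) div N" by simp
  then show False using \<open>p 0 < N\<close> \<open>q 0 < N\<close> jl by simp
qed

text \<open>Infinite dimensionality of the form domain. It shows that states exist at all, and it
  supplies the vectors that complete a density matrix of finite rank.\<close>

lemma orthonormal_sequence_exists:
  assumes N: "1 \<le> N"
  shows "\<exists>X. (\<forall>j::nat. X j \<in> Vspace N) \<and> (\<forall>j l. inner_wf N (X j) (X l) = (if j = l then 1 else 0))"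
proof -
  obtain Z where Z: "\<And>j. Z j \<in> Vspace N" "\<And>j i. i \<in> idx N \<Longrightarrow> coef N (Z j) i = slater_coef j i"
    using slater_exists by metis
  have ZL: "L2 N (Z j)" for j by (rule Vspace_L2[OF Z(1)])
  have pos: "0 < normsq N (Z j)" for j
  proof -
    have "(slater_mode j, \<lambda>i\<in>{..<N}. True) \<in> idx N" by (auto simp: idx_def modes_def spins_def slater_mode_def)
    then show ?thesis using coef_sq_le[OF ZL[of j], of "(slater_mode j, \<lambda>i\<in>{..<N}. True)"] Z(2) slater_coef_top by simp
  qed
  have orth: "inner_wf N (Z j) (Z l) = 0" if "j \<noteq> l" for j l
  proof -
    have "((\<lambda>i. cnj (coef N (Z j) i) * coef N (Z l) i) has_sum 0) (idx N)"
      by (rule has_sum_0) (use slater_coef_disjoint[OF N that] in \<open>auto simp: Z(2)\<close>)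
    then show ?thesis using inner_has_sum[OF ZL ZL] has_sum_unique by blast
  qed
  define X where "X j = lc (of_real (1 / sqrt (normsq N (Z j)))) (Z j) 0 (Z j)" for j
  have XV: "X j \<in> Vspace N" for j unfolding X_def by (intro Vspace_lc Z)
  have "inner_wf N (X j) (X l) = (if j = l then 1 else 0)" for j l
  proof (cases "j = l")
    case True
    have "normsq N (X l) = 1" unfolding X_def quadf_scale[OF quadf_normsq Z(1)]
      using pos[of l] by (simp add: norm_divide power_divide)
    then show ?thesis using True inner_self[of N "X l"] by simp
  next
    case False
    have "inner_wf N (Z l) (X j) = 0"
      unfolding X_def using orth[of l j] False ZL by (simp add: inner_lc_right)
    then have "inner_wf N (X j) (Z l) = 0" using inner_cnj[of N "X j" "Z l"] by simp
    then show ?thesis using False ZL Vspace_L2[OF XV] unfolding X_def[of l] by (simp add: inner_lc_right)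
  qed
  then show ?thesis using XV by blast
qed

end

text \<open>The trace of a mixture carried by low Fourier modes is spread over boundedly many eigenvectors, because each mode
  contributes at most the largest remaining eigenvalue.\<close>

lemma orthogonal_tightness:
  fixes X :: "nat \<Rightarrow> nat \<Rightarrow> wavefn"
  assumes V: "\<And>n k. X n k \<in> Vspace N" and s: "\<And>n. (\<lambda>k. normsq N (X n k)) sums 1"
    and o: "\<And>n k l. k \<noteq> l \<Longrightarrow> inner_wf N (X n k) (X n l) = 0"
    and dec: "\<And>n k l. k \<le> l \<Longrightarrow> normsq N (X n l) \<le> normsq N (X n k)"
    and kin: "\<And>n K. (\<Sum>k<K. kin N (X n k)) \<le> B" and \<epsilon>: "0 < \<epsilon>"
  shows "\<exists>K. \<forall>n. 1 - \<epsilon> \<le> (\<Sum>k<K. normsq N (X n k))"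
proof -
  have B0: "0 \<le> B" using kin[of 0 0] by simp
  \<comment> \<open>The modes above \<open>M\<close> carry at most B / M \<le> \<epsilon> / 2 of the
    weight; \<open>B + 1\<close> keeps \<open>M\<close> positive when \<open>B\<close> is 0. The
    other half of \<epsilon> is spent on the low modes.\<close>
  define M where "M = 2 * (B + 1) / \<epsilon>"
  have M: "0 < M" using B0 \<epsilon> by (simp add: M_def)
  have "2 * B \<le> \<epsilon> * M" using B0 \<epsilon> by (simp add: M_def)
  then have BM: "B / M \<le> \<epsilon> / 2" using M by (simp add: pos_divide_le_eq)
  define c where "c = card (low N M)"
  obtain K :: nat where K: "2 * real c / \<epsilon> < real K" using reals_Archimedean2 by blast
  have cK: "real c * (1 / real (Suc K)) \<le> \<epsilon> / 2"
  proof -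
    have "2 * real c < real K * \<epsilon>" using K \<epsilon> by (simp add: pos_divide_less_eq)
    also have "\<dots> \<le> real (Suc K) * \<epsilon>" using \<epsilon> by (intro mult_right_mono) auto
    finally have "real c \<le> \<epsilon> / 2 * real (Suc K)" by (simp add: algebra_simps)
    then show ?thesis by (simp add: pos_divide_le_eq)
  qed
  have tail: "(\<Sum>k\<in>{K..<L}. normsq N (X n k)) \<le> \<epsilon>" for n L
  proof -
    \<comment> \<open>The first K + 1 eigenvalues are at least this one and have sum at most
      1.\<close>
    have top: "normsq N (X n K) \<le> 1 / real (Suc K)"
    proof -
      have "real (Suc K) * normsq N (X n K) = (\<Sum>k<Suc K. normsq N (X n K))" by simp
      also have "\<dots> \<le> (\<Sum>k<Suc K. normsq N (X n k))" by (intro sum_mono dec) auto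
      also have "\<dots> \<le> 1" using sum_le_suminf[OF sums_summable[OF s], of "{..<Suc K}" n] sums_unique[OF s, of n] normsq_nonneg by simp
      finally show ?thesis by (simp add: pos_le_divide_eq mult.commute)
    qed
    have "(\<Sum>k\<in>{K..<L}. normsq N (X n k)) \<le> (\<Sum>k\<in>{K..<L}. (\<Sum>i\<in>low N M. (cmod (coef N (X n k) i))\<^sup>2) + kin N (X n k) / M)"
      by (intro sum_mono normsq_le_low Vspace_H1 V M)
    also have "\<dots> = (\<Sum>i\<in>low N M. \<Sum>k\<in>{K..<L}. (cmod (coef N (X n k) i))\<^sup>2) + (\<Sum>k\<in>{K..<L}. kin N (X n k)) / M"
      by (simp add: sum.distrib sum_divide_distrib) (rule sum.swap)
    also have "\<dots> \<le> (\<Sum>i\<in>low N M. 1 / real (Suc K)) + B / M"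
    proof (intro add_mono sum_mono divide_right_mono)
      fix i assume "i \<in> low N M"
      then have i: "i \<in> idx N" by (simp add: low_def)
      show "(\<Sum>k\<in>{K..<L}. (cmod (coef N (X n k) i))\<^sup>2) \<le> 1 / real (Suc K)"
        by (rule orthogonal_coef_bound) (use V o i order_trans[OF dec top] in auto)
    next
      have "(\<Sum>k\<in>{K..<L}. kin N (X n k)) \<le> (\<Sum>k<L. kin N (X n k))"
        by (intro sum_mono2) (auto simp: kin_nonneg)
      then show "(\<Sum>k\<in>{K..<L}. kin N (X n k)) \<le> B" using kin[where K = L and n = n] by linarith
    qed (use M in auto)
    also have "\<dots> \<le> \<epsilon>" using cK BM unfolding sum_constant c_def[symmetric] by linarith
    finally show ?thesis .
  qed
  have "1 - \<epsilon> \<le> (\<Sum>k<K. normsq N (X n k))" for n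
  proof -
    have "(\<lambda>L. \<Sum>k<L. normsq N (X n k)) \<longlonglongrightarrow> 1" using s[of n] by (simp add: sums_def)
    then have "1 \<le> (\<Sum>k<K. normsq N (X n k)) + \<epsilon>"
    proof (rule LIMSEQ_le_const2)
      have "(\<Sum>k<L. normsq N (X n k)) \<le> (\<Sum>k<K. normsq N (X n k)) + \<epsilon>" if "K \<le> L" for L
      proof -
        have "(\<Sum>k<L. normsq N (X n k)) = (\<Sum>k<K. normsq N (X n k)) + (\<Sum>k\<in>{K..<L}. normsq N (X n k))"
          using that by (metis atLeast0LessThan le0 sum.atLeastLessThan_concat)
        then show ?thesis using tail[of n L] by simp
      qed
      then show "\<exists>n0. \<forall>L\<ge>n0. (\<Sum>k<L. normsq N (X n k)) \<le> (\<Sum>k<K. normsq N (X n k)) + \<epsilon>" by blast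
    qed
    then show ?thesis by simp
  qed
  then show ?thesis by blast
qed

section \<open>Densities\<close>

lemma lessThan_eq_insert_0: "1 \<le> (N::nat) \<Longrightarrow> {..<N} = insert 0 {1..<N}"
  by auto

context
  fixes N :: nat and \<Psi> :: wavefn
  assumes N1: "1 \<le> N" and L: "L2 N \<Psi>"
begin

private lemma sq_integrable:
  assumes "s \<in> spins N"
  shows "integrable (PiM (insert 0 {1..<N}) (\<lambda>_. U)) (\<lambda>x. (cmod (\<Psi> x s))\<^sup>2)"
  using sqi_integrable_sq[OF L2D[OF L assms]] by (simp only: cube_def lessThan_eq_insert_0[OF N1])

lemma density_integrable: "integrable U (density N \<Psi>)"
proof -
  have "integrable U (\<lambda>t. \<integral>y. (cmod (\<Psi> (y(0 := t)) s))\<^sup>2 \<partial>PiM {1..<N} (\<lambda>_. U))" if "s \<in> spins N" for s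
    by (rule PU_slices(4)[OF _ _ sq_integrable[OF that]]) auto
  then have "integrable U (\<lambda>t. real N * (\<Sum>s\<in>spins N. \<integral>y. (cmod (\<Psi> (y(0 := t)) s))\<^sup>2 \<partial>PiM {1..<N} (\<lambda>_. U)))"
    by (intro integrable_mult_right Bochner_Integration.integrable_sum) auto
  then show ?thesis by (simp add: density_def[abs_def])
qed

lemma density_nonneg: "0 \<le> density N \<Psi> t"
  by (simp add: density_def sum_nonneg)

text \<open>Fubini turns a tested density into a bounded quadratic form on wave functions, the form
  in which densities enter all arguments on mixtures.\<close>

lemma integral_density_mult:
  fixes \<phi> :: "real \<Rightarrow> real"
  assumes \<phi>: "\<phi> \<in> borel_measurable borel" "\<And>t. \<bar>\<phi> t\<bar> \<le> C"
  shows "(\<integral>t. \<phi> t * density N \<Psi> t \<partial>U) = wnormsq N (\<lambda>x. real N * \<phi> (x 0)) \<Psi>"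
proof -
  let ?P = "PiM {1..<N} (\<lambda>_. U)"
  have m0: "(\<lambda>x. real N * \<phi> (x 0)) \<in> borel_measurable (PiM (insert 0 {1..<N}) (\<lambda>_. U))"
    by (intro borel_measurable_times borel_measurable_const measurable_compose[OF measurable_component_U \<phi>(1)]) simp
  have fi: "integrable (PiM (insert 0 {1..<N}) (\<lambda>_. U)) (\<lambda>x. real N * \<phi> (x 0) * (cmod (\<Psi> x s))\<^sup>2)" if "s \<in> spins N" for s
    by (rule integrable_bounded_mult_real[OF sq_integrable[OF that] m0, of "real N * C"])
      (simp add: abs_mult \<phi> mult_left_mono)
  have eq: "(\<integral>y. real N * \<phi> ((y(0 := t)) 0) * (cmod (\<Psi> (y(0 := t)) s))\<^sup>2 \<partial>?P)
    = real N * \<phi> t * (\<integral>y. (cmod (\<Psi> (y(0 := t)) s))\<^sup>2 \<partial>?P)" for s t by simp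
  have "wnormsq N (\<lambda>x. real N * \<phi> (x 0)) \<Psi> = (\<Sum>s\<in>spins N. \<integral>t. real N * \<phi> t * (\<integral>y. (cmod (\<Psi> (y(0 := t)) s))\<^sup>2 \<partial>?P) \<partial>U)"
    unfolding wnormsq_def cube_def lessThan_eq_insert_0[OF N1]
    by (intro sum.cong refl) (subst PU_slices(6)[OF _ _ fi], auto simp only: eq finite_atLeastLessThan atLeastLessThan_iff)
  also have "\<dots> = (\<integral>t. (\<Sum>s\<in>spins N. real N * \<phi> t * (\<integral>y. (cmod (\<Psi> (y(0 := t)) s))\<^sup>2 \<partial>?P)) \<partial>U)"
  proof (rule Bochner_Integration.integral_sum[symmetric])
    fix s assume s: "s \<in> spins N"
    show "integrable U (\<lambda>t. real N * \<phi> t * (\<integral>y. (cmod (\<Psi> (y(0 := t)) s))\<^sup>2 \<partial>?P))"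
      using PU_slices(4)[OF _ _ fi[OF s]] unfolding eq by simp
  qed
  also have "\<dots> = (\<integral>t. \<phi> t * density N \<Psi> t \<partial>U)"
    by (intro Bochner_Integration.integral_cong) (auto simp: density_def sum_distrib_left algebra_simps)
  finally show ?thesis by simp
qed

end

lemma integral_density:
  assumes "1 \<le> N" "L2 N \<Psi>"
  shows "(\<integral>t. density N \<Psi> t \<partial>U) = real N * normsq N \<Psi>"
  using integral_density_mult[OF assms, of "\<lambda>_. 1" 1]
  by (simp add: wnormsq_def normsq_def sum_distrib_left)

text \<open>The real Fourier basis under a single natural index, so that the penalty can refer to
  its first \<open>n\<close> members: index 2m is the cosine and 2m + 1 the sine of frequency
  m.\<close>

definition testfn :: "nat \<Rightarrow> real \<Rightarrow> real" where
  "testfn a t = (if even a then cos (2 * pi * real (a div 2) * t) else sin (2 * pi * real (a div 2) * t))"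

lemma testfn_measurable: "testfn a \<in> borel_measurable borel"
  unfolding testfn_def[abs_def] by (cases "even a") (auto intro!: borel_measurable_continuous_onI continuous_intros)

lemma testfn_bounded: "\<bar>testfn a t\<bar> \<le> 1"
  by (simp add: testfn_def)

lemma integrable_testfn_mult:
  assumes "integrable U f"
  shows "integrable U (\<lambda>t. testfn a t * f t)"
  by (rule integrable_bounded_mult_real[OF assms borel_measurable_U[OF testfn_measurable]]) (rule testfn_bounded)

lemma testfn_unique:
  fixes f :: "real \<Rightarrow> real"
  assumes f: "integrable U f" and 0: "\<And>a. (\<integral>t. testfn a t * f t \<partial>U) = 0"
  shows "AE t in U. f t = 0"
proof -
  have "AE t in U. complex_of_real (f t) = 0"
  proof (rule fourier_unique_U)
    show "integrable U (\<lambda>t. complex_of_real (f t))" using f by (rule integrable_of_real)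
    fix k :: int
    let ?m = "nat \<bar>k\<bar>"
    \<comment> \<open>The tests are indexed by |k|; the sign of \<open>k\<close> survives as the
      sign of the sine term.\<close>
    define \<sigma> :: complex where "\<sigma> = of_int (sgn k)"
    have cs: "cis (- 2 * pi * of_int k * t) = of_real (testfn (2 * ?m) t) - \<i> * \<sigma> * of_real (testfn (2 * ?m + 1) t)" for t
    proof -
      consider "k > 0" | "k = 0" | "k < 0" by linarith
      then show ?thesis by cases (auto simp: testfn_def \<sigma>_def complex_eq_iff)
    qed
    have i: "integrable U (\<lambda>t. complex_of_real (testfn a t * f t))" for a
      using integrable_testfn_mult[OF f] by (rule integrable_of_real)
    have "(\<integral>t. complex_of_real (f t) * cis (- 2 * pi * of_int k * t) \<partial>U)
      = (\<integral>t. of_real (testfn (2 * ?m) t * f t) - \<i> * \<sigma> * of_real (testfn (2 * ?m + 1) t * f t) \<partial>U)"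
      unfolding cs by (intro Bochner_Integration.integral_cong) (auto simp: algebra_simps)
    also have "\<dots> = of_real (\<integral>t. testfn (2 * ?m) t * f t \<partial>U) - \<i> * \<sigma> * of_real (\<integral>t. testfn (2 * ?m + 1) t * f t \<partial>U)"
      by (simp only: Bochner_Integration.integral_diff i integrable_mult_right integral_mult_right_zero integral_complex_of_real)
    finally show "(\<integral>t. complex_of_real (f t) * cis (- 2 * pi * of_int k * t) \<partial>U) = 0" by (simp add: 0)
  qed
  then show ?thesis by simp
qed

text \<open>Tonelli: the integral of the sum of the norms is finite, so the sum is finite almost
  everywhere.\<close>

lemma AE_summable_norm:
  fixes f :: "nat \<Rightarrow> 'a \<Rightarrow> 'b :: {banach, second_countable_topology}"
  assumes f: "\<And>k. integrable M (f k)" and s: "summable (\<lambda>k. \<integral>x. norm (f k x) \<partial>M)"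
  shows "AE x in M. summable (\<lambda>k. norm (f k x))"
proof -
  have "(\<lambda>x. norm (f k x)) \<in> borel_measurable M" for k
    by (intro borel_measurable_integrable integrable_norm f)
  then have m: "(\<lambda>x. \<Sum>k. ennreal (norm (f k x))) \<in> borel_measurable M" by measurable
  have "(\<integral>\<^sup>+x. (\<Sum>k. ennreal (norm (f k x))) \<partial>M) = (\<Sum>k. \<integral>\<^sup>+x. ennreal (norm (f k x)) \<partial>M)"
    by (intro nn_integral_suminf measurable_compose[OF _ measurable_ennreal] borel_measurable_integrable integrable_norm f)
  also have "\<dots> = (\<Sum>k. ennreal (\<integral>x. norm (f k x) \<partial>M))"
    by (intro suminf_cong nn_integral_eq_integral integrable_norm f) auto
  also have "\<dots> = ennreal (\<Sum>k. \<integral>x. norm (f k x) \<partial>M)" by (rule suminf_ennreal2[OF _ s]) simp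
  finally have fin: "(\<integral>\<^sup>+x. (\<Sum>k. ennreal (norm (f k x))) \<partial>M) \<noteq> \<infinity>" by simp
  show ?thesis using nn_integral_PInf_AE[OF m fin]
  proof eventually_elim
    case (elim x)
    show ?case by (rule summable_suminf_not_top) (use elim in auto)
  qed
qed

section \<open>Finite mixtures almost representing a density\<close>

text \<open>Coordinate 0 and the factor \<open>N\<close> match \<open>density\<close>, so the form
  with this weight is the Fourier coefficient of index \<open>a\<close> of the density.\<close>

definition dtest :: "nat \<Rightarrow> nat \<Rightarrow> (nat \<Rightarrow> real) \<Rightarrow> real" where
  "dtest N a x = real N * testfn a (x 0)"

lemma dtest_measurable: "1 \<le> N \<Longrightarrow> dtest N a \<in> borel_measurable (cube N)"
  unfolding dtest_def[abs_def]
  by (intro borel_measurable_times borel_measurable_const measurable_compose[OF measurable_cube_component testfn_measurable]) simp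

lemma dtest_bounded: "\<bar>dtest N a x\<bar> \<le> real N"
  using testfn_bounded[of a "x 0"] by (simp add: dtest_def abs_mult mult_left_le)

context hamiltonian
begin

lemma integral_testfn_density: "L2 N \<Psi> \<Longrightarrow> (\<integral>t. testfn a t * density N \<Psi> t \<partial>U) = wnormsq N (dtest N a) \<Psi>"
  unfolding dtest_def[abs_def] by (rule integral_density_mult[OF N1 _ testfn_measurable testfn_bounded])

lemma wnormsq_dtest_bound: "L2 N \<Psi> \<Longrightarrow> \<bar>wnormsq N (dtest N a) \<Psi>\<bar> \<le> real N * normsq N \<Psi>"
  by (rule wnormsq_bound[OF _ dtest_measurable[OF N1] dtest_bounded])

lemma quadf_dtest: "quadf N (wnormsq N (dtest N a))"
  by (rule quadf_wnormsq[OF dtest_measurable[OF N1] dtest_bounded])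

text \<open>A near-minimizer of the energy plus \<open>\<alpha>\<close> times the squared deviation of the first \<open>n\<close> Fourier coefficients of the
  density is almost stationary against admixing any pure state. This bounds from below the energy in the
  potential given by the gradient of the penalty.\<close>

lemma penalized_mixture:
  assumes \<rho>: "integrable U \<rho>" and F: "Ffun N W \<rho> \<le> ereal c"
  shows "\<exists>(p::nat) X. (\<forall>k<p. X k \<in> V) \<and> (\<Sum>k<p. normsq N (X k)) = 1
    \<and> (\<Sum>k<p. E (X k)) \<le> c + 1 / real (Suc n)
    \<and> (\<forall>a<n. ((\<Sum>k<p. wnormsq N (dtest N a) (X k)) - (\<integral>t. testfn a t * \<rho> t \<partial>U))\<^sup>2 \<le> (c + 1) / real (Suc n))"
proof -
  define \<alpha> where "\<alpha> = real (Suc n)"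
  define r where "r a = (\<integral>t. testfn a t * \<rho> t \<partial>U)" for a
  define R where "R p X a = (\<Sum>k<p. wnormsq N (dtest N a) (X k))" for p a and X :: "nat \<Rightarrow> wavefn"
  define S :: "(nat \<times> (nat \<Rightarrow> wavefn)) set" where "S = {(p, X). (\<forall>k<p. X k \<in> V) \<and> (\<Sum>k<p. normsq N (X k)) = 1}"
  define J where "J = (\<lambda>(p, X). (\<Sum>k<p. E (X k)) + \<alpha> * (\<Sum>a<n. (R p X a - r a)\<^sup>2))"
  \<comment> \<open>The coefficient of \<open>t\<^sup>2\<close> when weight \<open>t\<close> is
    moved to a pure state: 1 for the tolerance of near-minimality, the rest for the second-order
    part of the penalty. The choice of \<open>t\<close> makes t C at most 1 / \<alpha>.\<close>
  define C where "C = 1 + \<alpha> * real n * (2 * real N)\<^sup>2"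
  define t where "t = 1 / (\<alpha> * C + 1)"
  have \<alpha>: "0 < \<alpha>" by (simp add: \<alpha>_def)
  have C: "1 \<le> C" using \<alpha> by (simp add: C_def)
  then have t: "0 < t" "t < 1" "t * C \<le> 1 / \<alpha>" using \<alpha> by (auto simp: t_def field_simps add_pos_pos)
  have J0: "0 \<le> J G" if "G \<in> S" for G
    using that \<alpha> by (auto simp: S_def J_def intro!: add_nonneg_nonneg sum_nonneg mult_nonneg_nonneg energy_nonneg)
  have bdd: "bdd_below (J ` S)" by (rule bdd_belowI2[of _ 0]) (rule J0)
  obtain X0 where X0: "\<And>j::nat. X0 j \<in> V" "\<And>j l. inner_wf N (X0 j) (X0 l) = (if j = l then 1 else 0)"
    using orthonormal_sequence_exists[OF N1] by blast
  have "normsq N (X0 0) = 1" using X0(2)[of 0 0] inner_self[of N "X0 0"] by simp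
  then have "(1, X0) \<in> S" using X0 by (simp add: S_def)
  then have ne: "J ` S \<noteq> {}" by blast
  \<comment> \<open>The tolerance is quadratic in \<open>t\<close>: after division by
    \<open>t\<close> the first-order inequality has an error of order \<open>t\<close>.\<close>
  have "Inf (J ` S) < Inf (J ` S) + t\<^sup>2" using t by simp
  from cInf_lessD[OF ne this] obtain p X where pX: "(p, X) \<in> S" "J (p, X) < Inf (J ` S) + t\<^sup>2" by auto
  have min: "J (p, X) \<le> J G + t\<^sup>2" if "G \<in> S" for G
    using cInf_lower[OF imageI[OF that] bdd] pX(2) by simp
  have XV: "X k \<in> V" if "k < p" for k using pX that by (simp add: S_def)
  have X1: "(\<Sum>k<p. normsq N (X k)) = 1" using pX by (simp add: S_def)
  define EG where "EG = (\<Sum>k<p. E (X k))"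
  define D where "D a = R p X a - r a" for a
  have RN: "\<bar>R p X a\<bar> \<le> real N" for a
  proof -
    have "\<bar>R p X a\<bar> \<le> (\<Sum>k<p. real N * normsq N (X k))"
      unfolding R_def by (rule order_trans[OF sum_abs sum_mono]) (use XV in \<open>auto intro: wnormsq_dtest_bound Vspace_L2\<close>)
    then show ?thesis using X1 by (simp flip: sum_distrib_left)
  qed
  have pure: "EG + (\<Sum>a<n. 2 * \<alpha> * D a * R p X a) - t * C
      \<le> E \<Psi> + (\<Sum>a<n. 2 * \<alpha> * D a * wnormsq N (dtest N a) \<Psi>)" if \<Psi>: "\<Psi> \<in> Wset N" for \<Psi>
  proof -
    have \<Psi>V: "\<Psi> \<in> V" and \<Psi>1: "normsq N \<Psi> = 1" using \<Psi> by (auto simp: Wset_def)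
    \<comment> \<open>The mixture with weight 1 - t on the old density matrix and \<open>t\<close>
      on \<Psi>, realized by scaling the old vectors and appending one.\<close>
    define X' where "X' k = (if k < p then lc (of_real (sqrt (1 - t))) (X k) 0 (X k) else lc (of_real (sqrt t)) \<Psi> 0 \<Psi>)" for k
    have Q: "(\<Sum>k<Suc p. Q (X' k)) = (1 - t) * (\<Sum>k<p. Q (X k)) + t * Q \<Psi>" if "quadf N Q" for Q
    proof -
      have "(\<Sum>k<p. Q (X' k)) = (\<Sum>k<p. (1 - t) * Q (X k))"
        using t XV by (intro sum.cong) (auto simp: X'_def quadf_scale[OF that])
      then show ?thesis using t by (simp add: X'_def quadf_scale[OF that \<Psi>V] sum_distrib_left)
    qed
    have "(Suc p, X') \<in> S"
      using Q[OF quadf_normsq] X1 \<Psi>1 XV \<Psi>V by (auto simp: S_def X'_def intro: Vspace_lc)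
    then have le: "J (p, X) \<le> J (Suc p, X') + t\<^sup>2" by (rule min)
    define \<Delta> where "\<Delta> a = wnormsq N (dtest N a) \<Psi> - R p X a" for a
    have \<Delta>: "(\<Delta> a)\<^sup>2 \<le> (2 * real N)\<^sup>2" for a
    proof -
      have "\<bar>\<Delta> a\<bar> \<le> 2 * real N"
        using RN[of a] wnormsq_dtest_bound[OF Vspace_L2[OF \<Psi>V], of a] \<Psi>1 by (simp add: \<Delta>_def)
      then have "\<bar>\<Delta> a\<bar>\<^sup>2 \<le> (2 * real N)\<^sup>2" by (rule power_mono) simp
      then show ?thesis by (simp only: power2_abs)
    qed
    have R': "R (Suc p) X' a - r a = D a + t * \<Delta> a" for a
      unfolding R_def Q[OF quadf_dtest] by (simp add: D_def \<Delta>_def R_def algebra_simps)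
    have "J (Suc p, X') = (1 - t) * EG + t * E \<Psi> + \<alpha> * (\<Sum>a<n. (D a + t * \<Delta> a)\<^sup>2)"
      unfolding J_def using Q[OF quadf_energy] R' by (simp add: EG_def)
    also have "(\<Sum>a<n. (D a + t * \<Delta> a)\<^sup>2) \<le> (\<Sum>a<n. (D a)\<^sup>2 + 2 * t * D a * \<Delta> a + t\<^sup>2 * (2 * real N)\<^sup>2)"
    proof (rule sum_mono)
      fix a
      have "t\<^sup>2 * (\<Delta> a)\<^sup>2 \<le> t\<^sup>2 * (2 * real N)\<^sup>2" by (intro mult_left_mono \<Delta>) simp
      then show "(D a + t * \<Delta> a)\<^sup>2 \<le> (D a)\<^sup>2 + 2 * t * D a * \<Delta> a + t\<^sup>2 * (2 * real N)\<^sup>2"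
        by (simp add: power2_sum power_mult_distrib algebra_simps)
    qed
    finally have "J (Suc p, X') \<le> (1 - t) * EG + t * E \<Psi> + \<alpha> * (\<Sum>a<n. (D a)\<^sup>2 + 2 * t * D a * \<Delta> a + t\<^sup>2 * (2 * real N)\<^sup>2)"
      using \<alpha> by simp
    also have "(\<Sum>a<n. (D a)\<^sup>2 + 2 * t * D a * \<Delta> a + t\<^sup>2 * (2 * real N)\<^sup>2)
      = (\<Sum>a<n. (D a)\<^sup>2) + 2 * t * (\<Sum>a<n. D a * \<Delta> a) + real n * (t\<^sup>2 * (2 * real N)\<^sup>2)"
      by (simp add: sum.distrib sum_distrib_left algebra_simps)
    finally have "EG + \<alpha> * (\<Sum>a<n. (D a)\<^sup>2) \<le> (1 - t) * EG + t * E \<Psi>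
      + \<alpha> * ((\<Sum>a<n. (D a)\<^sup>2) + 2 * t * (\<Sum>a<n. D a * \<Delta> a) + real n * (t\<^sup>2 * (2 * real N)\<^sup>2)) + t\<^sup>2"
      using le by (simp add: J_def EG_def D_def)
    then have "t * EG \<le> t * (E \<Psi> + 2 * \<alpha> * (\<Sum>a<n. D a * \<Delta> a) + t * C)"
      by (simp add: C_def power2_eq_square algebra_simps)
    then have "EG \<le> E \<Psi> + 2 * \<alpha> * (\<Sum>a<n. D a * \<Delta> a) + t * C" using t(1) by simp
    moreover have "2 * \<alpha> * (\<Sum>a<n. D a * \<Delta> a) = (\<Sum>a<n. 2 * \<alpha> * D a * wnormsq N (dtest N a) \<Psi>) - (\<Sum>a<n. 2 * \<alpha> * D a * R p X a)"
      by (simp add: \<Delta>_def sum_distrib_left sum_subtractf[symmetric] algebra_simps)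
    ultimately show ?thesis by linarith
  qed
  define f where "f s = (\<Sum>a<n. 2 * \<alpha> * D a * testfn a s)" for s
  have fm: "f \<in> borel_measurable U" unfolding f_def[abs_def]
    by (intro borel_measurable_sum borel_measurable_times borel_measurable_const borel_measurable_U testfn_measurable)
  have fb: "\<bar>f s\<bar> \<le> (\<Sum>a<n. \<bar>2 * \<alpha> * D a\<bar>)" for s
  proof -
    have "\<bar>f s\<bar> \<le> (\<Sum>a<n. \<bar>2 * \<alpha> * D a * testfn a s\<bar>)" unfolding f_def by (rule sum_abs)
    also have "\<dots> \<le> (\<Sum>a<n. \<bar>2 * \<alpha> * D a\<bar>)"
      using testfn_bounded by (intro sum_mono) (simp add: abs_mult mult_left_le)
    finally show ?thesis .
  qed
  have "integrable U (\<lambda>s. (f s)\<^sup>2)"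
  proof (rule U.integrable_const_bound[of _ "(\<Sum>a<n. \<bar>2 * \<alpha> * D a\<bar>)\<^sup>2"])
    show "AE x in U. norm ((f x)\<^sup>2) \<le> (\<Sum>a<n. \<bar>2 * \<alpha> * D a\<bar>)\<^sup>2"
      using power_mono[OF fb abs_ge_zero, of _ 2] by simp
  qed (use fm in simp)
  then have fL: "L2T f" using fm by (simp add: L2T_def)
  \<comment> \<open>Without a gradient part the pairing involves only Fourier coefficients, so it is
    computed for every integrable function.\<close>
  let ?v = "(f, \<lambda>_. 0::real)"
  have vL: "?v \<in> {v. L2T (fst v) \<and> L2T (snd v)}" using fL by (simp add: L2T_def)
  have pair: "pairing ?v g = (\<Sum>a<n. 2 * \<alpha> * D a * (\<integral>s. testfn a s * g s \<partial>U))" if "integrable U g" for g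
  proof -
    have "pairing ?v g = (\<integral>s. (\<Sum>a<n. 2 * \<alpha> * D a * (testfn a s * g s)) \<partial>U)"
      by (simp add: pairing_def f_def sum_distrib_right mult.assoc)
    also have "\<dots> = (\<Sum>a<n. 2 * \<alpha> * D a * (\<integral>s. testfn a s * g s \<partial>U))"
      by (subst Bochner_Integration.integral_sum) (auto intro!: integrable_mult_right integrable_testfn_mult that)
    finally show ?thesis .
  qed
  have "ereal (EG + (\<Sum>a<n. 2 * \<alpha> * D a * R p X a) - t * C) \<le> Efun N W ?v"
    unfolding Efun_def
  proof (rule INF_greatest)
    fix \<Psi> assume \<Psi>: "\<Psi> \<in> Wset N"
    then have L: "L2 N \<Psi>" by (auto simp: Wset_def intro: Vspace_L2)
    have "pairing ?v (density N \<Psi>) = (\<Sum>a<n. 2 * \<alpha> * D a * wnormsq N (dtest N a) \<Psi>)"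
      unfolding pair[OF density_integrable[OF N1 L]] integral_testfn_density[OF L] ..
    then show "ereal (EG + (\<Sum>a<n. 2 * \<alpha> * D a * R p X a) - t * C) \<le> ereal (E \<Psi> + pairing ?v (density N \<Psi>))"
      using pure[OF \<Psi>] by simp
  qed
  then have "ereal (EG + (\<Sum>a<n. 2 * \<alpha> * D a * R p X a) - t * C) - ereal (pairing ?v \<rho>) \<le> Efun N W ?v - ereal (pairing ?v \<rho>)"
    by (rule ereal_minus_mono) simp
  also have "\<dots> \<le> Ffun N W \<rho>" unfolding Ffun_def using vL by (intro SUP_upper)
  also have "\<dots> \<le> ereal c" by (rule F)
  finally have "EG + (\<Sum>a<n. 2 * \<alpha> * D a * R p X a) - t * C - (\<Sum>a<n. 2 * \<alpha> * D a * r a) \<le> c"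
    unfolding pair[OF \<rho>] r_def by simp
  \<comment> \<open>The potential is weighted by the deviation itself, so its expectation minus its
    pairing with \<rho> is 2 \<alpha> times the sum of the squared deviations. A single inequality
    then bounds energy and deviation together.\<close>
  moreover have "(\<Sum>a<n. 2 * \<alpha> * D a * R p X a) - (\<Sum>a<n. 2 * \<alpha> * D a * r a) = 2 * \<alpha> * (\<Sum>a<n. (D a)\<^sup>2)"
    unfolding D_def by (simp add: sum_distrib_left sum_subtractf[symmetric] power2_eq_square algebra_simps)
  ultimately have main: "EG + 2 * \<alpha> * (\<Sum>a<n. (D a)\<^sup>2) \<le> c + 1 / \<alpha>" using t(3) by linarith
  have D0: "0 \<le> (\<Sum>a<n. (D a)\<^sup>2)" by (simp add: sum_nonneg)
  have EG0: "0 \<le> EG" unfolding EG_def by (intro sum_nonneg energy_nonneg XV) auto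
  have "EG \<le> c + 1 / real (Suc n)" using main D0 \<alpha> unfolding \<alpha>_def[symmetric] by (smt (verit) mult_nonneg_nonneg)
  moreover have "(D a)\<^sup>2 \<le> (c + 1) / real (Suc n)" if "a < n" for a
  proof -
    have "1 / \<alpha> \<le> 1" by (simp add: \<alpha>_def)
    then have "2 * (\<alpha> * (\<Sum>a<n. (D a)\<^sup>2)) \<le> c + 1" using main EG0 by linarith
    moreover have "0 \<le> \<alpha> * (\<Sum>a<n. (D a)\<^sup>2)" using D0 \<alpha> by simp
    ultimately have "(\<Sum>a<n. (D a)\<^sup>2) * \<alpha> \<le> c + 1" by (simp add: mult.commute)
    moreover have "(D a)\<^sup>2 \<le> (\<Sum>a<n. (D a)\<^sup>2)" using that by (intro member_le_sum) auto
    ultimately have "(D a)\<^sup>2 * \<alpha> \<le> c + 1" using \<alpha> by (meson mult_right_mono less_imp_le order_trans)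
    then show ?thesis using \<alpha> unfolding \<alpha>_def[symmetric] by (simp add: pos_le_divide_eq)
  qed
  ultimately show ?thesis using XV X1 unfolding EG_def D_def R_def r_def
    by (intro exI[of _ p] exI[of _ X]) (simp del: of_nat_Suc)
qed

end

section \<open>The density-matrix functional is bounded by the Legendre transform\<close>

context hamiltonian
begin

text \<open>Orthogonality amounts to additivity of the squared norm of \<Phi> + b \<Psi> for b = 1
  and b = i. Norms converge under bounded kinetic energy, so additivity passes to the limit.\<close>

lemma orthogonal_limit:
  assumes V: "\<And>n. X n \<in> V" "\<And>n. Y n \<in> V" "\<Phi> \<in> V" "\<Psi> \<in> V"
    and kin: "\<And>n. kin N (X n) \<le> B" "\<And>n. kin N (Y n) \<le> B"
    and lim: "\<And>i. i \<in> idx N \<Longrightarrow> (\<lambda>n. coef N (X n) i) \<longlonglongrightarrow> coef N \<Phi> i"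
      "\<And>i. i \<in> idx N \<Longrightarrow> (\<lambda>n. coef N (Y n) i) \<longlonglongrightarrow> coef N \<Psi> i"
    and nrm: "(\<lambda>n. normsq N (X n)) \<longlonglongrightarrow> normsq N \<Phi>" "(\<lambda>n. normsq N (Y n)) \<longlonglongrightarrow> normsq N \<Psi>"
    and o: "\<And>n. inner_wf N (X n) (Y n) = 0"
  shows "inner_wf N \<Phi> \<Psi> = 0"
proof -
  note L = V[THEN Vspace_L2]
  have "Re (b * inner_wf N \<Phi> \<Psi>) = 0" if b: "cmod b = 1" for b
  proof -
    have kb: "kin N (lc 1 (X n) b (Y n)) \<le> 4 * B" for n
    proof -
      have "kin N (lc 1 (X n) b (Y n)) + kin N (lc (of_real (- 1)) (X n) (of_real 0 * b) (Y n)) \<ge> kin N (lc 1 (X n) b (Y n))"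
        by (simp add: kin_nonneg)
      have Yb: "lc b (Y n) 0 (Y n) \<in> V" by (intro Vspace_lc V)
      have e: "lc 1 (X n) b (Y n) = lc 1 (X n) (of_real 1) (lc b (Y n) 0 (Y n))" by (simp add: lc_def)
      have "kin N (lc 1 (X n) b (Y n)) \<le> (1 + 1) * kin N (X n) + (1 + 1 / 1) * 1\<^sup>2 * kin N (lc b (Y n) 0 (Y n))"
        unfolding e by (rule quadf_triangle[OF quadf_kin V(1) Yb]) (auto simp: kin_nonneg)
      then show ?thesis using kin(1)[of n] kin(2)[of n] b quadf_scale[OF quadf_kin V(2)] by simp
    qed
    have "(\<lambda>n. normsq N (lc 1 (X n) b (Y n))) \<longlonglongrightarrow> normsq N (lc 1 \<Phi> b \<Psi>)"
    proof (rule quadf_convergence[OF quadf_normsq, of _ 1 "\<lambda>n. lc 1 (X n) b (Y n)" _ "4 * B"])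
      show "(\<lambda>n. coef N (lc 1 (X n) b (Y n)) i) \<longlonglongrightarrow> coef N (lc 1 \<Phi> b \<Psi>) i" if i: "i \<in> idx N" for i
        unfolding coef_lc[OF L(1,2) i] coef_lc[OF L(3,4) i] by (intro tendsto_intros lim i)
    qed (use V kb in \<open>auto simp: normsq_nonneg intro: Vspace_lc\<close>)
    then have "(\<lambda>n. normsq N (X n) + normsq N (Y n)) \<longlonglongrightarrow> normsq N (lc 1 \<Phi> b \<Psi>)"
      unfolding normsq_lc[OF L(1,2)] o using b by simp
    moreover have "(\<lambda>n. normsq N (X n) + normsq N (Y n)) \<longlonglongrightarrow> normsq N \<Phi> + normsq N \<Psi>"
      by (intro tendsto_add nrm)
    ultimately have "normsq N (lc 1 \<Phi> b \<Psi>) = normsq N \<Phi> + normsq N \<Psi>" by (rule LIMSEQ_unique)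
    then show ?thesis unfolding normsq_lc[OF L(3,4)] using b by simp
  qed
  from this[of 1] this[of \<i>] show ?thesis by (simp add: complex_eq_iff)
qed

text \<open>\<open>dm_reps\<close> asks for an infinite orthonormal sequence even if the density matrix has finite rank.\<close>

lemma orthonormal_completion:
  fixes \<Phi> :: "nat \<Rightarrow> wavefn"
  assumes V: "\<And>k. \<Phi> k \<in> V" and o: "\<And>k l. k \<noteq> l \<Longrightarrow> inner_wf N (\<Phi> k) (\<Phi> l) = 0"
    and dec: "\<And>k l. k \<le> l \<Longrightarrow> normsq N (\<Phi> l) \<le> normsq N (\<Phi> k)"
  shows "\<exists>\<Psi>. (\<forall>k. \<Psi> k \<in> Wset N) \<and> (\<forall>k l. k \<noteq> l \<longrightarrow> inner_wf N (\<Psi> k) (\<Psi> l) = 0)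
    \<and> (\<forall>k. 0 < normsq N (\<Phi> k) \<longrightarrow> \<Psi> k = lc (of_real (1 / sqrt (normsq N (\<Phi> k)))) (\<Phi> k) 0 (\<Phi> k))"
proof -
  define u where "u k = lc (of_real (1 / sqrt (normsq N (\<Phi> k)))) (\<Phi> k) 0 (\<Phi> k)" for k
  define P where "P f k w \<longleftrightarrow> w \<in> Wset N \<and> (\<forall>l<k. inner_wf N (f l) w = 0) \<and> (0 < normsq N (\<Phi> k) \<longrightarrow> w = u k)"
    for f :: "nat \<Rightarrow> wavefn" and k :: nat and w
  obtain X0 where X0: "\<And>j::nat. X0 j \<in> V" "\<And>j l. inner_wf N (X0 j) (X0 l) = (if j = l then 1 else 0)"
    using orthonormal_sequence_exists[OF N1] by blast
  have "\<exists>\<Psi>. \<forall>k. P \<Psi> k (\<Psi> k)"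
  \<comment> \<open>The vectors are chosen recursively: the normalized \<Phi> k where it is nonzero,
    any unit vector orthogonal to the earlier choices otherwise.\<close>
  proof (rule dependent_wellorder_choice)
    show "P f x r = P g x r" if "\<And>y. y < x \<Longrightarrow> f y = g y" for r f g and x :: nat
      using that by (simp add: P_def)
    fix k :: nat and f assume f: "\<And>l. l < k \<Longrightarrow> P f l (f l)"
    have fV: "f l \<in> V" "normsq N (f l) = 1" if "l < k" for l using f[OF that] by (auto simp: P_def Wset_def)
    have fo: "inner_wf N (f l) (f m) = (if l = m then 1 else 0)" if "l < k" "m < k" for l m
    proof -
      consider "l < m" | "l = m" | "m < l" by linarith
      then show ?thesis
      proof cases
        case 1
        then show ?thesis using f[OF that(2)] by (simp add: P_def)
      next
        case 2
        then show ?thesis using fV that inner_self[of N "f m"] by simp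
      next
        case 3
        then have "inner_wf N (f m) (f l) = 0" using f[OF that(1)] by (simp add: P_def)
        then show ?thesis using 3 inner_cnj[of N "f l" "f m"] by simp
      qed
    qed
    show "\<exists>w. P f k w"
    proof (cases "0 < normsq N (\<Phi> k)")
      case False
      obtain w where "w \<in> Wset N" "\<forall>l\<in>{..<k}. inner_wf N (f l) w = 0"
        using orthonormal_extension[of "{..<k}" f N X0] fV fo X0 by auto
      then show ?thesis using False by (auto simp: P_def)
    next
      case True
      have "inner_wf N (f l) (u k) = 0" if l: "l < k" for l
      proof -
        \<comment> \<open>Norms decrease, so all filler vectors come after the nonzero \<Phi> k; no
          earlier choice can conflict with a prescribed vector.\<close>
        have "0 < normsq N (\<Phi> l)" using dec[of l k] l True by linarith
        then have fl: "f l = u l" using f[OF l] by (simp add: P_def)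
        have "inner_wf N (\<Phi> k) (\<Phi> l) = 0" using o[of k l] l by simp
        then have "inner_wf N (\<Phi> k) (u l) = 0" unfolding u_def using V by (simp add: inner_lc_right Vspace_L2)
        then have "inner_wf N (u l) (\<Phi> k) = 0" using inner_cnj[of N "u l" "\<Phi> k"] by simp
        then show ?thesis unfolding fl u_def[of k] using V fV[OF l] fl by (simp add: inner_lc_right Vspace_L2)
      qed
      moreover have "u k \<in> Wset N" unfolding u_def by (rule normalize_in_Wset[OF V True])
      ultimately show ?thesis by (auto simp: P_def)
    qed
  qed
  then obtain \<Psi> where \<Psi>: "\<And>k. P \<Psi> k (\<Psi> k)" by blast
  have "inner_wf N (\<Psi> k) (\<Psi> l) = 0" if "k \<noteq> l" for k l
  proof (cases "k < l")
    case True
    then show ?thesis using \<Psi>[of l] by (simp add: P_def)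
  next
    case False
    then have "inner_wf N (\<Psi> l) (\<Psi> k) = 0" using \<Psi>[of k] that by (simp add: P_def)
    then show ?thesis using inner_cnj[of N "\<Psi> k" "\<Psi> l"] by simp
  qed
  then show ?thesis using \<Psi> unfolding P_def u_def by blast
qed

text \<open>The limit vectors are unnormalized, with eigenvalues \<open>lam k\<close> as squared
  norms. Their densities have total Fourier coefficients equal to those of \<rho>, and uniqueness of
  coefficients turns this into the pointwise sum demanded by \<open>dm_reps\<close>.\<close>

theorem F_DM_le:
  assumes \<rho>: "integrable U \<rho>" and F: "Ffun N W \<rho> \<le> ereal c"
  shows "F_DM N W \<rho> \<le> ereal c"
proof -
  define r where "r a = (\<integral>t. testfn a t * \<rho> t \<partial>U)" for a
  have "\<exists>Y. (\<forall>k. Y k \<in> V) \<and> (\<lambda>k. normsq N (Y k)) sums 1 \<and> (\<forall>K. (\<Sum>k<K. E (Y k)) \<le> c + 1 / real (Suc n))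
    \<and> (\<forall>a. \<exists>q. (\<lambda>k. wnormsq N (dtest N a) (Y k)) sums q \<and> (a < n \<longrightarrow> (q - r a)\<^sup>2 \<le> (c + 1) / real (Suc n)))
    \<and> (\<forall>k l. k \<noteq> l \<longrightarrow> inner_wf N (Y k) (Y l) = 0) \<and> (\<forall>k l. k \<le> l \<longrightarrow> normsq N (Y l) \<le> normsq N (Y k))" for n
  proof -
    obtain p :: nat and X where X: "\<And>k. k < p \<Longrightarrow> X k \<in> V" "(\<Sum>k<p. normsq N (X k)) = 1"
      "(\<Sum>k<p. E (X k)) \<le> c + 1 / real (Suc n)"
      "\<And>a. a < n \<Longrightarrow> ((\<Sum>k<p. wnormsq N (dtest N a) (X k)) - r a)\<^sup>2 \<le> (c + 1) / real (Suc n)"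
      using penalized_mixture[OF \<rho> F, of n] unfolding r_def by blast
    show ?thesis
    proof (rule orthogonal_mixture[of p X], goal_cases)
      case (3 Y)
      have "(\<lambda>k. wnormsq N (dtest N a) (Y k)) sums (\<Sum>k<p. wnormsq N (dtest N a) (X k))" for a
        by (rule 3(4)[OF dtest_measurable[OF N1] dtest_bounded])
      then have w: "\<forall>a. \<exists>q. (\<lambda>k. wnormsq N (dtest N a) (Y k)) sums q \<and> (a < n \<longrightarrow> (q - r a)\<^sup>2 \<le> (c + 1) / real (Suc n))"
        using X(4) by blast
      have e: "\<forall>K. (\<Sum>k<K. E (Y k)) \<le> c + 1 / real (Suc n)" using 3(3) X(3) order_trans by blast
      show ?case
        by (intro exI[of _ Y] conjI e w) (use 3 in auto)
    qed (use X in auto)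
  qed
  then obtain Y where YV: "\<And>n k. Y n k \<in> V" and Y1: "\<And>n. (\<lambda>k. normsq N (Y n k)) sums 1"
    and YE: "\<And>n K. (\<Sum>k<K. E (Y n k)) \<le> c + 1 / real (Suc n)"
    and Yq: "\<And>n a. \<exists>q. (\<lambda>k. wnormsq N (dtest N a) (Y n k)) sums q \<and> (a < n \<longrightarrow> (q - r a)\<^sup>2 \<le> (c + 1) / real (Suc n))"
    and Yo: "\<And>n k l. k \<noteq> l \<Longrightarrow> inner_wf N (Y n k) (Y n l) = 0"
    and Yd: "\<And>n k l. k \<le> l \<Longrightarrow> normsq N (Y n l) \<le> normsq N (Y n k)" 
    by metis
  define q where "q n a = (\<Sum>k. wnormsq N (dtest N a) (Y n k))" for n a
  have q: "(\<lambda>k. wnormsq N (dtest N a) (Y n k)) sums q n a \<and> (a < n \<longrightarrow> (q n a - r a)\<^sup>2 \<le> (c + 1) / real (Suc n))" for n a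
  proof -
    from Yq[where n = n and a = a] obtain z where z: "(\<lambda>k. wnormsq N (dtest N a) (Y n k)) sums z"
      "a < n \<longrightarrow> (z - r a)\<^sup>2 \<le> (c + 1) / real (Suc n)" by blast
    have "z = q n a" unfolding q_def by (rule sums_unique[OF z(1)])
    then show ?thesis using z by blast
  qed
  note q1 = q[THEN conjunct1] and q2 = q[THEN conjunct2, rule_format]
  have inv0: "(\<lambda>n. C / real (Suc n)) \<longlonglongrightarrow> 0" for C :: real
    using tendsto_mult[OF tendsto_const[of C] LIMSEQ_inverse_real_of_nat] by (simp add: divide_inverse)
  have qlim: "(\<lambda>n. q n a) \<longlonglongrightarrow> r a" for a
  proof -
    have "(\<lambda>n. (q n a - r a)\<^sup>2) \<longlonglongrightarrow> 0"
    proof (rule tendsto_sandwich[OF _ _ tendsto_const inv0[of "c + 1"]])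
      show "\<forall>\<^sub>F n in sequentially. (q n a - r a)\<^sup>2 \<le> (c + 1) / real (Suc n)"
        by (rule eventually_mono[OF eventually_gt_at_top[of a]]) (rule q2)
    qed simp
    then have "(\<lambda>n. sqrt ((q n a - r a)\<^sup>2)) \<longlonglongrightarrow> sqrt 0" by (rule tendsto_real_sqrt)
    then have "(\<lambda>n. q n a - r a) \<longlonglongrightarrow> 0" by (simp add: tendsto_rabs_zero_iff)
    then show ?thesis by (simp add: LIM_zero_iff)
  qed
  have blim: "(\<lambda>n. c + 1 / real (Suc n)) \<longlonglongrightarrow> c" using tendsto_add[OF tendsto_const[of c] inv0[of 1]] by simp
  have c0: "0 \<le> c + 1" using YE[of 0 0] by simp
  have tight: "\<exists>K. \<forall>n. 1 - \<epsilon> \<le> (\<Sum>k<K. normsq N (Y n k))" if "0 < \<epsilon>" for \<epsilon>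
  proof (rule orthogonal_tightness[OF YV Y1 Yo Yd _ that])
    fix n K
    have "(\<Sum>k<K. kin N (Y n k)) \<le> (\<Sum>k<K. E (Y n k))" by (intro sum_mono kin_le_energy YV)
    also have "\<dots> \<le> c + 1 / real (Suc n)" by (rule YE)
    also have "\<dots> \<le> c + 1" by simp
    finally show "(\<Sum>k<K. kin N (Y n k)) \<le> c + 1" .
  qed
  obtain s \<Phi> where s: "strict_mono s" and \<Phi>V: "\<And>k. \<Phi> k \<in> V"
    and lim: "\<And>k i. i \<in> idx N \<Longrightarrow> (\<lambda>n. coef N (Y (s n) k) i) \<longlonglongrightarrow> coef N (\<Phi> k) i"
    and \<Phi>E: "\<And>K. (\<Sum>k<K. E (\<Phi> k)) \<le> c"
    and \<Phi>Q: "\<And>Q s S C. quadf N Q \<Longrightarrow> (\<And>\<Psi>. \<Psi> \<in> V \<Longrightarrow> \<bar>Q \<Psi>\<bar> \<le> C * normsq N \<Psi>) \<Longrightarrow> (\<And>n. (\<lambda>k. Q (Y n k)) sums s n) \<Longrightarrow> s \<longlonglongrightarrow> S \<Longrightarrow> (\<lambda>k. Q (\<Phi> k)) sums S"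
    and \<Phi>n: "\<And>k. (\<lambda>n. normsq N (Y (s n) k)) \<longlonglongrightarrow> normsq N (\<Phi> k)"
    and kB: "\<exists>B. \<forall>n k. kin N (Y n k) \<le> B"
  proof (rule mixture_compactness[where X = Y and b = "\<lambda>n. c + 1 / real (Suc n)" and c = c], goal_cases)
    case (5 \<epsilon>)
    show ?case by (rule tight[OF 5(2)])
  next
    case (6 r \<Phi>)
    show ?case by (rule 6(1)[of r \<Phi>]) (fact 6)+
  qed (rule YV Y1 YE blim)+
  obtain B where B: "\<And>n k. kin N (Y n k) \<le> B" using kB by blast
  have \<Phi>L: "L2 N (\<Phi> k)" for k by (rule Vspace_L2[OF \<Phi>V])
  define lam where "lam k = normsq N (\<Phi> k)" for k
  have lam0: "0 \<le> lam k" for k by (simp add: lam_def normsq_nonneg)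
  have lam1: "lam sums 1"
    using \<Phi>Q[OF quadf_normsq _ Y1 tendsto_const, of 1] by (simp add: lam_def[abs_def] normsq_nonneg)
  have \<Phi>r: "(\<lambda>k. wnormsq N (dtest N a) (\<Phi> k)) sums r a" for a
    by (rule \<Phi>Q[OF quadf_dtest _ q1 qlim]) (rule wnormsq_dtest_bound[OF Vspace_L2])
  have \<Phi>o: "inner_wf N (\<Phi> k) (\<Phi> l) = 0" if "k \<noteq> l" for k l
    by (rule orthogonal_limit[of "\<lambda>n. Y (s n) k" "\<lambda>n. Y (s n) l" _ _ B])
      (use YV \<Phi>V B lim \<Phi>n Yo[OF that] in auto)
  have \<Phi>d: "normsq N (\<Phi> l) \<le> normsq N (\<Phi> k)" if "k \<le> l" for k l
    by (rule LIMSEQ_le[OF \<Phi>n \<Phi>n]) (use Yd[OF that] in auto)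
  obtain \<Psi> where \<Psi>: "\<And>k. \<Psi> k \<in> Wset N" "\<And>k l. k \<noteq> l \<Longrightarrow> inner_wf N (\<Psi> k) (\<Psi> l) = 0"
    "\<And>k. 0 < lam k \<Longrightarrow> \<Psi> k = lc (of_real (1 / sqrt (lam k))) (\<Phi> k) 0 (\<Phi> k)"
    using orthonormal_completion[of \<Phi>] \<Phi>V \<Phi>o \<Phi>d unfolding lam_def by metis
  have sc: "lam k * (cmod (of_real (1 / sqrt (lam k))))\<^sup>2 = 1" if "0 < lam k" for k
    using that by (simp add: norm_divide power_divide)
  \<comment> \<open>Normalizing \<Phi> k and weighting by \<open>lam k\<close> cancel; a filler
    vector carries weight 0.\<close>
  have \<Psi>Q: "lam k * Q (\<Psi> k) = (if 0 < lam k then Q (\<Phi> k) else 0)" if Q: "quadf N Q" for Q k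
  proof (cases "0 < lam k")
    case True
    have "lam k * Q (\<Psi> k) = (lam k * (cmod (of_real (1 / sqrt (lam k))))\<^sup>2) * Q (\<Phi> k)"
      unfolding \<Psi>(3)[OF True] quadf_scale[OF Q \<Phi>V] by simp
    then show ?thesis using sc[OF True] True by simp
  next
    case False
    then show ?thesis using lam0[of k] by simp
  qed
  have \<Psi>L: "L2 N (\<Psi> k)" for k using \<Psi>(1)[of k] by (auto simp: Wset_def intro: Vspace_L2)
  define g where "g k t = lam k * density N (\<Psi> k) t" for k t
  have gi: "integrable U (g k)" for k
    unfolding g_def[abs_def] by (intro integrable_mult_right density_integrable[OF N1 \<Psi>L])
  have g0: "0 \<le> g k t" for k t using lam0 density_nonneg[OF N1 \<Psi>L] by (simp add: g_def)
  have "(\<lambda>k. real N * lam k) sums (real N * 1)" by (intro sums_mult lam1)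
  moreover have "(\<integral>t. norm (g k t) \<partial>U) = real N * lam k" for k
  proof -
    have "normsq N (\<Psi> k) = 1" using \<Psi>(1) by (simp add: Wset_def)
    then show ?thesis using integral_density[OF N1 \<Psi>L[of k]] g0[of k] by (simp add: g_def)
  qed
  ultimately have "(\<lambda>k. \<integral>t. norm (g k t) \<partial>U) sums (real N * 1)" by (simp only:)
  then have gs: "summable (\<lambda>k. \<integral>t. norm (g k t) \<partial>U)" by (rule sums_summable)
  have gAE: "AE t in U. summable (\<lambda>k. norm (g k t))" by (rule AE_summable_norm[OF gi gs])
  have Gi: "integrable U (\<lambda>t. \<Sum>k. g k t)" by (rule integrable_suminf[OF gi gAE gs])
  \<comment> \<open>Integration term by term, with the integrable majorants |g k|, identifies the
    coefficients of the summed density with the limits \<open>r a\<close>.\<close>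
  have "(\<integral>t. testfn a t * (\<rho> t - (\<Sum>k. g k t)) \<partial>U) = 0" for a
  proof -
    have ti: "integrable U (\<lambda>t. testfn a t * g k t)" for k by (rule integrable_testfn_mult[OF gi])
    have tn: "norm (testfn a t * g k t) \<le> norm (g k t)" for k t
      using testfn_bounded[of a t] by (simp add: abs_mult mult_left_le_one_le)
    have tAE: "AE t in U. summable (\<lambda>k. norm (testfn a t * g k t))"
      using gAE
    proof eventually_elim
      case (elim t)
      show ?case unfolding norm_mult using elim by (rule summable_mult)
    qed
    have ts: "summable (\<lambda>k. \<integral>t. norm (testfn a t * g k t) \<partial>U)"
    proof (rule summable_comparison_test'[where g = "\<lambda>k. \<integral>t. norm (g k t) \<partial>U" and N = 0])
      show "summable (\<lambda>k. \<integral>t. norm (g k t) \<partial>U)" by (rule gs)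
      fix k
      have "(\<integral>t. norm (testfn a t * g k t) \<partial>U) \<le> (\<integral>t. norm (g k t) \<partial>U)"
        by (intro integral_mono integrable_norm ti gi tn)
      then show "norm (\<integral>t. norm (testfn a t * g k t) \<partial>U) \<le> (\<integral>t. norm (g k t) \<partial>U)" by simp
    qed
    have "(\<integral>t. testfn a t * g k t \<partial>U) = wnormsq N (dtest N a) (\<Phi> k)" for k
    proof -
      have "(\<integral>t. testfn a t * g k t \<partial>U) = lam k * wnormsq N (dtest N a) (\<Psi> k)"
        unfolding integral_testfn_density[OF \<Psi>L, symmetric] g_def
        by (subst integral_mult_right_zero[symmetric]) (simp add: algebra_simps)
      moreover have "wnormsq N (dtest N a) (\<Phi> k) = 0" if "\<not> 0 < lam k"
        using wnormsq_dtest_bound[OF \<Phi>L[of k], of a] that lam0[of k] by (simp add: lam_def)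
      ultimately show ?thesis using \<Psi>Q[OF quadf_dtest, of k a] by auto
    qed
    then have "(\<lambda>k. wnormsq N (dtest N a) (\<Phi> k)) sums (\<integral>t. (\<Sum>k. testfn a t * g k t) \<partial>U)"
      using sums_integral[OF ti tAE ts] by (simp only:)
    then have "(\<integral>t. (\<Sum>k. testfn a t * g k t) \<partial>U) = r a"
      using \<Phi>r[of a] by (rule sums_unique2)
    moreover have "(\<integral>t. testfn a t * (\<Sum>k. g k t) \<partial>U) = (\<integral>t. (\<Sum>k. testfn a t * g k t) \<partial>U)"
    proof (rule integral_cong_AE)
      show "(\<lambda>t. testfn a t * (\<Sum>k. g k t)) \<in> borel_measurable U" using integrable_testfn_mult[OF Gi] by auto
      show "(\<lambda>t. \<Sum>k. testfn a t * g k t) \<in> borel_measurable U" using integrable_suminf[OF ti tAE ts] by auto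
      show "AE t in U. testfn a t * (\<Sum>k. g k t) = (\<Sum>k. testfn a t * g k t)"
        using gAE
      proof eventually_elim
        case (elim t)
        have "summable (\<lambda>k. g k t)" using elim by (rule summable_norm_cancel)
        then show ?case by (simp only: suminf_mult)
      qed
    qed
    ultimately show ?thesis
      using integrable_testfn_mult[OF \<rho>, of a] integrable_testfn_mult[OF Gi, of a] by (simp add: right_diff_distrib r_def)
  qed
  then have "AE t in U. \<rho> t - (\<Sum>k. g k t) = 0" using \<rho> Gi by (intro testfn_unique) auto
  then have gsum: "AE t in U. (\<lambda>k. lam k * density N (\<Psi> k) t) sums \<rho> t"
    using gAE
  proof eventually_elim
    case (elim t)
    have "summable (\<lambda>k. g k t)" using elim(2) by (rule summable_norm_cancel)
    then have "(\<lambda>k. g k t) sums (\<Sum>k. g k t)" by (rule summable_sums)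
    then show ?case using elim(1) by (simp add: g_def)
  qed
  have rep: "(lam, \<Psi>) \<in> dm_reps N \<rho>"
    unfolding dm_reps_def using lam0 lam1 \<Psi> gsum by auto
  have WE: "0 \<le> E (\<Psi> k)" for k using \<Psi>(1)[of k] by (auto simp: Wset_def intro: energy_nonneg)
  have "(\<Sum>k. ereal (lam k * E (\<Psi> k))) \<le> ereal c"
  proof (rule suminf_bound)
    show "\<forall>K. (\<Sum>k<K. ereal (lam k * E (\<Psi> k))) \<le> ereal c"
    proof
      fix K
      have "(\<Sum>k<K. lam k * E (\<Psi> k)) \<le> (\<Sum>k<K. E (\<Phi> k))"
        unfolding \<Psi>Q[OF quadf_energy] using energy_nonneg[OF \<Phi>V] by (intro sum_mono) auto
      then show "(\<Sum>k<K. ereal (lam k * E (\<Psi> k))) \<le> ereal c" using \<Phi>E[of K] by simp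
    qed
  qed (use lam0 WE in simp)
  moreover have "F_DM N W \<rho> \<le> (\<Sum>k. ereal (fst (lam, \<Psi>) k * E (snd (lam, \<Psi>) k)))"
    unfolding F_DM_def by (rule INF_lower[OF rep])
  ultimately show ?thesis by simp
qed

end

section \<open>The weak derivative of a density\<close>

lemma cis_U_measurable: "(\<lambda>x. cis (c * x)) \<in> borel_measurable borel"
  by (intro borel_measurable_continuous_onI continuous_intros)

lemma integrable_mult_cis:
  assumes "integrable U f"
  shows "integrable U (\<lambda>x. complex_of_real (f x) * cis (c * x))"
  by (rule integrable_bounded_mult[OF integrable_of_real[OF assms] borel_measurable_U[OF cis_U_measurable], of _ 1]) simp

text \<open>The Fourier coefficient of the indicator of [t,1]; it is the inner integral when a
  primitive is expanded by Fubini.\<close>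

lemma integral_tail_cis:
  assumes "m \<noteq> 0" "t \<in> {0..1}"
  shows "(\<integral>x. indicat_real {t..} x *\<^sub>R cis (- 2 * pi * of_int m * x) \<partial>U)
    = (cis (- 2 * pi * of_int m * t) - 1) / (2 * pi * \<i> * of_int m)"
proof -
  let ?F = "\<lambda>x::real. - cis (- 2 * pi * of_int m * x) / (2 * pi * \<i> * of_int m)"
  have "((\<lambda>x. cis (- 2 * pi * of_int m * x)) has_integral (?F 1 - ?F t)) {t..1}"
  proof (rule fundamental_theorem_of_calculus)
    fix x :: real
    have "((\<lambda>x. cis (- 2 * pi * of_int m * x)) has_vector_derivative ((- 2 * pi * \<i> * of_int m) * cis (- 2 * pi * of_int m * x))) (at x within {t..1})"
      unfolding cis_conv_exp of_real_mult
      by (auto intro!: has_vector_derivative_real_field derivative_eq_intros simp: algebra_simps)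
    then show "(?F has_vector_derivative cis (- 2 * pi * of_int m * x)) (at x within {t..1})"
      using assms by (auto intro!: derivative_eq_intros simp: field_simps)
  qed (use assms in auto)
  moreover have "cis (- 2 * pi * of_int m) = 1"
    using cis_multiple_2pi[of "of_int (- m)"] by (simp add: mult.commute)
  ultimately have hi: "((\<lambda>x. cis (- 2 * pi * of_int m * x)) has_integral ((cis (- 2 * pi * of_int m * t) - 1) / (2 * pi * \<i> * of_int m))) {t..1}"
    by (simp add: diff_divide_distrib)
  have si: "set_integrable lborel {t..1} (\<lambda>x. cis (- 2 * pi * of_int m * x))"
    by (intro borel_integrable_atLeastAtMost' continuous_intros)
  have "(\<integral>x. indicat_real {t..} x *\<^sub>R cis (- 2 * pi * of_int m * x) \<partial>U) = (LINT x:{t..1}|lborel. cis (- 2 * pi * of_int m * x))"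
    unfolding U_def set_lebesgue_integral_def
    by (subst integral_restrict_space) (use assms in \<open>auto simp: indicator_def intro!: Bochner_Integration.integral_cong\<close>)
  also have "\<dots> = integral {t..1} (\<lambda>x. cis (- 2 * pi * of_int m * x))"
    by (rule set_borel_integral_eq_integral(2)[OF si])
  finally show ?thesis using hi by (simp add: integral_unique)
qed

text \<open>A function with an integrable weak derivative agrees almost everywhere with a primitive of it,
  as both have the same Fourier coefficients of nonzero order.\<close>

lemma weak_derivative_bound:
  fixes f d :: "real \<Rightarrow> real"
  assumes f: "integrable U f" and d: "integrable U d"
    and fd: "\<And>m::int. (\<integral>x. complex_of_real (d x) * cis (- 2 * pi * of_int m * x) \<partial>U)
       = 2 * pi * \<i> * of_int m * (\<integral>x. complex_of_real (f x) * cis (- 2 * pi * of_int m * x) \<partial>U)"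
  shows "AE x in U. \<bar>f x\<bar> \<le> (\<integral>x. \<bar>f x\<bar> \<partial>U) + 2 * (\<integral>x. \<bar>d x\<bar> \<partial>U)"
proof -
  interpret UU: pair_sigma_finite U U by unfold_locales
  \<comment> \<open>The primitive of \<open>d\<close> vanishing at 0, written with an indicator in
    both variables so that Fubini applies.\<close>
  define F where "F x = (\<integral>t. indicat_real {t..} x * d t \<partial>U)" for x
  have dm: "d \<in> borel_measurable U" using d by auto
  have m2: "(\<lambda>z. indicat_real {fst z..} (snd z)) \<in> borel_measurable (U \<Otimes>\<^sub>M U)"
  proof -
    have m1: "fst \<in> borel_measurable (U \<Otimes>\<^sub>M U)" "snd \<in> borel_measurable (U \<Otimes>\<^sub>M U)"
      using measurable_compose[OF measurable_fst id_measurable_U] measurable_compose[OF measurable_snd id_measurable_U] by auto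
    have eq: "(\<lambda>z. indicat_real {fst z..} (snd z)) = (\<lambda>z. if fst z \<le> snd z then 1 else 0)"
      by (auto simp: indicator_def)
    show ?thesis unfolding eq by (intro measurable_If borel_measurable_le m1) auto
  qed
  have di: "integrable (U \<Otimes>\<^sub>M U) (\<lambda>(t, x). indicat_real {t..} x * d t)"
  proof (rule Bochner_Integration.integrable_bound)
    show "integrable (U \<Otimes>\<^sub>M U) (\<lambda>z. d (fst z))"
      by (rule integrable_distr[OF measurable_fst[of U U]]) (simp only: U.distr_pair_fst d)
    show "(\<lambda>(t, x). indicat_real {t..} x * d t) \<in> borel_measurable (U \<Otimes>\<^sub>M U)"
      unfolding split_def by (intro borel_measurable_times m2 measurable_compose[OF measurable_fst dm])
    show "AE z in U \<Otimes>\<^sub>M U. norm (case z of (t, x) \<Rightarrow> indicat_real {t..} x * d t) \<le> norm (d (fst z))"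
      by (auto simp: indicator_def)
  qed
  have Fi: "integrable U F" unfolding F_def[abs_def] by (rule UU.integrable_snd[OF di])
  have Fb: "\<bar>F x\<bar> \<le> (\<integral>t. \<bar>d t\<bar> \<partial>U)" for x
  proof -
    have ix: "integrable U (\<lambda>t. indicat_real {t..} x * d t)"
    proof (rule Bochner_Integration.integrable_bound[OF d])
      have "(\<lambda>t. indicat_real {t..} x) = (\<lambda>t. indicat_real {..x} t)" by (auto simp: indicator_def)
      then have "(\<lambda>t. indicat_real {t..} x) \<in> borel_measurable U" by (simp add: borel_measurable_U)
      then show "(\<lambda>t. indicat_real {t..} x * d t) \<in> borel_measurable U" using dm by (rule borel_measurable_times)
    qed (auto simp: indicator_def)
    have "\<bar>F x\<bar> \<le> (\<integral>t. \<bar>indicat_real {t..} x * d t\<bar> \<partial>U)" unfolding F_def by (rule integral_abs_bound)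
    also have "\<dots> \<le> (\<integral>t. \<bar>d t\<bar> \<partial>U)"
      by (rule integral_mono[OF integrable_abs[OF ix] integrable_abs[OF d]]) (simp add: indicator_def)
    finally show ?thesis .
  qed
  \<comment> \<open>The relation at m = 0 says that \<open>d\<close> has mean zero, so its primitive
    is periodic: the constant term of each coefficient drops out.\<close>
  have d0: "(\<integral>t. complex_of_real (d t) \<partial>U) = 0" using fd[of 0] by simp
  have Ff: "(\<integral>x. complex_of_real (F x) * cis (- 2 * pi * of_int m * x) \<partial>U)
     = (\<integral>x. complex_of_real (f x) * cis (- 2 * pi * of_int m * x) \<partial>U)" if m: "m \<noteq> 0" for m :: int
  proof -
    let ?e = "\<lambda>x. cis (- 2 * pi * of_int m * x)"
    have em: "(\<lambda>x. ?e x) \<in> borel_measurable U" by (rule borel_measurable_U[OF cis_U_measurable])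
    have "integrable (U \<Otimes>\<^sub>M U) (\<lambda>z. complex_of_real (case z of (t, x) \<Rightarrow> indicat_real {t..} x * d t) * ?e (snd z))"
      by (rule integrable_bounded_mult[OF integrable_of_real[OF di] measurable_compose[OF measurable_snd em], of 1]) simp
    then have ei: "integrable (U \<Otimes>\<^sub>M U) (\<lambda>(t, x). complex_of_real (indicat_real {t..} x * d t) * ?e x)"
      by (simp only: split_def)
    have "complex_of_real (F x) * ?e x = (\<integral>t. complex_of_real (indicat_real {t..} x * d t) * ?e x \<partial>U)" for x
      unfolding F_def by (simp only: integral_complex_of_real[symmetric] integral_mult_left_zero)
    then have "(\<integral>x. complex_of_real (F x) * ?e x \<partial>U) = (\<integral>x. (\<integral>t. complex_of_real (indicat_real {t..} x * d t) * ?e x \<partial>U) \<partial>U)"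
      by (simp only:)
    also have "\<dots> = (\<integral>t. (\<integral>x. complex_of_real (indicat_real {t..} x * d t) * ?e x \<partial>U) \<partial>U)"
      using UU.Fubini_integral[OF ei] by simp
    also have "\<dots> = (\<integral>t. (complex_of_real (d t) * ?e t - complex_of_real (d t)) / (2 * pi * \<i> * of_int m) \<partial>U)"
    proof (rule Bochner_Integration.integral_cong[OF refl])
      fix t assume "t \<in> space U"
      then have t: "t \<in> {0..1}" by simp
      have "(\<integral>x. complex_of_real (indicat_real {t..} x * d t) * ?e x \<partial>U) = complex_of_real (d t) * (\<integral>x. indicat_real {t..} x *\<^sub>R ?e x \<partial>U)"
        by (subst integral_mult_right_zero[symmetric]) (simp add: scaleR_conv_of_real algebra_simps)
      then show "(\<integral>x. complex_of_real (indicat_real {t..} x * d t) * ?e x \<partial>U)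
        = (complex_of_real (d t) * ?e t - complex_of_real (d t)) / (2 * pi * \<i> * of_int m)"
        unfolding integral_tail_cis[OF m t] by (simp add: right_diff_distrib)
    qed
    also have "\<dots> = ((\<integral>t. complex_of_real (d t) * ?e t \<partial>U) - (\<integral>t. complex_of_real (d t) \<partial>U)) / (2 * pi * \<i> * of_int m)"
      by (simp only: integral_divide_zero Bochner_Integration.integral_diff[OF integrable_mult_cis[OF d] integrable_of_real[OF d]])
    also have "\<dots> = (\<integral>x. complex_of_real (f x) * ?e x \<partial>U)" unfolding d0 fd[of m] using m by simp
    finally show ?thesis .
  qed
  define c where "c = (\<integral>x. f x - F x \<partial>U)"
  have "AE x in U. complex_of_real (f x - F x - c) = 0"
  proof (rule fourier_unique_U)
    show "integrable U (\<lambda>x. complex_of_real (f x - F x - c))"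
      by (intro integrable_of_real Bochner_Integration.integrable_diff f Fi) simp
    fix m :: int
    let ?e = "\<lambda>x. cis (- 2 * pi * of_int m * x)"
    have "(\<integral>x. complex_of_real (f x - F x - c) * ?e x \<partial>U) = (\<integral>x. complex_of_real (f x) * ?e x - complex_of_real (F x) * ?e x - complex_of_real c * ?e x \<partial>U)"
      by (intro Bochner_Integration.integral_cong) (auto simp: algebra_simps)
    also have "\<dots> = (\<integral>x. complex_of_real (f x) * ?e x \<partial>U) - (\<integral>x. complex_of_real (F x) * ?e x \<partial>U) - complex_of_real c * (\<integral>x. ?e x \<partial>U)"
    proof -
      have "integrable U (\<lambda>x. complex_of_real c * ?e x)"
        using integrable_mult_cis[of "\<lambda>_. c" "- 2 * pi * of_int m"] by simp
      then show ?thesis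
        by (simp only: Bochner_Integration.integral_diff integrable_mult_cis f Fi Bochner_Integration.integrable_diff integral_mult_right_zero)
    qed
    also have "\<dots> = 0"
    proof (cases "m = 0")
      case True
      have "(\<integral>x. complex_of_real (f x) \<partial>U) - (\<integral>x. complex_of_real (F x) \<partial>U) = complex_of_real c"
        using f Fi by (simp add: c_def)
      then show ?thesis using True U.prob_space by simp
    next
      case False
      have "(\<integral>x. ?e x \<partial>U) = 0" using integral_U_cis[of "- m"] False by simp
      then show ?thesis using Ff[OF False] by simp
    qed
    finally show "(\<integral>x. complex_of_real (f x - F x - c) * ?e x \<partial>U) = 0" .
  qed
  moreover have "\<bar>c\<bar> \<le> (\<integral>x. \<bar>f x\<bar> \<partial>U) + (\<integral>x. \<bar>d x\<bar> \<partial>U)"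
  proof -
    have "\<bar>c\<bar> \<le> (\<integral>x. \<bar>f x - F x\<bar> \<partial>U)" unfolding c_def by (rule integral_abs_bound)
    also have "\<dots> \<le> (\<integral>x. \<bar>f x\<bar> + (\<integral>t. \<bar>d t\<bar> \<partial>U) \<partial>U)"
    proof (rule integral_mono)
      show "integrable U (\<lambda>x. \<bar>f x - F x\<bar>)" using f Fi by auto
      show "integrable U (\<lambda>x. \<bar>f x\<bar> + (\<integral>t. \<bar>d t\<bar> \<partial>U))" using f by auto
      show "\<bar>f x - F x\<bar> \<le> \<bar>f x\<bar> + (\<integral>t. \<bar>d t\<bar> \<partial>U)" for x using Fb[of x] by linarith
    qed
    also have "\<dots> = (\<integral>x. \<bar>f x\<bar> \<partial>U) + (\<integral>x. \<bar>d x\<bar> \<partial>U)" using f U.prob_space by simp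
    finally show ?thesis .
  qed
  \<comment> \<open>One L1 norm of \<open>d\<close> comes from the primitive and one, together with
    the L1 norm of \<open>f\<close>, from the constant.\<close>
  ultimately show ?thesis
  proof (elim AE_mp, intro AE_I2 impI)
    fix x assume c: "\<bar>c\<bar> \<le> (\<integral>x. \<bar>f x\<bar> \<partial>U) + (\<integral>x. \<bar>d x\<bar> \<partial>U)" and "complex_of_real (f x - F x - c) = 0"
    then have "f x = F x + c" by (simp only: of_real_eq_0_iff; simp)
    then show "\<bar>f x\<bar> \<le> (\<integral>x. \<bar>f x\<bar> \<partial>U) + 2 * (\<integral>x. \<bar>d x\<bar> \<partial>U)" using Fb[of x] c by linarith
  qed
qed

section \<open>Fourier coefficients and derivatives of one-particle densities\<close>

definition slice :: "nat \<Rightarrow> ((nat \<Rightarrow> real) \<Rightarrow> 'b) \<Rightarrow> real \<Rightarrow> 'b :: {banach, second_countable_topology}" where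
  "slice N h t = (\<integral>y. h (y(0 := t)) \<partial>PiM {1..<N} (\<lambda>_. U))"

lemma slice_integral:
  fixes h :: "(nat \<Rightarrow> real) \<Rightarrow> 'b :: {banach, second_countable_topology}"
  assumes "1 \<le> N" "integrable (cube N) h"
  shows "integrable U (slice N h)" "(\<integral>t. slice N h t \<partial>U) = (\<integral>x. h x \<partial>cube N)"
    "AE t in U. integrable (PiM {1..<N} (\<lambda>_. U)) (\<lambda>y. h (y(0 := t)))"
proof -
  have i: "integrable (PiM (insert 0 {1..<N}) (\<lambda>_. U)) h"
    using assms(2) by (simp only: cube_def lessThan_eq_insert_0[OF assms(1)])
  show "integrable U (slice N h)" unfolding slice_def[abs_def] by (rule PU_slices(4)[OF _ _ i]) auto
  show "(\<integral>t. slice N h t \<partial>U) = (\<integral>x. h x \<partial>cube N)"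
    unfolding slice_def cube_def lessThan_eq_insert_0[OF assms(1)] by (rule PU_slices(6)[OF _ _ i, symmetric]) auto
  show "AE t in U. integrable (PiM {1..<N} (\<lambda>_. U)) (\<lambda>y. h (y(0 := t)))" by (rule PU_slices(5)[OF _ _ i]) auto
qed

text \<open>Shifts the momentum of particle 0 by \<open>m\<close>. The Fourier coefficients of a
  density are inner products of a wave function with its twists, which moves the computation to the
  coefficients on the cube.\<close>

definition twist :: "int \<Rightarrow> wavefn \<Rightarrow> wavefn" where
  "twist m \<Psi> = (\<lambda>x s. cis (2 * pi * of_int m * x 0) * \<Psi> x s)"

lemma L2_twist:
  assumes N: "1 \<le> N" and L: "L2 N \<Psi>"
  shows "L2 N (twist m \<Psi>)"
  unfolding L2_iff_sqi twist_def
proof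
  fix s assume s: "s \<in> spins N"
  have "(\<lambda>x. cis (2 * pi * of_int m * x 0)) \<in> borel_measurable (cube N)"
    using measurable_compose[OF measurable_cube_component cis_U_measurable, of 0 N "2 * pi * of_int m"] N by simp
  then show "sqi (cube N) (\<lambda>x. cis (2 * pi * of_int m * x 0) * \<Psi> x s)"
    by (rule sqi_bounded_mult[OF L2D[OF L s], of _ 1]) simp
qed

lemma coef_twist:
  assumes N: "1 \<le> N"
  shows "coef N (twist m \<Psi>) (k, s) = coef N \<Psi> (k(0 := k 0 - m), s)"
proof -
  have "emode N k x = cis (2 * pi * of_int m * x 0) * emode N (k(0 := k 0 - m)) x" for x
  proof -
    have z: "0 \<in> {..<N}" using N by auto
    have "(\<Sum>j<N. of_int (k j) * x j) = of_int (k 0) * x 0 + (\<Sum>j\<in>{..<N} - {0}. of_int (k j) * x j)"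
      by (rule sum.remove[OF _ z]) simp
    moreover have "(\<Sum>j<N. of_int ((k(0 := k 0 - m)) j) * x j) = of_int (k 0 - m) * x 0 + (\<Sum>j\<in>{..<N} - {0}. of_int (k j) * x j)"
      by (subst sum.remove[OF _ z]) simp_all
    ultimately have "(\<Sum>j<N. of_int (k j) * x j) = of_int m * x 0 + (\<Sum>j<N. of_int ((k(0 := k 0 - m)) j) * x j)"
      by (simp add: algebra_simps)
    then show ?thesis unfolding emode_def cis_mult by (simp add: algebra_simps)
  qed
  then have "cis (2 * pi * of_int m * x 0) * \<Psi> x s * cnj (emode N k x) = \<Psi> x s * cnj (emode N (k(0 := k 0 - m)) x)" for x
    by (simp add: cis_cnj cis_mult mult.assoc[symmetric] mult.commute[of "\<Psi> x s"]; simp add: mult.commute cis_mult flip: mult.assoc)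
  then show ?thesis by (simp only: coef_def twist_def fst_conv snd_conv)
qed

text \<open>The product rule for the squared modulus on the Fourier side: the two momenta in each
  term differ by \<open>m\<close>, and conjugation turns their multipliers into a
  difference.\<close>

lemma twist_pderiv:
  assumes N: "1 \<le> N" and d: "is_pderiv N 0 \<Psi> G"
  shows "inner_wf N (twist m \<Psi>) G + inner_wf N (twist m G) \<Psi> = 2 * pi * \<i> * of_int m * inner_wf N (twist m \<Psi>) \<Psi>"
proof -
  have N0: "0 < N" using N by simp
  have L: "L2 N \<Psi>" "L2 N G" and G: "\<And>i. i \<in> idx N \<Longrightarrow> coef N G i = 2 * pi * \<i> * of_int (fst i 0) * coef N \<Psi> i"
    using d by (auto simp: is_pderiv_iff[OF N0])
  have sh: "(k(0 := k 0 - m), s) \<in> idx N" if "(k, s) \<in> idx N" for k s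
    using that N0 by (auto simp: idx_def modes_def PiE_iff extensional_def)
  have "((\<lambda>i. cnj (coef N (twist m \<Psi>) i) * coef N G i + cnj (coef N (twist m G) i) * coef N \<Psi> i) has_sum
      (inner_wf N (twist m \<Psi>) G + inner_wf N (twist m G) \<Psi>)) (idx N)"
    by (intro has_sum_add inner_has_sum L2_twist N L)
  moreover have "((\<lambda>i. 2 * pi * \<i> * of_int m * (cnj (coef N (twist m \<Psi>) i) * coef N \<Psi> i)) has_sum
      (2 * pi * \<i> * of_int m * inner_wf N (twist m \<Psi>) \<Psi>)) (idx N)"
    by (intro has_sum_cmult_right inner_has_sum L2_twist N L)
  moreover have "cnj (coef N (twist m \<Psi>) i) * coef N G i + cnj (coef N (twist m G) i) * coef N \<Psi> i
    = 2 * pi * \<i> * of_int m * (cnj (coef N (twist m \<Psi>) i) * coef N \<Psi> i)" if "i \<in> idx N" for i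
  proof -
    obtain k s where i: "i = (k, s)" by fastforce
    show ?thesis unfolding i coef_twist[OF N] G[OF sh[OF that[unfolded i]]] G[OF that[unfolded i]]
      by (simp add: algebra_simps)
  qed
  ultimately show ?thesis using has_sum_cong[of "idx N"] has_sum_unique by (smt (verit, best))
qed

lemma density_eq_slice: "density N \<Psi> t = real N * (\<Sum>s\<in>spins N. slice N (\<lambda>x. (cmod (\<Psi> x s))\<^sup>2) t)"
  by (simp add: density_def slice_def)

text \<open>The formal derivative of the density when \<open>G\<close> is the partial derivative in
  coordinate 0.\<close>

definition dens_deriv :: "nat \<Rightarrow> wavefn \<Rightarrow> wavefn \<Rightarrow> real \<Rightarrow> real" where
  "dens_deriv N \<Psi> G t = real N * (\<Sum>s\<in>spins N. slice N (\<lambda>x. 2 * Re (cnj (\<Psi> x s) * G x s)) t)"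

context
  fixes N :: nat and \<Psi> G :: wavefn
  assumes N1: "1 \<le> N" and L: "L2 N \<Psi>" and LG: "L2 N G"
begin

lemma cross_integrable:
  assumes "s \<in> spins N"
  shows "integrable (cube N) (\<lambda>x. cnj (\<Psi> x s) * G x s)"
  by (intro sqi_mult_integrable sqi_cnj L2D[OF L assms] L2D[OF LG assms])

lemma dens_deriv_integrable: "integrable U (dens_deriv N \<Psi> G)"
  unfolding dens_deriv_def[abs_def]
  by (intro integrable_mult_right Bochner_Integration.integrable_sum slice_integral(1)[OF N1] integrable_Re cross_integrable)

text \<open>Cauchy-Schwarz in the form of Young's inequality. The null set is the same for all
  \<open>a\<close>, which permits choosing \<open>a\<close> depending on \<open>t\<close>;
  optimizing gives the square at most 4 times the product of the densities of \<Psi> and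
  \<open>G\<close>.\<close>

lemma dens_deriv_bound:
  "AE t in U. \<forall>a>0. \<bar>dens_deriv N \<Psi> G t\<bar> \<le> a * density N \<Psi> t + density N G t / a"
proof -
  let ?P = "PiM {1..<N} (\<lambda>_. U)"
  have "AE t in U. \<forall>s\<in>spins N. integrable ?P (\<lambda>y. (cmod (\<Psi> (y(0 := t)) s))\<^sup>2)"
    by (intro AE_finite_allI finite_spins slice_integral(3)[OF N1] sqi_integrable_sq L2D[OF L])
  moreover have "AE t in U. \<forall>s\<in>spins N. integrable ?P (\<lambda>y. (cmod (G (y(0 := t)) s))\<^sup>2)"
    by (intro AE_finite_allI finite_spins slice_integral(3)[OF N1] sqi_integrable_sq L2D[OF LG])
  moreover have "AE t in U. \<forall>s\<in>spins N. integrable ?P (\<lambda>y. cnj (\<Psi> (y(0 := t)) s) * G (y(0 := t)) s)"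
    by (intro AE_finite_allI finite_spins slice_integral(3)[OF N1] cross_integrable)
  ultimately show ?thesis
  proof eventually_elim
    case (elim t)
    show ?case
    proof (intro allI impI)
      fix a :: real assume a: "0 < a"
      let ?p = "\<lambda>s y. cmod (\<Psi> (y(0 := t)) s)" and ?q = "\<lambda>s y. cmod (G (y(0 := t)) s)"
      have "\<bar>slice N (\<lambda>x. 2 * Re (cnj (\<Psi> x s) * G x s)) t\<bar>
        \<le> a * slice N (\<lambda>x. (cmod (\<Psi> x s))\<^sup>2) t + slice N (\<lambda>x. (cmod (G x s))\<^sup>2) t / a" if s: "s \<in> spins N" for s
      proof -
        have i: "integrable ?P (\<lambda>y. 2 * Re (cnj (\<Psi> (y(0 := t)) s) * G (y(0 := t)) s))"
          "integrable ?P (\<lambda>y. a * (?p s y)\<^sup>2)" "integrable ?P (\<lambda>y. (?q s y)\<^sup>2 / a)"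
          using elim s by (auto intro!: integrable_mult_right integrable_Re integrable_divide simp del: times_complex.sel)
        have "\<bar>slice N (\<lambda>x. 2 * Re (cnj (\<Psi> x s) * G x s)) t\<bar> \<le> (\<integral>y. \<bar>2 * Re (cnj (\<Psi> (y(0 := t)) s) * G (y(0 := t)) s)\<bar> \<partial>?P)"
          unfolding slice_def by (rule integral_abs_bound)
        also have "\<dots> \<le> (\<integral>y. a * (?p s y)\<^sup>2 + (?q s y)\<^sup>2 / a \<partial>?P)"
        proof (rule integral_mono[OF integrable_abs[OF i(1)] Bochner_Integration.integrable_add[OF i(2,3)]])
          fix y
          have "\<bar>2 * Re (cnj (\<Psi> (y(0 := t)) s) * G (y(0 := t)) s)\<bar> \<le> 2 * (?p s y * ?q s y)"
            using abs_Re_le_cmod[of "cnj (\<Psi> (y(0 := t)) s) * G (y(0 := t)) s"] by (simp only: abs_mult norm_mult complex_mod_cnj; simp)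
          also have "\<dots> \<le> a * (?p s y)\<^sup>2 + (?q s y)\<^sup>2 / a"
          proof -
            have "0 \<le> (a * ?p s y - ?q s y)\<^sup>2 / a" using a by simp
            also have "(a * ?p s y - ?q s y)\<^sup>2 / a = a * (?p s y)\<^sup>2 + (?q s y)\<^sup>2 / a - 2 * (?p s y * ?q s y)"
              using a by (simp add: power2_eq_square field_simps)
            finally show ?thesis by simp
          qed
          finally show "\<bar>2 * Re (cnj (\<Psi> (y(0 := t)) s) * G (y(0 := t)) s)\<bar> \<le> a * (?p s y)\<^sup>2 + (?q s y)\<^sup>2 / a" .
        qed
        also have "\<dots> = a * slice N (\<lambda>x. (cmod (\<Psi> x s))\<^sup>2) t + slice N (\<lambda>x. (cmod (G x s))\<^sup>2) t / a"
          unfolding slice_def by (simp only: Bochner_Integration.integral_add[OF i(2,3)] integral_mult_right_zero integral_divide_zero)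
        finally show ?thesis .
      qed
      then have "\<bar>\<Sum>s\<in>spins N. slice N (\<lambda>x. 2 * Re (cnj (\<Psi> x s) * G x s)) t\<bar>
        \<le> (\<Sum>s\<in>spins N. a * slice N (\<lambda>x. (cmod (\<Psi> x s))\<^sup>2) t + slice N (\<lambda>x. (cmod (G x s))\<^sup>2) t / a)"
        by (rule order_trans[OF sum_abs sum_mono])
      then have "\<bar>dens_deriv N \<Psi> G t\<bar> \<le> real N * (\<Sum>s\<in>spins N. a * slice N (\<lambda>x. (cmod (\<Psi> x s))\<^sup>2) t + slice N (\<lambda>x. (cmod (G x s))\<^sup>2) t / a)"
        unfolding dens_deriv_def abs_mult by (simp add: mult_left_mono)
      then show "\<bar>dens_deriv N \<Psi> G t\<bar> \<le> a * density N \<Psi> t + density N G t / a"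
        unfolding density_eq_slice by (simp add: sum.distrib sum_distrib_left sum_divide_distrib algebra_simps)
    qed
  qed
qed

lemma integral_density_cis:
  "(\<integral>t. complex_of_real (density N \<Psi> t) * cis (- 2 * pi * of_int m * t) \<partial>U) = of_nat N * inner_wf N (twist m \<Psi>) \<Psi>"
proof -
  have Lt: "L2 N (twist m \<Psi>)" by (rule L2_twist[OF N1 L])
  let ?h = "\<lambda>s x. cnj (twist m \<Psi> x s) * \<Psi> x s"
  have i: "integrable (cube N) (?h s)" if "s \<in> spins N" for s
    using that by (intro sqi_mult_integrable sqi_cnj L2D[OF Lt] L2D[OF L])
  have "complex_of_real (slice N (\<lambda>x. (cmod (\<Psi> x s))\<^sup>2) t) * cis (- 2 * pi * of_int m * t) = slice N (?h s) t" for s t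
  proof -
    have "complex_of_real ((cmod z)\<^sup>2) * cis (- 2 * pi * of_int m * t) = cnj (cis (2 * pi * of_int m * t) * z) * z" for z
      by (simp only: complex_norm_square complex_cnj_mult cis_cnj) (simp add: mult.commute mult.left_commute)
    then show ?thesis unfolding slice_def twist_def
      by (simp only: integral_complex_of_real[symmetric] integral_mult_left_zero[symmetric] fun_upd_same)
  qed
  then have "complex_of_real (density N \<Psi> t) * cis (- 2 * pi * of_int m * t) = of_nat N * (\<Sum>s\<in>spins N. slice N (?h s) t)" for t
    unfolding density_eq_slice by (simp only: of_real_mult of_real_sum sum_distrib_right mult.assoc of_real_of_nat_eq)
  then have "(\<integral>t. complex_of_real (density N \<Psi> t) * cis (- 2 * pi * of_int m * t) \<partial>U) = of_nat N * (\<Sum>s\<in>spins N. \<integral>t. slice N (?h s) t \<partial>U)"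
    by (simp only: integral_mult_right_zero) (subst Bochner_Integration.integral_sum, auto intro: slice_integral(1)[OF N1 i])
  also have "(\<Sum>s\<in>spins N. \<integral>t. slice N (?h s) t \<partial>U) = inner_wf N (twist m \<Psi>) \<Psi>"
    unfolding inner_wf_def by (intro sum.cong refl slice_integral(2)[OF N1 i])
  finally show ?thesis .
qed

lemma integral_dens_deriv_cis:
  "(\<integral>t. complex_of_real (dens_deriv N \<Psi> G t) * cis (- 2 * pi * of_int m * t) \<partial>U)
    = of_nat N * (inner_wf N (twist m \<Psi>) G + inner_wf N (twist m G) \<Psi>)"
proof -
  have Lt: "L2 N (twist m \<Psi>)" "L2 N (twist m G)" by (rule L2_twist[OF N1 L], rule L2_twist[OF N1 LG])
  let ?h = "\<lambda>s x. cnj (twist m \<Psi> x s) * G x s + cnj (twist m G x s) * \<Psi> x s"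
  have i1: "integrable (cube N) (\<lambda>x. cnj (twist m \<Psi> x s) * G x s)" if "s \<in> spins N" for s
    using that by (intro sqi_mult_integrable sqi_cnj L2D[OF Lt(1)] L2D[OF LG])
  have i2: "integrable (cube N) (\<lambda>x. cnj (twist m G x s) * \<Psi> x s)" if "s \<in> spins N" for s
    using that by (intro sqi_mult_integrable sqi_cnj L2D[OF Lt(2)] L2D[OF L])
  have ih: "integrable (cube N) (?h s)" if "s \<in> spins N" for s
    using i1[OF that] i2[OF that] by (rule Bochner_Integration.integrable_add)
  have "complex_of_real (slice N (\<lambda>x. 2 * Re (cnj (\<Psi> x s) * G x s)) t) * cis (- 2 * pi * of_int m * t) = slice N (?h s) t" for s t
  proof -
    have "complex_of_real (2 * Re (cnj z * w)) * cis (- 2 * pi * of_int m * t)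
      = cnj (cis (2 * pi * of_int m * t) * z) * w + cnj (cis (2 * pi * of_int m * t) * w) * z" for z w
      by (simp add: complex_eq_iff algebra_simps)
    then show ?thesis unfolding slice_def twist_def
      by (simp only: integral_complex_of_real[symmetric] integral_mult_left_zero[symmetric] fun_upd_same)
  qed
  then have "complex_of_real (dens_deriv N \<Psi> G t) * cis (- 2 * pi * of_int m * t) = of_nat N * (\<Sum>s\<in>spins N. slice N (?h s) t)" for t
    unfolding dens_deriv_def by (simp only: of_real_mult[of "real N"] of_real_sum sum_distrib_right mult.assoc of_real_of_nat_eq)
  then have "(\<integral>t. complex_of_real (dens_deriv N \<Psi> G t) * cis (- 2 * pi * of_int m * t) \<partial>U) = of_nat N * (\<Sum>s\<in>spins N. \<integral>t. slice N (?h s) t \<partial>U)"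
    by (simp only: integral_mult_right_zero) (subst Bochner_Integration.integral_sum, auto intro: slice_integral(1)[OF N1 ih])
  also have "(\<Sum>s\<in>spins N. \<integral>t. slice N (?h s) t \<partial>U) = inner_wf N (twist m \<Psi>) G + inner_wf N (twist m G) \<Psi>"
    unfolding inner_wf_def sum.distrib[symmetric]
  proof (intro sum.cong refl)
    fix s assume s: "s \<in> spins N"
    show "(\<integral>t. slice N (?h s) t \<partial>U) = (\<integral>x. cnj (twist m \<Psi> x s) * G x s \<partial>cube N) + (\<integral>x. cnj (twist m G x s) * \<Psi> x s \<partial>cube N)"
      unfolding slice_integral(2)[OF N1 ih[OF s]] by (rule Bochner_Integration.integral_add[OF i1[OF s] i2[OF s]])
  qed
  finally show ?thesis .
qed

end

section \<open>Regularity of one-particle densities\<close>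

lemma L2T_integrable: "L2T f \<Longrightarrow> integrable U f"
proof -
  assume f: "L2T f"
  have "sqi U (\<lambda>x. complex_of_real (f x))" using f by (auto simp: L2T_def sqi_def)
  then have "integrable U (\<lambda>x. complex_of_real (f x))" by (rule U.sqi_integrable)
  then show ?thesis using integrable_Re by fastforce
qed

text \<open>Young's inequality with a free parameter; it is later set to 1 + T, so that a bound
  quadratic in the kinetic energy becomes linear.\<close>

lemma L2T_mult_bound:
  assumes f: "L2T f" and g: "L2T g" and a: "0 < a"
  shows "integrable U (\<lambda>x. f x * g x)" "(\<integral>x. \<bar>f x * g x\<bar> \<partial>U) \<le> (a * (\<integral>x. (f x)\<^sup>2 \<partial>U) + (\<integral>x. (g x)\<^sup>2 \<partial>U) / a) / 2"
proof -
  have "sqi U (\<lambda>x. complex_of_real (f x))" "sqi U (\<lambda>x. complex_of_real (g x))" using f g by (auto simp: L2T_def sqi_def)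
  then have "integrable U (\<lambda>x. complex_of_real (f x) * complex_of_real (g x))" by (rule sqi_mult_integrable)
  then show i: "integrable U (\<lambda>x. f x * g x)" using integrable_Re by fastforce
  have i2: "integrable U (\<lambda>x. (a * (f x)\<^sup>2 + (g x)\<^sup>2 / a) / 2)" using f g by (simp add: L2T_def)
  have "(\<integral>x. \<bar>f x * g x\<bar> \<partial>U) \<le> (\<integral>x. (a * (f x)\<^sup>2 + (g x)\<^sup>2 / a) / 2 \<partial>U)"
  proof (rule integral_mono[OF integrable_abs[OF i] i2])
    fix x
    have "0 \<le> (a * \<bar>f x\<bar> - \<bar>g x\<bar>)\<^sup>2 / a" using a by simp
    also have "(a * \<bar>f x\<bar> - \<bar>g x\<bar>)\<^sup>2 / a = a * (f x)\<^sup>2 + (g x)\<^sup>2 / a - 2 * (\<bar>f x\<bar> * \<bar>g x\<bar>)"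
      using a unfolding power2_diff power_mult_distrib power2_abs by (simp add: power2_eq_square field_simps)
    finally show "\<bar>f x * g x\<bar> \<le> (a * (f x)\<^sup>2 + (g x)\<^sup>2 / a) / 2" by (simp add: abs_mult)
  qed
  also have "\<dots> = (a * (\<integral>x. (f x)\<^sup>2 \<partial>U) + (\<integral>x. (g x)\<^sup>2 \<partial>U) / a) / 2"
    using f g by (simp add: L2T_def)
  finally show "(\<integral>x. \<bar>f x * g x\<bar> \<partial>U) \<le> (a * (\<integral>x. (f x)\<^sup>2 \<partial>U) + (\<integral>x. (g x)\<^sup>2 \<partial>U) / a) / 2" .
qed

text \<open>\<open>derivT\<close> is a choice; by this uniqueness any explicit weak derivative may
  replace it under an integral.\<close>

lemma weak_derivT_unique:
  assumes "weak_derivT f d" "weak_derivT f d'"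
  shows "AE x in U. d x = d' x"
proof -
  have i: "integrable U d" "integrable U d'" using assms by (auto simp: weak_derivT_def intro: L2T_integrable)
  have "AE x in U. complex_of_real (d x - d' x) = 0"
  proof (rule fourier_unique_U)
    show "integrable U (\<lambda>x. complex_of_real (d x - d' x))" using i by simp
    fix k :: int
    have "(\<integral>x. complex_of_real (d x - d' x) * cis (- 2 * pi * of_int k * x) \<partial>U)
      = (\<integral>x. complex_of_real (d x) * cis (- 2 * pi * of_int k * x) - complex_of_real (d' x) * cis (- 2 * pi * of_int k * x) \<partial>U)"
      by (simp add: left_diff_distrib)
    also have "\<dots> = 0"
      unfolding Bochner_Integration.integral_diff[OF integrable_mult_cis[OF i(1)] integrable_mult_cis[OF i(2)]]
      using assms by (simp add: weak_derivT_def)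
    finally show "(\<integral>x. complex_of_real (d x - d' x) * cis (- 2 * pi * of_int k * x) \<partial>U) = 0" .
  qed
  then show ?thesis by simp
qed

lemma derivT_weak: "weak_derivT f d \<Longrightarrow> weak_derivT f (derivT f)"
  unfolding derivT_def by (rule someI[of "weak_derivT f" d])

text \<open>An L1 bound on the derivative gives boundedness of the density by comparison with a
  primitive. Boundedness in turn upgrades the derivative to L2, since its square is at most 4 times
  the density times that of \<partial>\<Psi>, whose integral is controlled by the kinetic
  energy.\<close>

lemma density_regularity:
  assumes N: "1 \<le> N" and \<Psi>: "\<Psi> \<in> Wset N"
  shows "weak_derivT (density N \<Psi>) (derivT (density N \<Psi>))"
    and "AE t in U. density N \<Psi> t \<le> 4 * real N * (1 + kin N \<Psi>)"
    and "(\<integral>t. (derivT (density N \<Psi>) t)\<^sup>2 \<partial>U) \<le> 32 * (real N)\<^sup>2 * (1 + kin N \<Psi>)\<^sup>2"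
proof -
  have N0: "0 < N" using N by simp
  have H: "H1 N \<Psi>" and n1: "normsq N \<Psi> = 1" using \<Psi> by (auto simp: Wset_def intro: Vspace_H1)
  define G where "G = pderiv_wf N 0 \<Psi>"
  have G: "is_pderiv N 0 \<Psi> G" unfolding G_def by (rule is_pderiv_pderiv_wf[OF H N0])
  have L: "L2 N \<Psi>" and LG: "L2 N G" using G by (auto simp: is_pderiv_def)
  have nG: "normsq N G \<le> 2 * kin N \<Psi>"
  proof -
    have "normsq N G \<le> (\<Sum>j<N. normsq N (pderiv_wf N j \<Psi>))"
      unfolding G_def using N0 by (intro member_le_sum) (auto simp: normsq_nonneg)
    then show ?thesis by (simp add: kin_def)
  qed
  let ?k = "kin N \<Psi>"
  have k0: "0 \<le> ?k" by (rule kin_nonneg)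
  define \<rho> \<tau> d where "\<rho> = density N \<Psi>" and "\<tau> = density N G" and "d = dens_deriv N \<Psi> G"
  have \<rho>i: "integrable U \<rho>" and \<tau>i: "integrable U \<tau>" and di: "integrable U d"
    unfolding \<rho>_def \<tau>_def d_def by (rule density_integrable[OF N L], rule density_integrable[OF N LG], rule dens_deriv_integrable[OF N L LG])
  have \<rho>0: "0 \<le> \<rho> t" and \<tau>0: "0 \<le> \<tau> t" for t
    unfolding \<rho>_def \<tau>_def by (rule density_nonneg[OF N L], rule density_nonneg[OF N LG])
  have I\<rho>: "(\<integral>t. \<rho> t \<partial>U) = real N" unfolding \<rho>_def using integral_density[OF N L] n1 by simp
  have "(\<integral>t. \<tau> t \<partial>U) = real N * normsq N G" unfolding \<tau>_def by (rule integral_density[OF N LG])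
  also have "\<dots> \<le> real N * (2 * ?k)" by (intro mult_left_mono nG) simp
  finally have I\<tau>: "(\<integral>t. \<tau> t \<partial>U) \<le> 2 * real N * ?k" by simp
  have bound: "AE t in U. \<forall>a>0. \<bar>d t\<bar> \<le> a * \<rho> t + \<tau> t / a"
    unfolding d_def \<rho>_def \<tau>_def by (rule dens_deriv_bound[OF N L LG])
  have fd: "(\<integral>x. complex_of_real (d x) * cis (- 2 * pi * of_int m * x) \<partial>U)
       = 2 * pi * \<i> * of_int m * (\<integral>x. complex_of_real (\<rho> x) * cis (- 2 * pi * of_int m * x) \<partial>U)" for m :: int
    unfolding d_def \<rho>_def integral_density_cis[OF N L LG] integral_dens_deriv_cis[OF N L LG] twist_pderiv[OF N G] by simp
  have Id: "(\<integral>t. \<bar>d t\<bar> \<partial>U) \<le> real N + 2 * real N * ?k"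
  proof -
    have "(\<integral>t. \<bar>d t\<bar> \<partial>U) \<le> (\<integral>t. \<rho> t + \<tau> t \<partial>U)"
    proof (rule integral_mono_AE)
      show "AE t in U. \<bar>d t\<bar> \<le> \<rho> t + \<tau> t"
        using bound
      proof eventually_elim
        case (elim t)
        from elim[rule_format, of 1] show ?case by simp
      qed
    qed (use di \<rho>i \<tau>i in auto)
    then show ?thesis using \<rho>i \<tau>i I\<rho> I\<tau> by simp
  qed
  have "AE t in U. \<bar>\<rho> t\<bar> \<le> (\<integral>t. \<bar>\<rho> t\<bar> \<partial>U) + 2 * (\<integral>t. \<bar>d t\<bar> \<partial>U)"
    by (rule weak_derivative_bound[OF \<rho>i di fd])
  \<comment> \<open>N plus twice the L1 bound N + 2 N T of the derivative is 3 N + 4 N T, rounded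
    up.\<close>
  then have \<rho>b: "AE t in U. \<rho> t \<le> 4 * real N * (1 + ?k)"
  proof eventually_elim
    case (elim t)
    have "(\<integral>t. \<bar>\<rho> t\<bar> \<partial>U) = real N" using I\<rho> \<rho>0 by simp
    then show ?case using elim \<rho>0[of t] Id by (simp add: algebra_simps)
  qed
  then show "AE t in U. density N \<Psi> t \<le> 4 * real N * (1 + kin N \<Psi>)" unfolding \<rho>_def .
  let ?B = "4 * real N * (1 + ?k)"
  have B: "0 < ?B" using N0 k0 by simp
  have dsq: "AE t in U. (d t)\<^sup>2 \<le> 4 * ?B * \<tau> t"
    using bound \<rho>b
  proof eventually_elim
    case (elim t)
    show ?case
    proof (cases "d t = 0")
      case True
      then show ?thesis using B \<tau>0[of t] by simp
    next
      case False
      define K where "K = ?B"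
      have K: "0 < K" using B by (simp only: K_def)
      \<comment> \<open>Makes a K half of |d t|, which is absorbed on the left.\<close>
      define a where "a = \<bar>d t\<bar> / (2 * K)"
      have a: "0 < a" unfolding a_def using False K by simp
      have "\<bar>d t\<bar> \<le> a * \<rho> t + \<tau> t / a" using elim(1) a by blast
      also have "\<dots> \<le> a * K + \<tau> t / a" using elim(2) a unfolding K_def by (intro add_right_mono mult_left_mono) auto
      also have "a * K = \<bar>d t\<bar> / 2" using K by (simp add: a_def)
      finally have "\<bar>d t\<bar> / 2 \<le> \<tau> t / a" by linarith
      then have "\<bar>d t\<bar> / 2 * a \<le> \<tau> t" using a by (simp add: pos_le_divide_eq)
      then have "\<bar>d t\<bar> / 2 * a * (4 * K) \<le> \<tau> t * (4 * K)" using K by (intro mult_right_mono) auto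
      moreover have "\<bar>d t\<bar> / 2 * a * (4 * K) = (d t)\<^sup>2"
        using K unfolding a_def by (simp add: power2_eq_square flip: abs_mult)
      ultimately show ?thesis unfolding K_def by (simp only: mult.commute)
    qed
  qed
  have d2i: "integrable U (\<lambda>t. (d t)\<^sup>2)"
  proof (rule Bochner_Integration.integrable_bound[of _ "\<lambda>t. 4 * ?B * \<tau> t"])
    show "integrable U (\<lambda>t. 4 * ?B * \<tau> t)" using \<tau>i by (rule integrable_mult_right)
    show "(\<lambda>t. (d t)\<^sup>2) \<in> borel_measurable U" using di by (intro borel_measurable_power borel_measurable_integrable)
    show "AE t in U. norm ((d t)\<^sup>2) \<le> norm (4 * ?B * \<tau> t)"
      using dsq
    proof eventually_elim
      case (elim t)
      have "(d t)\<^sup>2 \<le> \<bar>4 * ?B * \<tau> t\<bar>" using elim by (rule order_trans) simp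
      then show ?case by simp
    qed
  qed
  have "(\<integral>t. (d t)\<^sup>2 \<partial>U) \<le> (\<integral>t. 4 * ?B * \<tau> t \<partial>U)"
    by (rule integral_mono_AE[OF d2i integrable_mult_right[OF \<tau>i] dsq])
  also have "\<dots> = 4 * ?B * (\<integral>t. \<tau> t \<partial>U)" by simp
  also have "\<dots> \<le> 4 * ?B * (2 * real N * ?k)" using B by (intro mult_left_mono I\<tau>) auto
  also have "\<dots> \<le> 4 * ?B * (2 * real N * (1 + ?k))" using B by (intro mult_left_mono) auto
  also have "\<dots> = 32 * (real N)\<^sup>2 * (1 + ?k)\<^sup>2" by (simp add: power2_eq_square)
  finally have Id2: "(\<integral>t. (d t)\<^sup>2 \<partial>U) \<le> 32 * (real N)\<^sup>2 * (1 + ?k)\<^sup>2" .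
  have "L2T \<rho>" unfolding L2T_def
  proof
    show m: "\<rho> \<in> borel_measurable U" using \<rho>i by auto
    show "integrable U (\<lambda>t. (\<rho> t)\<^sup>2)"
    proof (rule U.integrable_const_bound[of _ "?B\<^sup>2"])
      show "AE t in U. norm ((\<rho> t)\<^sup>2) \<le> ?B\<^sup>2"
        using \<rho>b by eventually_elim (simp add: power_mono \<rho>0)
    qed (use m in simp)
  qed
  moreover have "L2T d" unfolding L2T_def using di d2i by auto
  ultimately have wd: "weak_derivT \<rho> d" unfolding weak_derivT_def using fd by simp
  show w: "weak_derivT (density N \<Psi>) (derivT (density N \<Psi>))" using derivT_weak[OF wd] unfolding \<rho>_def .
  have "(\<integral>t. (derivT (density N \<Psi>) t)\<^sup>2 \<partial>U) = (\<integral>t. (d t)\<^sup>2 \<partial>U)"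
  proof (rule integral_cong_AE)
    show "AE t in U. (derivT (density N \<Psi>) t)\<^sup>2 = (d t)\<^sup>2"
      using weak_derivT_unique[OF w wd[unfolded \<rho>_def]] by eventually_elim simp
  qed (use w wd in \<open>auto simp: weak_derivT_def L2T_def\<close>)
  then show "(\<integral>t. (derivT (density N \<Psi>) t)\<^sup>2 \<partial>U) \<le> 32 * (real N)\<^sup>2 * (1 + kin N \<Psi>)\<^sup>2" using Id2 by simp
qed

section \<open>The Legendre transform is bounded by the density-matrix functional\<close>

text \<open>Termwise integration for a sum known only almost everywhere, as in
  \<open>dm_reps\<close>; measurability of \<open>H\<close> is a separate assumption because an
  almost everywhere limit need not be measurable.\<close>

lemma sums_integral_AE:
  fixes h :: "nat \<Rightarrow> 'a \<Rightarrow> 'b :: {banach, second_countable_topology}"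
  assumes h: "\<And>k. integrable M (h k)" and s: "summable (\<lambda>k. \<integral>x. norm (h k x) \<partial>M)"
    and H: "H \<in> borel_measurable M" "AE x in M. (\<lambda>k. h k x) sums H x"
  shows "integrable M H" "(\<lambda>k. \<integral>x. h k x \<partial>M) sums (\<integral>x. H x \<partial>M)"
proof -
  have ae: "AE x in M. summable (\<lambda>k. norm (h k x))" by (rule AE_summable_norm[OF h s])
  have i: "integrable M (\<lambda>x. \<Sum>k. h k x)" by (rule integrable_suminf[OF h ae s])
  have eq: "AE x in M. (\<Sum>k. h k x) = H x" using H(2)
  proof eventually_elim
    case (elim x)
    show ?case using sums_unique[OF elim] by simp
  qed
  have m: "(\<lambda>x. \<Sum>k. h k x) \<in> borel_measurable M" using i by (rule borel_measurable_integrable)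
  show "integrable M H" using integrable_cong_AE[OF m H(1) eq] i by simp
  have "(\<integral>x. (\<Sum>k. h k x) \<partial>M) = (\<integral>x. H x \<partial>M)" by (rule integral_cong_AE[OF m H(1) eq])
  then show "(\<lambda>k. \<integral>x. h k x \<partial>M) sums (\<integral>x. H x \<partial>M)" using sums_integral[OF h ae s] by simp
qed

context hamiltonian
begin

text \<open>The point is that \<rho> has a weak derivative in L2, namely the weighted sum of the
  derivatives of the component densities. Every majorant is linear in 1 + T of the component, and
  these are summable against the weights.\<close>

lemma pairing_sums:
  assumes \<rho>: "\<rho> \<in> borel_measurable U" and rep: "(lam, Ps) \<in> dm_reps N \<rho>"
    and sm: "summable (\<lambda>k. lam k * kin N (Ps k))" and v: "L2T f" "L2T g"
  shows "(\<lambda>k. lam k * pairing (f, g) (density N (Ps k))) sums pairing (f, g) \<rho>"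
proof -
  have lam0: "0 \<le> lam k" and lam1: "lam sums 1" and Ps: "Ps k \<in> Wset N"
    and \<rho>s: "AE x in U. (\<lambda>k. lam k * density N (Ps k) x) sums \<rho> x" for k
    using rep by (auto simp: dm_reps_def)
  define r where "r k = density N (Ps k)" for k
  define D where "D k = derivT (r k)" for k
  define m where "m k = 1 + kin N (Ps k)" for k
  have m1: "1 \<le> m k" for k by (simp add: m_def kin_nonneg)
  have lm: "summable (\<lambda>k. lam k * m k)"
    using summable_add[OF sums_summable[OF lam1] sm] by (simp add: m_def distrib_left)
  have L: "L2 N (Ps k)" for k using Ps[of k] by (auto simp: Wset_def intro: Vspace_L2)
  have rD: "weak_derivT (r k) (D k)" "AE t in U. r k t \<le> 4 * real N * m k"
    "(\<integral>t. (D k t)\<^sup>2 \<partial>U) \<le> 32 * (real N)\<^sup>2 * (m k)\<^sup>2" for k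
    unfolding r_def D_def m_def using density_regularity[OF N1 Ps] by auto
  have rL: "L2T (r k)" and DL: "L2T (D k)" for k using rD(1)[of k] by (auto simp: weak_derivT_def)
  have r0: "0 \<le> r k t" for k t unfolding r_def by (rule density_nonneg[OF N1 L])
  have wsm: "summable (\<lambda>k. \<integral>x. norm (lam k * h k x) \<partial>U)" if "\<And>k. (\<integral>x. \<bar>h k x\<bar> \<partial>U) \<le> C * m k" for h C
  proof (rule summable_comparison_test'[where g = "\<lambda>k. C * (lam k * m k)" and N = 0])
    show "summable (\<lambda>k. C * (lam k * m k))" by (rule summable_mult[OF lm])
    fix k
    have "(\<integral>x. norm (lam k * h k x) \<partial>U) = lam k * (\<integral>x. \<bar>h k x\<bar> \<partial>U)" using lam0[of k] by (simp add: abs_mult)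
    also have "\<dots> \<le> lam k * (C * m k)" by (intro mult_left_mono that lam0)
    finally show "norm (\<integral>x. norm (lam k * h k x) \<partial>U) \<le> C * (lam k * m k)" by (simp add: algebra_simps)
  qed
  have one: "L2T (\<lambda>_. 1)" by (simp add: L2T_def)
  have fr: "(\<integral>x. \<bar>f x * r k x\<bar> \<partial>U) \<le> (4 * real N * (\<integral>x. \<bar>f x\<bar> \<partial>U)) * m k" if f: "L2T f" for f k
  proof -
    have "(\<integral>x. \<bar>f x * r k x\<bar> \<partial>U) \<le> (\<integral>x. (4 * real N * m k) * \<bar>f x\<bar> \<partial>U)"
    proof (rule integral_mono_AE)
      show "integrable U (\<lambda>x. \<bar>f x * r k x\<bar>)" using L2T_mult_bound(1)[OF f rL, of 1] by (intro integrable_abs) simp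
      show "integrable U (\<lambda>x. (4 * real N * m k) * \<bar>f x\<bar>)" by (intro integrable_mult_right integrable_abs L2T_integrable f)
      show "AE x in U. \<bar>f x * r k x\<bar> \<le> (4 * real N * m k) * \<bar>f x\<bar>"
        using rD(2)[of k]
      proof eventually_elim
        case (elim x)
        then have "\<bar>f x\<bar> * r k x \<le> \<bar>f x\<bar> * (4 * real N * m k)" by (intro mult_left_mono) auto
        then show ?case using r0[of k x] by (simp add: abs_mult mult.commute)
      qed
    qed
    then show ?thesis by (simp add: algebra_simps)
  qed
  have gD: "(\<integral>x. \<bar>g x * D k x\<bar> \<partial>U) \<le> (((\<integral>x. (g x)\<^sup>2 \<partial>U) + 32 * (real N)\<^sup>2) / 2) * m k" if g: "L2T g" for g k
  proof -
    have mk: "0 < m k" using m1[of k] by linarith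
    \<comment> \<open>Young's parameter \<open>m k\<close> balances a squared norm of
      \<open>D k\<close> that grows like the square of \<open>m k\<close>.\<close>
    have "(\<integral>x. \<bar>g x * D k x\<bar> \<partial>U) \<le> (m k * (\<integral>x. (g x)\<^sup>2 \<partial>U) + (\<integral>x. (D k x)\<^sup>2 \<partial>U) / m k) / 2"
      by (rule L2T_mult_bound(2)[OF g DL mk])
    also have "(\<integral>x. (D k x)\<^sup>2 \<partial>U) / m k \<le> 32 * (real N)\<^sup>2 * (m k)\<^sup>2 / m k"
      using mk by (intro divide_right_mono rD(3)) simp
    also have "\<dots> = 32 * (real N)\<^sup>2 * m k" using mk by (simp add: power2_eq_square)
    finally show ?thesis by (simp add: algebra_simps)
  qed
  have ri: "integrable U (r k)" and Di: "integrable U (D k)" for k by (rule L2T_integrable[OF rL], rule L2T_integrable[OF DL])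
  have sD: "summable (\<lambda>k. \<integral>x. norm (lam k * D k x) \<partial>U)"
    by (rule wsm[OF gD[OF one, unfolded mult_1_left]])
  have sr: "summable (\<lambda>k. \<integral>x. norm (lam k * r k x) \<partial>U)"
    by (rule wsm[OF fr[OF one, unfolded mult_1_left]])
  define DD where "DD x = (\<Sum>k. lam k * D k x)" for x
  have lDi: "integrable U (\<lambda>x. lam k * D k x)" and lri: "integrable U (\<lambda>x. lam k * r k x)" for k
    by (rule integrable_mult_right[OF Di], rule integrable_mult_right[OF ri])
  have Dae: "AE x in U. summable (\<lambda>k. norm (lam k * D k x))" by (rule AE_summable_norm[OF lDi sD])
  have DDi: "integrable U DD" unfolding DD_def[abs_def] by (rule integrable_suminf[OF lDi Dae sD])
  have DDs: "AE x in U. (\<lambda>k. lam k * D k x) sums DD x"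
    using Dae
  proof eventually_elim
    case (elim x)
    have "summable (\<lambda>k. lam k * D k x)" using elim by (rule summable_norm_cancel)
    then show ?case unfolding DD_def by (rule summable_sums)
  qed
  have \<rho>s': "AE x in U. (\<lambda>k. lam k * r k x) sums \<rho> x" using \<rho>s unfolding r_def .
  have \<rho>i: "integrable U \<rho>" by (rule sums_integral_AE(1)[OF lri sr \<rho> \<rho>s'])
  define M where "M = (\<Sum>k. lam k * m k)"
  have Ms: "(\<lambda>k. lam k * m k) sums M" unfolding M_def by (rule summable_sums[OF lm])
  have M1: "1 \<le> M"
    by (rule sums_le[OF _ lam1 Ms]) (use mult_left_mono[OF m1 lam0] in simp)
  have \<rho>L: "L2T \<rho>" unfolding L2T_def
  proof (rule conjI[OF \<rho>])
    have "AE x in U. \<forall>k. r k x \<le> 4 * real N * m k" using rD(2) by (simp add: AE_all_countable)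
    then have b: "AE x in U. 0 \<le> \<rho> x \<and> \<rho> x \<le> 4 * real N * M"
      using \<rho>s'
    proof eventually_elim
      case (elim x)
      have "\<rho> x \<le> 4 * real N * M"
      proof (rule sums_le[OF _ elim(2) sums_mult[OF Ms]])
        fix k
        have "lam k * r k x \<le> lam k * (4 * real N * m k)" by (intro mult_left_mono lam0) (use elim(1) in blast)
        then show "lam k * r k x \<le> 4 * real N * (lam k * m k)" by (simp add: algebra_simps)
      qed
      moreover have "0 \<le> \<rho> x" by (rule sums_le[OF _ sums_zero elim(2)]) (use lam0 r0 in simp)
      ultimately show ?case by simp
    qed
    show "integrable U (\<lambda>x. (\<rho> x)\<^sup>2)"
    proof (rule U.integrable_const_bound[of _ "(4 * real N * M)\<^sup>2"])
      show "AE x in U. norm ((\<rho> x)\<^sup>2) \<le> (4 * real N * M)\<^sup>2"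
        using b
      proof eventually_elim
        case (elim x)
        then have "(\<rho> x)\<^sup>2 \<le> (4 * real N * M)\<^sup>2" by (intro power_mono) auto
        then show ?case by simp
      qed
    qed (use \<rho> in simp)
  qed
  have DDL: "L2T DD" unfolding L2T_def
  proof (rule conjI)
    show DDm: "DD \<in> borel_measurable U" using DDi by auto
    \<comment> \<open>The squared norms of \<open>D k\<close> grow like the square of
      \<open>m k\<close> and need not be summable against the weights; after division by
      \<open>m k\<close> they are. Cauchy-Schwarz with this split bounds the square of the sum by M
      * Q.\<close>
    let ?q = "\<lambda>k x. lam k * ((D k x)\<^sup>2 / m k)"
    have qi: "integrable U (\<lambda>x. ?q k x)" for k using DL[of k] by (intro integrable_mult_right integrable_divide) (simp add: L2T_def)
    have "summable (\<lambda>k. \<integral>x. norm (?q k x) \<partial>U)"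
    proof (rule wsm[where C = "32 * (real N)\<^sup>2"])
      fix k
      have mk: "0 < m k" using m1[of k] by linarith
      have "(\<integral>x. \<bar>(D k x)\<^sup>2 / m k\<bar> \<partial>U) = (\<integral>x. (D k x)\<^sup>2 \<partial>U) / m k" using mk by simp
      also have "\<dots> \<le> 32 * (real N)\<^sup>2 * (m k)\<^sup>2 / m k" using mk by (intro divide_right_mono rD(3)) simp
      also have "\<dots> = 32 * (real N)\<^sup>2 * m k" using mk by (simp add: power2_eq_square)
      finally show "(\<integral>x. \<bar>(D k x)\<^sup>2 / m k\<bar> \<partial>U) \<le> 32 * (real N)\<^sup>2 * m k" .
    qed
    note qs = this
    have qae: "AE x in U. summable (\<lambda>k. norm (?q k x))" by (rule AE_summable_norm[OF qi qs])
    define Q where "Q x = (\<Sum>k. ?q k x)" for x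
    have Qi: "integrable U Q" unfolding Q_def[abs_def] by (rule integrable_suminf[OF qi qae qs])
    have "AE x in U. (DD x)\<^sup>2 \<le> M * Q x"
      using qae DDs
    proof eventually_elim
      case (elim x)
      have "summable (\<lambda>k. ?q k x)" using elim(1) by (rule summable_norm_cancel)
      then have Qs: "(\<lambda>k. ?q k x) sums Q x" unfolding Q_def by (rule summable_sums)
      have Q0: "0 \<le> Q x" 
        by (rule sums_le[OF _ sums_zero Qs]) (use lam0 m1 in \<open>simp add: order_trans[OF zero_le_one]\<close>)
      show ?case
      proof (cases "DD x = 0")
        case True
        then show ?thesis using Q0 M1 by simp
      next
        case False
        \<comment> \<open>Young's parameter for which the first term is half of |DD x| and is
          absorbed.\<close>
        define a where "a = \<bar>DD x\<bar> / M"
        have a: "0 < a" using False M1 by (simp add: a_def)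
        have le: "\<bar>lam k * D k x\<bar> \<le> (a * (lam k * m k) + ?q k x / a) / 2" for k
        proof -
          have mk: "0 < m k" using m1[of k] by linarith
          have "0 \<le> (a * m k - \<bar>D k x\<bar>)\<^sup>2 / (a * m k)" using a mk by simp
          also have "\<dots> = a * m k + (D k x)\<^sup>2 / m k / a - 2 * \<bar>D k x\<bar>"
            using a mk unfolding power2_diff power2_abs by (simp add: power2_eq_square field_simps)
          finally have "lam k * (2 * \<bar>D k x\<bar>) \<le> lam k * (a * m k + (D k x)\<^sup>2 / m k / a)" by (intro mult_left_mono lam0) simp
          then show ?thesis using lam0[of k] by (simp add: abs_mult algebra_simps)
        qed
        have s2: "(\<lambda>k. (a * (lam k * m k) + ?q k x / a) / 2) sums ((a * M + Q x / a) / 2)"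
          by (intro sums_divide sums_add sums_mult Ms Qs)
        have "DD x \<le> (a * M + Q x / a) / 2" by (rule sums_le[OF _ elim(2) s2]) (use le abs_le_D1 in blast)
        moreover have "- DD x \<le> (a * M + Q x / a) / 2" by (rule sums_le[OF _ sums_minus[OF elim(2)] s2]) (use le abs_le_D2 in blast)
        ultimately have "\<bar>DD x\<bar> \<le> (a * M + Q x / a) / 2" by linarith
        moreover have "a * M = \<bar>DD x\<bar>" using M1 by (simp add: a_def)
        ultimately have "\<bar>DD x\<bar> \<le> (\<bar>DD x\<bar> + Q x / a) / 2" by (simp only:)
        moreover have "y \<le> z" if "y \<le> (y + z) / 2" for y z :: real using that by simp
        ultimately have "\<bar>DD x\<bar> \<le> Q x / a" by blast
        then have "\<bar>DD x\<bar> * a \<le> Q x" using a by (simp add: pos_le_divide_eq)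
        then have "\<bar>DD x\<bar> * a * M \<le> Q x * M" using M1 by (intro mult_right_mono) auto
        moreover have "\<bar>DD x\<bar> * a * M = (DD x)\<^sup>2" using M1 by (simp add: a_def power2_eq_square flip: abs_mult)
        ultimately show ?thesis by (simp add: mult.commute)
      qed
    qed
    then show "integrable U (\<lambda>x. (DD x)\<^sup>2)"
    proof (intro Bochner_Integration.integrable_bound[OF integrable_mult_right[OF Qi, of M]])
      assume *: "AE x in U. (DD x)\<^sup>2 \<le> M * Q x"
      show "AE x in U. norm ((DD x)\<^sup>2) \<le> norm (M * Q x)"
        using *
      proof eventually_elim
        case (elim x)
        have "(DD x)\<^sup>2 \<le> \<bar>M * Q x\<bar>" using elim by (rule order_trans) simp
        then show ?case by simp
      qed
    qed (use DDm in simp)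
  qed
  have cs: "(\<lambda>k. \<integral>x. complex_of_real (lam k * h k x) * cis (c * x) \<partial>U) sums (\<integral>x. complex_of_real (H x) * cis (c * x) \<partial>U)"
    if h: "\<And>k. integrable U (\<lambda>x. lam k * h k x)" "summable (\<lambda>k. \<integral>x. norm (lam k * h k x) \<partial>U)"
      and H: "integrable U H" "AE x in U. (\<lambda>k. lam k * h k x) sums H x" for h H c
  proof (rule sums_integral_AE(2))
    show "integrable U (\<lambda>x. complex_of_real (lam k * h k x) * cis (c * x))" for k by (rule integrable_mult_cis[OF h(1)])
    show "summable (\<lambda>k. \<integral>x. norm (complex_of_real (lam k * h k x) * cis (c * x)) \<partial>U)"
      using h(2) by (simp only: norm_mult norm_cis norm_of_real mult_1_right real_norm_def)
    show "(\<lambda>x. complex_of_real (H x) * cis (c * x)) \<in> borel_measurable U" using integrable_mult_cis[OF H(1)] by auto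
    show "AE x in U. (\<lambda>k. complex_of_real (lam k * h k x) * cis (c * x)) sums (complex_of_real (H x) * cis (c * x))"
      using H(2) by eventually_elim (intro sums_mult2 sums_of_real)
  qed
  have wd: "weak_derivT \<rho> DD" unfolding weak_derivT_def
  proof (intro conjI \<rho>L DDL allI)
    fix j :: int
    let ?c = "- 2 * pi * of_int j"
    have "(\<integral>x. complex_of_real (lam k * D k x) * cis (?c * x) \<partial>U)
      = 2 * pi * \<i> * of_int j * (\<integral>x. complex_of_real (lam k * r k x) * cis (?c * x) \<partial>U)" for k
    proof -
      have "(\<integral>x. complex_of_real (D k x) * cis (?c * x) \<partial>U) = 2 * pi * \<i> * of_int j * (\<integral>x. complex_of_real (r k x) * cis (?c * x) \<partial>U)"
        using rD(1)[of k] unfolding weak_derivT_def by blast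
      then show ?thesis by (simp only: of_real_mult mult.assoc integral_mult_right_zero) (simp only: mult.left_commute)
    qed
    then have "(\<lambda>k. 2 * pi * \<i> * of_int j * (\<integral>x. complex_of_real (lam k * r k x) * cis (?c * x) \<partial>U)) sums (\<integral>x. complex_of_real (DD x) * cis (?c * x) \<partial>U)"
      using cs[OF lDi sD DDi DDs, of ?c] by (simp only:)
    moreover have "(\<lambda>k. 2 * pi * \<i> * of_int j * (\<integral>x. complex_of_real (lam k * r k x) * cis (?c * x) \<partial>U)) sums
       (2 * pi * \<i> * of_int j * (\<integral>x. complex_of_real (\<rho> x) * cis (?c * x) \<partial>U))"
      by (intro sums_mult cs lri sr \<rho>i \<rho>s')
    ultimately show "(\<integral>x. complex_of_real (DD x) * cis (?c * x) \<partial>U) = 2 * pi * \<i> * of_int j * (\<integral>x. complex_of_real (\<rho> x) * cis (?c * x) \<partial>U)"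
      by (rule sums_unique2)
  qed
  have "AE x in U. derivT \<rho> x = DD x" by (rule weak_derivT_unique[OF derivT_weak[OF wd] wd])
  then have gd: "(\<integral>x. g x * derivT \<rho> x \<partial>U) = (\<integral>x. g x * DD x \<partial>U)"
  proof (intro integral_cong_AE)
    assume "AE x in U. derivT \<rho> x = DD x"
    then show "AE x in U. g x * derivT \<rho> x = g x * DD x" by eventually_elim simp
  qed (use v(2) derivT_weak[OF wd] DDL in \<open>auto simp: weak_derivT_def L2T_def\<close>)
  have prod: "(\<lambda>k. lam k * (\<integral>x. w x * h k x \<partial>U)) sums (\<integral>x. w x * H x \<partial>U)"
    if w: "L2T w" and h: "\<And>k. L2T (h k)" "\<And>k. (\<integral>x. \<bar>w x * h k x\<bar> \<partial>U) \<le> C * m k"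
      and H: "L2T H" "AE x in U. (\<lambda>k. lam k * h k x) sums H x" for w h H C
  proof -
    have "(\<lambda>k. \<integral>x. lam k * (w x * h k x) \<partial>U) sums (\<integral>x. w x * H x \<partial>U)"
    proof (rule sums_integral_AE(2))
      show "integrable U (\<lambda>x. lam k * (w x * h k x))" for k
        using L2T_mult_bound(1)[OF w h(1), of 1 k] by (intro integrable_mult_right) simp
      show "summable (\<lambda>k. \<integral>x. norm (lam k * (w x * h k x)) \<partial>U)" by (rule wsm[OF h(2)])
      show "(\<lambda>x. w x * H x) \<in> borel_measurable U" using w H(1) by (auto simp: L2T_def)
      show "AE x in U. (\<lambda>k. lam k * (w x * h k x)) sums (w x * H x)"
        using H(2)
      proof eventually_elim
        case (elim x)
        show ?case using sums_mult[OF elim, of "w x"] by (simp only: mult.left_commute)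
      qed
    qed
    then show ?thesis by (simp only: integral_mult_right_zero)
  qed
  have "(\<lambda>k. lam k * (\<integral>x. f x * r k x \<partial>U) - lam k * (\<integral>x. g x * D k x \<partial>U)) sums ((\<integral>x. f x * \<rho> x \<partial>U) - (\<integral>x. g x * DD x \<partial>U))"
    by (rule sums_diff[OF prod[OF v(1) rL fr[OF v(1)] \<rho>L \<rho>s'] prod[OF v(2) DL gD[OF v(2)] DDL DDs]])
  then show ?thesis
    unfolding pairing_def fst_conv snd_conv gd by (simp only: r_def D_def right_diff_distrib)
qed

text \<open>A density matrix of infinite energy gives no constraint. For finite energy, T \<le> E
  makes the weighted kinetic energies summable, and the variational bounds for the components can be
  averaged.\<close>

theorem Ffun_le:
  assumes \<rho>: "\<rho> \<in> borel_measurable U"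
  shows "Ffun N W \<rho> \<le> F_DM N W \<rho>"
  unfolding F_DM_def
proof (rule INF_greatest)
  fix \<Gamma> assume "\<Gamma> \<in> dm_reps N \<rho>"
  then obtain lam Ps where rep: "(lam, Ps) \<in> dm_reps N \<rho>" and \<Gamma>: "\<Gamma> = (lam, Ps)" by (cases \<Gamma>) auto
  have lam0: "0 \<le> lam k" and lam1: "lam sums 1" and Ps: "Ps k \<in> Wset N" for k
    using rep by (auto simp: dm_reps_def)
  have V: "Ps k \<in> V" for k using Ps[of k] by (simp add: Wset_def)
  have E0: "0 \<le> lam k * E (Ps k)" for k using lam0 energy_nonneg[OF V] by simp
  let ?S = "\<Sum>k. ereal (lam k * E (Ps k))"
  have "Ffun N W \<rho> \<le> ?S"
  proof (cases "?S = \<infinity>")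
    case False
    have "summable (\<lambda>k. lam k * E (Ps k))"
      by (rule summable_ereal) (use E0 False in auto)
    then obtain e where e: "(\<lambda>k. lam k * E (Ps k)) sums e" by (auto simp: summable_def)
    have S: "?S = ereal e" using e by (intro sums_unique[symmetric]) (simp add: sums_ereal)
    have sk: "summable (\<lambda>k. lam k * kin N (Ps k))"
    proof (rule summable_comparison_test'[where g = "\<lambda>k. lam k * E (Ps k)" and N = 0])
      show "summable (\<lambda>k. lam k * E (Ps k))" using e by (rule sums_summable)
      show "norm (lam k * kin N (Ps k)) \<le> lam k * E (Ps k)" for k
        using lam0[of k] kin_nonneg[of N "Ps k"] kin_le_energy[OF V[of k]] by (simp add: mult_left_mono)
    qed
    show ?thesis unfolding Ffun_def
    proof (rule SUP_least)
      fix v :: "(real \<Rightarrow> real) \<times> (real \<Rightarrow> real)"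
      assume "v \<in> {v. L2T (fst v) \<and> L2T (snd v)}"
      then obtain f g where v: "v = (f, g)" "L2T f" "L2T g" by (cases v) auto
      have ps: "(\<lambda>k. lam k * pairing v (density N (Ps k))) sums pairing v \<rho>"
        unfolding v(1) by (rule pairing_sums[OF \<rho> rep sk v(2,3)])
      have le: "Efun N W v \<le> ereal (E (Ps k) + pairing v (density N (Ps k)))" for k
        unfolding Efun_def by (rule INF_lower[OF Ps])
      show "Efun N W v - ereal (pairing v \<rho>) \<le> ?S"
      proof (cases "Efun N W v")
        case (real w)
        have "w * 1 \<le> e + pairing v \<rho>"
        proof (rule sums_le[OF _ sums_mult[OF lam1] sums_add[OF e ps]])
          fix k
          have "w \<le> E (Ps k) + pairing v (density N (Ps k))" using le[of k] real by simp
          then have "lam k * w \<le> lam k * (E (Ps k) + pairing v (density N (Ps k)))" by (intro mult_left_mono lam0)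
          then show "w * lam k \<le> lam k * E (Ps k) + lam k * pairing v (density N (Ps k))" by (simp add: algebra_simps)
        qed
        then show ?thesis using real S by simp
      next
        case PInf
        then show ?thesis using le[of 0] by simp
      next
        case MInf
        then show ?thesis by simp
      qed
    qed
  qed simp
  then show "Ffun N W \<rho> \<le> (\<Sum>k. ereal (fst \<Gamma> k * E (snd \<Gamma> k)))" by (simp add: \<Gamma>)
qed

text \<open>The potential 0 is a competitor in the supremum and the energy is nonnegative; this
  excludes the value minus infinity.\<close>

lemma Ffun_nonneg: "0 \<le> Ffun N W \<rho>"
proof -
  let ?v = "(\<lambda>_. 0, \<lambda>_. 0) :: (real \<Rightarrow> real) \<times> (real \<Rightarrow> real)"
  have v: "?v \<in> {v. L2T (fst v) \<and> L2T (snd v)}" by (simp add: L2T_def)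
  have "0 \<le> Efun N W ?v"
    unfolding Efun_def by (rule INF_greatest) (auto simp: pairing_def Wset_def energy_nonneg)
  then have "0 \<le> Efun N W ?v - ereal (pairing ?v \<rho>)" by (simp add: pairing_def)
  also have "\<dots> \<le> Ffun N W \<rho>" unfolding Ffun_def by (rule SUP_upper[OF v])
  finally show ?thesis .
qed

end

theorem theorem4:
  fixes N :: nat and W :: "wavefn \<Rightarrow> wavefn \<Rightarrow> complex" and \<rho> :: "real \<Rightarrow> real"
  assumes "1 \<le> N"
    and "positive_sesq_form N W"
    and "kin_bounded_lt1 N W"
    and "\<rho> \<in> Iset N"
  shows "Ffun N W \<rho> = F_DM N W \<rho>"
proof -
  interpret hamiltonian N W by unfold_locales (fact assms)+
  have \<rho>: "\<rho> \<in> borel_measurable U" "integrable U \<rho>" using assms(4) by (auto simp: Iset_def)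
  have "F_DM N W \<rho> \<le> Ffun N W \<rho>"
  \<comment> \<open>The value plus infinity makes the inequality trivial, so the compactness
    argument concerns a finite \<open>c\<close>.\<close>
  proof (cases "Ffun N W \<rho>")
    case (real c)
    then show ?thesis using F_DM_le[OF \<rho>(2), of c] by simp
  next
    case MInf
    then show ?thesis using Ffun_nonneg[of \<rho>] by simp
  qed simp
  then show ?thesis using Ffun_le[OF \<rho>(1)] by (rule antisym[rotated])
qed

end
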